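(* Let $V$ be a complex Banach space, $R\subset V$ a closed convex cone and $C\subset V$ a complex cone such that: (C1) $C=\mathbb{C}^*R$ and $\overline{(R+iR)}\cap\overline{(R-iR)}=R$; (C2) $C$ is proper and contains at least two (complex) linearly independent vectors. Let $C_1\subset C$ be any complex subcone of $C$. Consider the three diameters of $C_1$ with respect to $\delta_C$, $d_C$ and $\tilde{d}_C$. If any one of these diameters is finite, then the two others are also finite.
   Context: $\mathbb{C}^*=\mathbb{C}\setminus\{0\}$ and $\hat{\mathbb{C}}$ is the Riemann sphere. A complex cone is a non-empty subset $C\subset V$ with $\mathbb{C}^*C\subset C$ (a complex subcone is a complex cone contained in $C$); it is proper if its closure contains no complex vector subspace of complex dimension 2. A closed convex cone $R\subset V$ is a closed non-empty subset with $R+R\subset R$ and $(0,\infty)R\subset R$. (Condition (C1) implies that $C$ is closed.) For $x,y\in C\setminus\{0\}$ let $E_C(x,y)=\{z\in\mathbb{C}: zx-y\notin C\}$. If $x,y$ are colinear, $\delta_C(x,y)=0$; if $x,y$ are linearly independent, $\delta_C(x,y)=\log(b/a)\in[0,\infty]$ with $b=\sup\{|z|:z\in E_C(x,y)\}\in(0,\infty]$, $a=\inf\{|z|:z\in E_C(x,y)\}\in[0,\infty)$ (equal to $\infty$ if $b=\infty$ or $a=0$). Let $L(x,y)=\{z\in\hat{\mathbb{C}}: zx-y\in C\}$, with the convention $\infty\in L(x,y)$, and let $\mathring{L}(x,y)$ be its interior in $\hat{\mathbb{C}}$ (under (C1)-(C2) it is simply connected when non-empty). The gauge $d_C$ (Rugh)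 is defined for $x,y\in C\setminus\{0\}$ by: $d_C(x,y)=0$ if $x,y$ are colinear; if $x,y$ are linearly independent and $0,\infty\in\mathring{L}(x,y)$, then $d_C(x,y)$ is the Poincaré distance between $0$ and $\infty$ in the hyperbolic Riemann surface $\mathring{L}(x,y)$, normalized to have Gaussian curvature $-1$ (on the unit disk the metric is $2|dz|/(1-|z|^2)$); $d_C(x,y)=\infty$ otherwise. $\tilde{d}_C(x,y)=\inf\big\{\sum_{k=0}^{n-1} d_C(x_k,x_{k+1}):\ n\ge 1,\ x_0=x,\ x_1,\dots,x_n=y\in C\setminus\{0\}\big\}$. The diameter of $C_1$ with respect to $\rho\in\{\delta_C,d_C,\tilde{d}_C\}$ is $\sup\{\rho(x,y): x,y\in C_1\setminus\{0\}\}$. *)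

theory Defs
  imports "HOL-Analysis.Analysis"
begin

section \<open>Complex Banach spaces\<close>

class complex_normed_vector = real_normed_vector +
  fixes scaleC :: "complex \<Rightarrow> 'a \<Rightarrow> 'a"  (infixr \<open>*\<^sub>C\<close> 75)
  assumes scaleC_add_right: "c *\<^sub>C (x + y) = c *\<^sub>C x + c *\<^sub>C y"
    and scaleC_add_left: "(b + c) *\<^sub>C x = b *\<^sub>C x + c *\<^sub>C x"
    and scaleC_scaleC: "b *\<^sub>C c *\<^sub>C x = (b * c) *\<^sub>C x"
    and scaleC_one: "1 *\<^sub>C x = x"
    and scaleR_scaleC: "r *\<^sub>R x = complex_of_real r *\<^sub>C x"
    and norm_scaleC: "norm (c *\<^sub>C x) = cmod c * norm x"

class cbanach = complex_normed_vector + banach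

interpretation complex_vector: vector_space "scaleC :: complex \<Rightarrow> 'a \<Rightarrow> 'a::complex_normed_vector"
  by unfold_locales (simp_all add: scaleC_add_right scaleC_add_left scaleC_scaleC scaleC_one)

definition lin_indep2 :: "'a::complex_normed_vector \<Rightarrow> 'a \<Rightarrow> bool" where
  "lin_indep2 x y \<longleftrightarrow> x \<noteq> y \<and> complex_vector.independent {x, y}"

section \<open>Cones\<close>

definition closed_convex_cone :: "'a::real_normed_vector set \<Rightarrow> bool" where
  "closed_convex_cone R \<longleftrightarrow> closed R \<and> R \<noteq> {} \<and> (\<forall>x\<in>R. \<forall>y\<in>R. x + y \<in> R) \<and>
     (\<forall>r>0. \<forall>x\<in>R. r *\<^sub>R x \<in> R)"

definition cplx_cone :: "'a::complex_normed_vector set \<Rightarrow> bool" where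
  "cplx_cone C \<longleftrightarrow> C \<noteq> {} \<and> (\<forall>c. c \<noteq> 0 \<longrightarrow> (\<forall>x\<in>C. c *\<^sub>C x \<in> C))"

definition proper_cone :: "'a::complex_normed_vector set \<Rightarrow> bool" where
  "proper_cone C \<longleftrightarrow>
     \<not> (\<exists>W. complex_vector.subspace W \<and> complex_vector.dim W = 2 \<and> W \<subseteq> closure C)"

definition condition_C1 :: "'a::complex_normed_vector set \<Rightarrow> 'a set \<Rightarrow> bool" where
  "condition_C1 R C \<longleftrightarrow>
     C = {c *\<^sub>C x | c x. c \<noteq> 0 \<and> x \<in> R} \<and>
     closure {x + \<i> *\<^sub>C y | x y. x \<in> R \<and> y \<in> R} \<inter>
       closure {x - \<i> *\<^sub>C y | x y. x \<in> R \<and> y \<in> R} = R"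

definition condition_C2 :: "'a::complex_normed_vector set \<Rightarrow> bool" where
  "condition_C2 C \<longleftrightarrow> proper_cone C \<and> (\<exists>x\<in>C. \<exists>y\<in>C. lin_indep2 x y)"

section \<open>The gauge \<open>\<delta>\<close>\<close>

definition E_set :: "'a::complex_normed_vector set \<Rightarrow> 'a \<Rightarrow> 'a \<Rightarrow> complex set" where
  "E_set C x y = {z. z *\<^sub>C x - y \<notin> C}"

definition delta_gauge :: "'a::complex_normed_vector set \<Rightarrow> 'a \<Rightarrow> 'a \<Rightarrow> ennreal" where
  "delta_gauge C x y =
    (if \<not> lin_indep2 x y then 0
     else let b = (SUP z\<in>E_set C x y. ennreal (cmod z));
              a = (INF z\<in>E_set C x y. ennreal (cmod z))
          in if b = \<infinity> \<or> a = 0 then \<infinity> else ennreal (ln (enn2real b / enn2real a)))"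

section \<open>The Riemann sphere and its Poincare distances\<close>

text \<open>The Riemann sphere is the one-point compactification of the complex plane, with
  \<^term>\<open>None\<close> as the point at infinity.\<close>

instantiation option :: (topological_space) topological_space
begin

definition open_option :: "'a option set \<Rightarrow> bool" where
  "open_option U \<longleftrightarrow> openin (Alexandroff_compactification euclidean) U"

instance
proof
  have "topspace (Alexandroff_compactification (euclidean :: 'a topology)) = UNIV"
    by (auto simp: topspace_Alexandroff_compactification) (metis option.exhaust rangeI)
  then show "open (UNIV :: 'a option set)"
    unfolding open_option_def by (metis openin_topspace)
qed (auto simp: open_option_def)

end

type_synonym riemann_sphere = "complex option"

text \<open>Holomorphy on an open subset of the plane is tested in the charts \<open>w \<mapsto> w\<close> and \<open>w \<mapsto> 1/w\<close>.
  In the second chart infinity is correctly sent to 0. The values given to the points outside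
  the charts (infinity in the first, 0 in the second) are irrelevant: by continuity \<open>f\<close> does not
  take them near the point at which differentiability is tested.\<close>

definition holomorphic_to_sphere :: "(complex \<Rightarrow> riemann_sphere) \<Rightarrow> complex set \<Rightarrow> bool" where
  "holomorphic_to_sphere f S \<longleftrightarrow> open S \<and> continuous_on S f \<and>
     (\<forall>z\<in>S.
        (f z \<noteq> None \<longrightarrow> (\<lambda>w. case f w of Some u \<Rightarrow> u | None \<Rightarrow> 0) field_differentiable at z) \<and>
        (f z = None \<longrightarrow> (\<lambda>w. case f w of Some u \<Rightarrow> inverse u | None \<Rightarrow> 0) field_differentiable at z))"

text \<open>The length is a nonnegative Lebesgue integral, so that a piecewise \<open>C\<^sup>1\<close> path whose derivative
  is not absolutely integrable near a break point has length \<open>\<infinity>\<close>.\<close>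

definition disk_length :: "(real \<Rightarrow> complex) \<Rightarrow> ennreal" where
  "disk_length g =
     (\<integral>\<^sup>+ t\<in>{0..1}. ennreal (2 * cmod (vector_derivative g (at t)) / (1 - (cmod (g t))\<^sup>2)) \<partial>lborel)"

definition disk_distance :: "complex \<Rightarrow> complex \<Rightarrow> ennreal" where
  "disk_distance z w =
     Inf {disk_length g | g. valid_path g \<and> path_image g \<subseteq> ball 0 1 \<and>
                             pathstart g = z \<and> pathfinish g = w}"

text \<open>The Poincare metric of a hyperbolic surface is the one that makes a holomorphic universal
  covering by the unit disk a local isometry; the distance of two points is therefore the
  infimum of the distances of their lifts. All such coverings differ by an automorphism
  of the disk, so letting \<open>f\<close> range over all of them in the infimum does not change it. If the
  surface is simply connected, they are the biholomorphic maps from the disk.\<close>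

definition poincare_distance :: "riemann_sphere set \<Rightarrow> riemann_sphere \<Rightarrow> riemann_sphere \<Rightarrow> ennreal" where
  "poincare_distance S p q =
     Inf {disk_distance z w | f z w.
            holomorphic_to_sphere f (ball 0 1) \<and> covering_space (ball 0 1) f S \<and>
            z \<in> ball 0 1 \<and> w \<in> ball 0 1 \<and> f z = p \<and> f w = q}"

section \<open>The gauges \<open>d\<close> and \<open>d~\<close>\<close>

definition L_set :: "'a::complex_normed_vector set \<Rightarrow> 'a \<Rightarrow> 'a \<Rightarrow> riemann_sphere set" where
  "L_set C x y = insert None (Some ` {z. z *\<^sub>C x - y \<in> C})"

definition d_gauge :: "'a::complex_normed_vector set \<Rightarrow> 'a \<Rightarrow> 'a \<Rightarrow> ennreal" where
  "d_gauge C x y =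
    (if \<not> lin_indep2 x y then 0
     else if Some 0 \<in> interior (L_set C x y) \<and> None \<in> interior (L_set C x y)
       then poincare_distance (interior (L_set C x y)) (Some 0) None
     else \<infinity>)"

definition d_tilde :: "'a::complex_normed_vector set \<Rightarrow> 'a \<Rightarrow> 'a \<Rightarrow> ennreal" where
  "d_tilde C x y =
     Inf {\<Sum>k<n. d_gauge C (X k) (X (Suc k)) | n (X :: nat \<Rightarrow> 'a).
            n \<ge> 1 \<and> X 0 = x \<and> X n = y \<and> (\<forall>k\<le>n. X k \<in> C - {0})}"

definition cone_diameter :: "('a::zero \<Rightarrow> 'a \<Rightarrow> ennreal) \<Rightarrow> 'a set \<Rightarrow> ennreal" where
  "cone_diameter \<rho> A = (SUP x\<in>A - {0}. SUP y\<in>A - {0}. \<rho> x y)"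

end

theory Submission
  imports Defs "HOL-Complex_Analysis.Complex_Analysis"
begin

text \<open>By the Hahn-Banach theorem and (C1), \<open>R\<close> consists of the vectors that are mapped into a
  fixed quadrant by all forms of a convex cone \<open>M\<close> of complex linear forms. Therefore \<open>v \<in> C\<close> iff
  \<open>0 \<le> Re (m v * cnj (l v))\<close> for all \<open>m\<close> and \<open>l\<close> in \<open>M\<close> (\<open>C_iff\<close>): if the values of the forms
  at \<open>v\<close> pairwise enclose at most a right angle, a common rotation moves them into the quadrant.
  So \<open>E(x,y)\<close> is a union of disks and half-planes given by pairs of forms. The theorem follows from
  two comparisons and the obvious inequality \<open>d_tilde \<le> d\<close>.

  The first comparison is \<open>\<delta> \<le> 6 d_tilde\<close> (\<open>delta_gauge_le_d_tilde\<close>). A quotient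
  \<open>m (z x - y) / l (z x - y)\<close> of forms maps the interior of \<open>L(x,y)\<close> to the right half-plane, so a
  hyperbolic length in this interior bounds the change of \<open>ln \<bar>m/l - w\<bar>\<close> between \<open>x\<close> and \<open>y\<close> when
  \<open>Re w < 0\<close> (\<open>log_ratio_le_d_gauge\<close>). Such changes add up along a chain, and each point of
  \<open>E(x,y)\<close> is a ratio \<open>f y / f x\<close> with \<open>f = m - w l\<close>; hence the points of \<open>E(x,y)\<close> have comparable
  moduli.

  The second comparison bounds \<open>d\<close> in terms of \<open>\<delta>\<close> (\<open>d_gauge_bound\<close>). If \<open>\<delta>(x,y)\<close> is finite,
  then \<open>E(x,y)\<close> lies in an annulus \<open>a \<le> \<bar>z\<bar> \<le> K a\<close>. The interior of \<open>L(x,y)\<close> contains the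
  complement of the annulus and, because \<open>R\<close> is convex, a sector whose opening depends only on \<open>K\<close>
  (\<open>sector_avoids_X\<close>). Thus \<open>0\<close> and infinity are joined by three holomorphic disks of a shape
  that depends only on \<open>K\<close>, and the Schwarz-Pick lemma bounds their distance. This lemma is applied
  to a Riemann map, which exists because the interior of \<open>L(x,y)\<close> is simply connected
  (\<open>simply_connected_U\<close>): it is connected since \<open>R\<close> is convex, and its complement is
  connected since \<open>M\<close> is convex.\<close>

section \<open>Separation of a point from a closed convex cone\<close>

definition sublinear :: "('a::real_vector \<Rightarrow> real) \<Rightarrow> bool" where
  "sublinear p \<longleftrightarrow> (\<forall>x y. p (x + y) \<le> p x + p y) \<and> (\<forall>r>0. \<forall>x. p (r *\<^sub>R x) \<le> r * p x)"

lemma sublinear_add: "sublinear p \<Longrightarrow> p (x + y) \<le> p x + p y"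
  by (simp add: sublinear_def)

lemma sublinear_scaleR:
  assumes "sublinear p" "r > 0" shows "p (r *\<^sub>R x) = r * p x"
proof (rule antisym)
  show "p (r *\<^sub>R x) \<le> r * p x" using assms by (simp add: sublinear_def)
  have "p ((1/r) *\<^sub>R (r *\<^sub>R x)) \<le> (1/r) * p (r *\<^sub>R x)"
    using assms unfolding sublinear_def by (metis zero_less_divide_1_iff)
  then show "r * p x \<le> p (r *\<^sub>R x)"
    using assms(2) by (simp add: field_simps)
qed

lemma sublinear_0: "sublinear p \<Longrightarrow> p 0 = 0"
  using sublinear_scaleR[of p 2 0] by simp

lemma sublinear_minus: "sublinear p \<Longrightarrow> - p (- x) \<le> p x"
  using sublinear_add[of p x "- x"] sublinear_0[of p] by simp

text \<open>The function \<open>q'\<close> is the infimum of \<open>q (x + t y) - t q y\<close> over \<open>t \<ge> 0\<close>: it lowers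
  \<open>q\<close> until it is linear along the ray of \<open>y\<close>. A minimal sublinear function admits no
  proper lowering, and this is what makes it linear.\<close>

lemma sublinear_shift:
  fixes q :: "'a::real_vector \<Rightarrow> real"
  assumes q: "sublinear q"
  obtains q' where "sublinear q'" "\<And>x. q' x \<le> q x" "q' (- y) \<le> - q y"
proof -
  define g where "g x t = q (x + t *\<^sub>R y) - t * q y" for x and t :: real
  define q' where "q' x = (INF t\<in>{0..}. g x t)" for x
  have sc: "q (t *\<^sub>R z) = t * q z" if "t \<ge> 0" for t z
    using sublinear_scaleR[OF q, of t z] sublinear_0[OF q] that by (cases "t = 0") auto
  have bd: "- q (- x) \<le> g x t" if "t \<ge> 0" for x t
    using sublinear_add[OF q, of "x + t *\<^sub>R y" "- x"] sc[OF that, of y] by (simp add: g_def)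
  have bdd: "bdd_below (g x ` {0..})" for x
    using bd by (auto simp: bdd_below_def)
  have le: "q' x \<le> g x t" if "t \<ge> 0" for x t
    unfolding q'_def using that by (intro cINF_lower bdd) auto
  have ge: "c \<le> q' x" if "\<And>t. t \<ge> 0 \<Longrightarrow> c \<le> g x t" for c x
    unfolding q'_def using that by (intro cINF_greatest) auto
  have "q' (x1 + x2) \<le> q' x1 + q' x2" for x1 x2
  proof -
    have "q' (x1 + x2) \<le> g x1 t1 + g x2 t2" if "t1 \<ge> 0" "t2 \<ge> 0" for t1 t2
    proof -
      have "q' (x1 + x2) \<le> g (x1 + x2) (t1 + t2)" using that by (intro le) auto
      also have "\<dots> \<le> g x1 t1 + g x2 t2"
        using sublinear_add[OF q, of "x1 + t1 *\<^sub>R y" "x2 + t2 *\<^sub>R y"]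
        by (simp add: g_def algebra_simps)
      finally show ?thesis .
    qed
    then have "q' (x1 + x2) - g x1 t1 \<le> q' x2" if "t1 \<ge> 0" for t1
      using that by (intro ge) (simp add: algebra_simps)
    then have "q' (x1 + x2) - q' x2 \<le> q' x1"
      by (intro ge) (simp add: algebra_simps)
    then show ?thesis by simp
  qed
  moreover have "q' (r *\<^sub>R x) \<le> r * q' x" if "r > 0" for r x
  proof -
    have "q' (r *\<^sub>R x) / r \<le> q' x"
    proof (rule ge)
      fix t :: real assume "t \<ge> 0"
      then have "q' (r *\<^sub>R x) \<le> g (r *\<^sub>R x) (r * t)" using that by (intro le) auto
      also have "\<dots> = r * g x t"
        using sublinear_scaleR[OF q that, of "x + t *\<^sub>R y"] by (simp add: g_def algebra_simps)
      finally show "q' (r *\<^sub>R x) / r \<le> g x t" using that by (simp add: field_simps)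
    qed
    then show ?thesis using that by (simp add: field_simps)
  qed
  ultimately have "sublinear q'" by (simp add: sublinear_def)
  moreover have "q' x \<le> q x" for x using le[of 0 x] by (simp add: g_def)
  moreover have "q' (- y) \<le> - q y" using le[of 1 "- y"] sublinear_0[OF q] by (simp add: g_def)
  ultimately show thesis by (rule that)
qed

lemma minimal_sublinear_linear:
  assumes q: "sublinear q" and min: "\<And>q'. sublinear q' \<Longrightarrow> q' \<le> q \<Longrightarrow> q' = q"
  shows "linear q"
proof -
  have neg: "q (- y) = - q y" for y
  proof -
    obtain q' where "sublinear q'" "\<And>x. q' x \<le> q x" "q' (- y) \<le> - q y"
      using sublinear_shift[OF q] by blast
    then have "q (- y) \<le> - q y" using min[of q'] by (auto simp: le_fun_def)
    then show ?thesis using sublinear_minus[OF q, of y] by simp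
  qed
  have add: "q (x + y) = q x + q y" for x y
    using sublinear_add[OF q, of x y] sublinear_add[OF q, of "- x" "- y"] neg[of "x + y"] neg[of x] neg[of y]
    by simp
  have "q (r *\<^sub>R x) = r * q x" for r x
    using sublinear_scaleR[OF q, of r x] sublinear_scaleR[OF q, of "- r" x] neg[of "r *\<^sub>R x"] sublinear_0[OF q]
    by (cases r "0::real" rule: linorder_cases) auto
  then show ?thesis using add by (intro linearI) auto
qed

text \<open>Zorn's lemma applies to the sublinear functions below \<open>p\<close>, ordered downwards: a chain has its
  pointwise infimum as a bound, which is finite because every \<open>q \<le> p\<close> satisfies
  \<open>q x \<ge> - q (- x) \<ge> - p (- x)\<close>.\<close>

lemma minimal_sublinear_exists:
  assumes p: "sublinear (p :: 'a::real_vector \<Rightarrow> real)"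
  obtains q where "sublinear q" "q \<le> p" "\<And>q'. sublinear q' \<Longrightarrow> q' \<le> q \<Longrightarrow> q' = q"
proof -
  define A where "A = {q. sublinear q \<and> q \<le> p}"
  let ?P = "\<lambda>f g :: 'a \<Rightarrow> real. g \<le> f"
  have "\<exists>m\<in>A. \<forall>a\<in>A. a \<le> m \<longrightarrow> a = m"
  proof (rule predicate_Zorn)
    show "partial_order_on A (relation_of ?P A)"
      by (rule partial_order_on_relation_ofI) auto
    fix \<C> assume ch: "\<C> \<in> Chains (relation_of ?P A)"
    then have CA: "\<C> \<subseteq> A" by (auto simp: Chains_def relation_of_def)
    have tot: "f \<le> g \<or> g \<le> f" if "f \<in> \<C>" "g \<in> \<C>" for f g
      using ch that by (auto simp: Chains_def relation_of_def)
    show "\<exists>u\<in>A. \<forall>a\<in>\<C>. u \<le> a"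
    proof (cases "\<C> = {}")
      case True then show ?thesis using p by (auto simp: A_def)
    next
      case False
      define u where "u x = (INF q\<in>\<C>. q x)" for x
      have "- p (- x) \<le> q x" if "q \<in> \<C>" for q x
      proof -
        have "sublinear q" "q (- x) \<le> p (- x)" using that CA by (auto simp: A_def le_fun_def)
        then show ?thesis using sublinear_minus[of q x] by linarith
      qed
      then have bdd: "bdd_below ((\<lambda>q. q x) ` \<C>)" for x by (auto simp: bdd_below_def)
      have le: "u x \<le> q x" if "q \<in> \<C>" for x q
        unfolding u_def using that by (intro cINF_lower bdd) auto
      have ge: "c \<le> u x" if "\<And>q. q \<in> \<C> \<Longrightarrow> c \<le> q x" for c x
        unfolding u_def using that False by (intro cINF_greatest) auto
      have "u (x + y) \<le> u x + u y" for x y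
      proof -
        have "u (x + y) \<le> f x + g y" if fg: "f \<in> \<C>" "g \<in> \<C>" for f g
        proof -
          obtain h where h: "h \<in> \<C>" "h \<le> f" "h \<le> g" using tot[OF fg] fg by blast
          have "u (x + y) \<le> h (x + y)" by (rule le[OF h(1)])
          also have "\<dots> \<le> h x + h y" using h(1) CA by (auto simp: A_def intro: sublinear_add)
          also have "\<dots> \<le> f x + g y" using h by (auto simp: le_fun_def intro: add_mono)
          finally show ?thesis .
        qed
        then have *: "u (x + y) - f x \<le> g y" if "f \<in> \<C>" "g \<in> \<C>" for f g
          using that by (simp add: diff_le_eq add.commute)
        have "u (x + y) - f x \<le> u y" if "f \<in> \<C>" for f
          using that by (intro ge *)
        then have "u (x + y) - u y \<le> f x" if "f \<in> \<C>" for f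
          using that by (simp add: diff_le_eq add.commute)
        then have "u (x + y) - u y \<le> u x" by (intro ge)
        then show ?thesis by simp
      qed
      moreover have "u (r *\<^sub>R x) \<le> r * u x" if "r > 0" for r x
      proof -
        have "u (r *\<^sub>R x) / r \<le> u x"
        proof (rule ge)
          fix q assume "q \<in> \<C>"
          moreover from this have "q (r *\<^sub>R x) = r * q x"
            using CA that by (auto simp: A_def intro: sublinear_scaleR)
          ultimately show "u (r *\<^sub>R x) / r \<le> q x"
            using le[of q "r *\<^sub>R x"] that by (simp add: field_simps)
        qed
        then show ?thesis using that by (simp add: field_simps)
      qed
      moreover obtain q0 where "q0 \<in> \<C>" using False by blast
      then have "u x \<le> q0 x" "q0 x \<le> p x" for x
        using le[of q0] CA by (auto simp: A_def le_fun_def)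
      then have "u \<le> p" by (auto simp: le_fun_def intro: order_trans)
      ultimately have "u \<in> A" by (simp add: A_def sublinear_def)
      then show ?thesis using le by (auto simp: le_fun_def)
    qed
  qed
  then obtain q where "q \<in> A" "\<And>a. a \<in> A \<Longrightarrow> a \<le> q \<Longrightarrow> a = q" by blast
  then show thesis by (intro that[of q]) (auto simp: A_def intro: order_trans)
qed

text \<open>Lowering \<open>p\<close> along \<open>v\<close> before taking a minimal function forces the value \<open>p v\<close> at \<open>v\<close>.\<close>

theorem Hahn_Banach_sublinear:
  assumes p: "sublinear (p :: 'a::real_vector \<Rightarrow> real)"
  obtains f where "linear f" "\<And>x. f x \<le> p x" "f v = p v"
proof -
  obtain p' where p': "sublinear p'" "\<And>x. p' x \<le> p x" "p' (- v) \<le> - p v"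
    using sublinear_shift[OF p] by blast
  obtain f where f: "sublinear f" "f \<le> p'" "\<And>q'. sublinear q' \<Longrightarrow> q' \<le> f \<Longrightarrow> q' = f"
    using minimal_sublinear_exists[OF p'(1)] by blast
  have lin: "linear f" by (rule minimal_sublinear_linear) (use f in auto)
  have le: "f x \<le> p x" for x using f(2) p'(2)[of x] by (meson le_fun_def order_trans)
  have "f (- v) \<le> - p v" using f(2) p'(3) by (meson le_fun_def order_trans)
  then have "f v = p v" using le[of v] linear_neg[OF lin, of v] by simp
  with lin le show thesis by (rule that)
qed

lemma infdist_almost_attained:
  assumes "infdist x A < c" "A \<noteq> {}"
  obtains a where "a \<in> A" "dist x a < c"
  using assms cInf_lessD[of "dist x ` A" c] by (auto simp: infdist_notempty)

text \<open>The distance of \<open>- x\<close> to \<open>A\<close> is sublinear, vanishes on \<open>- A\<close> and is positive at \<open>- v\<close>; a linear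
  function below it that agrees with it at \<open>- v\<close> separates.\<close>

theorem closed_convex_cone_separation:
  fixes A :: "'a::real_normed_vector set"
  assumes A: "closed_convex_cone A" and v: "v \<notin> A"
  obtains f where "linear f" "\<forall>x\<in>A. 0 \<le> f x" "f v < (0::real)"
proof -
  have cl: "closed A" and ne: "A \<noteq> {}" and add: "\<And>x y. x \<in> A \<Longrightarrow> y \<in> A \<Longrightarrow> x + y \<in> A"
    and sc: "\<And>r x. r > 0 \<Longrightarrow> x \<in> A \<Longrightarrow> r *\<^sub>R x \<in> A"
    using A by (auto simp: closed_convex_cone_def)
  define p where "p x = infdist (- x) A" for x
  have "p (x + y) \<le> p x + p y" for x y
  proof (rule field_le_epsilon)
    fix e :: real assume "e > 0"
    then obtain a b where ab: "a \<in> A" "dist (- x) a < p x + e/2" "b \<in> A" "dist (- y) b < p y + e/2"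
      using infdist_almost_attained[of "- x" A "p x + e/2"]
        infdist_almost_attained[of "- y" A "p y + e/2"] ne unfolding p_def
      by (metis half_gt_zero less_add_same_cancel1)
    have "p (x + y) \<le> dist (- (x + y)) (a + b)" unfolding p_def
      using ab add by (intro infdist_le) auto
    also have "\<dots> \<le> dist (- x) a + dist (- y) b"
      using norm_triangle_ineq[of "- x - a" "- y - b"] by (simp add: dist_norm algebra_simps)
    finally show "p (x + y) \<le> p x + p y + e" using ab by linarith
  qed
  moreover have "p (r *\<^sub>R x) \<le> r * p x" if r: "r > 0" for r x
  proof (rule field_le_epsilon)
    fix e :: real assume "e > 0"
    then obtain a where a: "a \<in> A" "dist (- x) a < p x + e/r"
      using infdist_almost_attained[of "- x" A "p x + e/r"] ne r unfolding p_def
      by (metis divide_pos_pos less_add_same_cancel1)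
    have "p (r *\<^sub>R x) \<le> dist (- (r *\<^sub>R x)) (r *\<^sub>R a)" unfolding p_def
      using a sc r by (intro infdist_le) auto
    also have "\<dots> = norm (r *\<^sub>R (- x - a))"
      by (simp add: dist_norm algebra_simps)
    also have "\<dots> = r * dist (- x) a" using r by (simp only: norm_scaleR dist_norm abs_of_pos)
    also have "\<dots> \<le> r * (p x + e/r)" using a r by (intro mult_left_mono) auto
    also have "\<dots> = r * p x + e" using r by (simp add: field_simps)
    finally show "p (r *\<^sub>R x) \<le> r * p x + e" .
  qed
  ultimately have "sublinear p" by (simp add: sublinear_def)
  then obtain f where f: "linear f" "\<And>x. f x \<le> p x" "f (- v) = p (- v)"
    using Hahn_Banach_sublinear by blast
  have "0 < p (- v)" using v cl ne infdist_pos_not_in_closed[OF cl ne v] by (simp add: p_def)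
  then have "f v < 0" using f(3) linear_neg[OF f(1), of v] by simp
  moreover have "0 \<le> f x" if "x \<in> A" for x
    using f(2)[of "- x"] linear_neg[OF f(1), of x] that by (simp add: p_def)
  ultimately show thesis using f(1) by (intro that) auto
qed

section \<open>Linear forms with values in a quadrant\<close>

definition clinear_form :: "('a::complex_normed_vector \<Rightarrow> complex) \<Rightarrow> bool" where
  "clinear_form m \<longleftrightarrow> (\<forall>x y. m (x + y) = m x + m y) \<and> (\<forall>c x. m (c *\<^sub>C x) = c * m x)"

lemma clinear_form_add: "clinear_form m \<Longrightarrow> m (x + y) = m x + m y"
  and clinear_form_scale: "clinear_form m \<Longrightarrow> m (c *\<^sub>C x) = c * m x"
  by (auto simp: clinear_form_def)

lemma clinear_form_0: "clinear_form m \<Longrightarrow> m 0 = 0"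
  using clinear_form_add[of m 0 0] by simp

lemma clinear_form_minus: "clinear_form m \<Longrightarrow> m (- x) = - m x"
  using clinear_form_scale[of m "-1" x] by simp

lemma clinear_form_diff: "clinear_form m \<Longrightarrow> m (x - y) = m x - m y"
  using clinear_form_add[of m x "- y"] by (simp add: clinear_form_minus)

lemmas clinear_form_simps =
  clinear_form_add clinear_form_scale clinear_form_0 clinear_form_minus clinear_form_diff

lemma scaleC_Re_Im: "c *\<^sub>C x = Re c *\<^sub>R x + Im c *\<^sub>R (\<i> *\<^sub>C x)"
proof -
  have "of_real (Re c) + of_real (Im c) * \<i> = c" by (simp add: complex_eq_iff)
  then have "c *\<^sub>C x = (of_real (Re c) + of_real (Im c) * \<i>) *\<^sub>C x" by simp
  then show ?thesis by (simp only: scaleR_scaleC scaleC_scaleC complex_vector.scale_left_distrib)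
qed

text \<open>A real linear form \<open>n\<close> is the real part of the complex linear form
  \<open>n x - \<i> n (\<i> x)\<close>.\<close>

lemma clinear_form_of_real_linear:
  assumes "linear (n :: 'a::complex_normed_vector \<Rightarrow> real)"
  shows "clinear_form (\<lambda>x. Complex (n x) (- n (\<i> *\<^sub>C x)))"
proof -
  have ii: "\<i> *\<^sub>C \<i> *\<^sub>C x = - x" for x :: 'a by (simp add: scaleC_scaleC)
  have re: "n (c *\<^sub>C x) = Re c * n x + Im c * n (\<i> *\<^sub>C x)" for c x
    by (subst scaleC_Re_Im) (simp add: linear_add[OF assms] linear_scale[OF assms])
  have im: "n (\<i> *\<^sub>C c *\<^sub>C x) = Re c * n (\<i> *\<^sub>C x) - Im c * n x" for c x
  proof -
    have "\<i> *\<^sub>C c *\<^sub>C x = c *\<^sub>C \<i> *\<^sub>C x" by (simp add: scaleC_scaleC mult.commute)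
    then show ?thesis unfolding re[of c "\<i> *\<^sub>C x"] ii
      using re[of c "\<i> *\<^sub>C x"] by (simp only: ii linear_neg[OF assms])
  qed
  have add: "n (\<i> *\<^sub>C (x + y)) = n (\<i> *\<^sub>C x) + n (\<i> *\<^sub>C y)" for x y
    by (simp add: complex_vector.scale_right_distrib linear_add[OF assms])
  show ?thesis
    unfolding clinear_form_def
  proof (intro conjI allI)
    show "Complex (n (x + y)) (- n (\<i> *\<^sub>C (x + y))) =
        Complex (n x) (- n (\<i> *\<^sub>C x)) + Complex (n y) (- n (\<i> *\<^sub>C y))" for x y
      by (simp only: add linear_add[OF assms] complex_add) simp
    show "Complex (n (c *\<^sub>C x)) (- n (\<i> *\<^sub>C c *\<^sub>C x)) = c * Complex (n x) (- n (\<i> *\<^sub>C x))" for c x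
      unfolding im re[of c x] by (simp add: complex_eq_iff)
  qed
qed

text \<open>A complex linear form \<open>m\<close> satisfies \<open>0 \<le> Re m\<close> on \<open>R + \<i>R\<close> iff it maps \<open>R\<close> into this
  quadrant, because \<open>Re (m (\<i> y)) = - Im (m y)\<close>.\<close>

definition quadrant :: "complex set" where
  "quadrant = {z. 0 \<le> Re z \<and> Im z \<le> 0}"

lemma quadrant_add: "p \<in> quadrant \<Longrightarrow> q \<in> quadrant \<Longrightarrow> p + q \<in> quadrant"
  by (auto simp: quadrant_def)

lemma quadrant_scale: "p \<in> quadrant \<Longrightarrow> 0 \<le> r \<Longrightarrow> of_real r * p \<in> quadrant"
  by (auto simp: quadrant_def intro: mult_nonneg_nonpos)

lemma quadrant_add_eq_0: "p \<in> quadrant \<Longrightarrow> q \<in> quadrant \<Longrightarrow> p + q = 0 \<Longrightarrow> p = 0"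
  by (auto simp: quadrant_def complex_eq_iff)

lemma quadrant_angle: "p \<in> quadrant \<Longrightarrow> q \<in> quadrant \<Longrightarrow> 0 \<le> Re (p * cnj q)"
  by (auto simp: quadrant_def mult_nonpos_nonpos)

definition quadrant_forms :: "'a::complex_normed_vector set \<Rightarrow> ('a \<Rightarrow> complex) set" where
  "quadrant_forms R = {m. clinear_form m \<and> (\<forall>x\<in>R. m x \<in> quadrant)}"

lemma quadrant_forms_linear: "m \<in> quadrant_forms R \<Longrightarrow> clinear_form m"
  and quadrant_forms_mem: "m \<in> quadrant_forms R \<Longrightarrow> x \<in> R \<Longrightarrow> m x \<in> quadrant"
  by (auto simp: quadrant_forms_def)

lemma quadrant_forms_combine:
  assumes "m \<in> quadrant_forms R" "l \<in> quadrant_forms R" "0 \<le> r" "0 \<le> s"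
  shows "(\<lambda>x. of_real r * m x + of_real s * l x) \<in> quadrant_forms R"
  using assms unfolding quadrant_forms_def clinear_form_def
  by (simp add: quadrant_add quadrant_scale distrib_left mult.left_commute)

lemma closed_convex_cone_closure:
  fixes S :: "'a::real_normed_vector set"
  assumes ne: "S \<noteq> {}" and add: "\<And>x y. x \<in> S \<Longrightarrow> y \<in> S \<Longrightarrow> x + y \<in> S"
    and sc: "\<And>r x. r > 0 \<Longrightarrow> x \<in> S \<Longrightarrow> r *\<^sub>R x \<in> S"
  shows "closed_convex_cone (closure S)"
proof -
  have "(\<lambda>p. fst p + snd p) ` closure (S \<times> S) \<subseteq> closure S"
  proof (rule image_closure_subset)
    show "(\<lambda>p. fst p + snd p) ` (S \<times> S) \<subseteq> closure S"
      using add closure_subset by fastforce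
  qed (auto intro!: continuous_intros)
  then have a: "x + y \<in> closure S" if "x \<in> closure S" "y \<in> closure S" for x y
    using that unfolding closure_Times by force
  have b: "r *\<^sub>R x \<in> closure S" if r: "r > 0" and x: "x \<in> closure S" for r x
  proof -
    have "(\<lambda>x. r *\<^sub>R x) ` closure S \<subseteq> closure S"
    proof (rule image_closure_subset)
      show "(\<lambda>x. r *\<^sub>R x) ` S \<subseteq> closure S"
        using sc[OF r] closure_subset by blast
    qed (auto intro!: continuous_intros)
    then show ?thesis using x by blast
  qed
  show ?thesis unfolding closed_convex_cone_def using a b ne by simp
qed

lemma closed_convex_cone_0:
  assumes "closed_convex_cone R" shows "0 \<in> R"
proof -
  obtain x where x: "x \<in> R" and cl: "closed R" and sc: "\<And>r x. r > 0 \<Longrightarrow> x \<in> R \<Longrightarrow> r *\<^sub>R x \<in> R"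
    using assms by (auto simp: closed_convex_cone_def)
  define f where "f n = inverse (real (Suc n)) *\<^sub>R x" for n
  have "f \<longlonglongrightarrow> 0 *\<^sub>R x" unfolding f_def
    by (intro tendsto_scaleR LIMSEQ_inverse_real_of_nat tendsto_const)
  then have "f \<longlonglongrightarrow> 0" by simp
  moreover have "f n \<in> R" for n unfolding f_def by (intro sc x) simp
  ultimately show ?thesis by (rule closed_sequentially[OF cl, rotated])
qed

text \<open>Numbers that pairwise enclose an angle of at most \<open>\<pi>/2\<close> lie in a common rotated quadrant.
  Measured from one of them, all arguments lie in \<open>[-\<pi>/2, \<pi>/2]\<close>, so the pairwise condition on
  directions becomes a condition on real arguments: they fill an interval of length at most
  \<open>\<pi>/2\<close>. The rotation that sends its supremum to \<open>0\<close> does the job.\<close>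

lemma rotate_into_quadrant:
  assumes P: "\<And>p q. p \<in> P \<Longrightarrow> q \<in> P \<Longrightarrow> 0 \<le> Re (p * cnj q)"
  obtains c where "c \<noteq> 0" "\<And>p. p \<in> P \<Longrightarrow> c * p \<in> quadrant"
proof (cases "P \<subseteq> {0}")
  case True
  then show thesis by (intro that[of 1]) (auto simp: quadrant_def)
next
  case False
  then obtain p0 where p0: "p0 \<in> P" "p0 \<noteq> 0" by blast
  have re: "Re (z * cnj w / (p0 * cnj p0)) = Re (z * cnj w) / (cmod p0)\<^sup>2" for z w
    by (metis Re_divide_of_real complex_norm_square)
  define T where "T = (\<lambda>p. Arg (p / p0)) ` (P - {0})"
  have pol: "p / p0 = of_real (cmod (p / p0)) * cis (Arg (p / p0))" for p
    using rcis_cmod_Arg[of "p / p0"] by (simp add: rcis_def)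
  have diff: "\<bar>Arg (p/p0) - Arg (q/p0)\<bar> \<le> pi / 2"
    if pq: "p \<in> P" "q \<in> P" "p \<noteq> 0" "q \<noteq> 0" "\<bar>Arg (p/p0) - Arg (q/p0)\<bar> \<le> pi" for p q
  proof (rule ccontr)
    let ?d = "Arg (p/p0) - Arg (q/p0)"
    assume "\<not> \<bar>?d\<bar> \<le> pi / 2"
    then have "cos \<bar>?d\<bar> < 0" using pq(5) by (intro cos_lt_zero_pi) auto
    then have neg: "cos ?d < 0" by simp
    have alg: "(of_real r * cis a) * cnj (of_real s * cis b) = of_real (r * s) * cis (a - b)" for r s a b
      by (simp add: complex_eq_iff cos_diff sin_diff algebra_simps)
    have "(p/p0) * cnj (q/p0) = of_real (cmod (p / p0) * cmod (q/p0)) * cis ?d"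
      using alg[of "cmod (p/p0)" "Arg (p/p0)" "cmod (q/p0)" "Arg (q/p0)"] unfolding pol[symmetric] .
    then have "Re ((p/p0) * cnj (q/p0)) = cmod (p / p0) * cmod (q/p0) * cos ?d" by simp
    also have "\<dots> < 0" using neg pq p0 by (intro mult_pos_neg) auto
    finally have "Re (p * cnj q / (p0 * cnj p0)) < 0" by simp
    moreover have "0 \<le> Re (p * cnj q)" using P pq by blast
    ultimately show False unfolding re by (simp add: divide_less_0_iff)
  qed
  have base: "\<bar>Arg (p/p0)\<bar> \<le> pi / 2" if "p \<in> P" "p \<noteq> 0" for p
    using diff[of p p0] that p0 Arg_bounded[of "p/p0"] by (auto simp: abs_if)
  have diff': "\<bar>Arg (p/p0) - Arg (q/p0)\<bar> \<le> pi / 2" if "p \<in> P" "q \<in> P" "p \<noteq> 0" "q \<noteq> 0" for p q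
    using that base[of p] base[of q] by (intro diff) auto
  have bdd: "bdd_above T" 
  proof (rule bdd_aboveI[of _ "pi / 2"])
    fix t assume "t \<in> T"
    then obtain q where "q \<in> P" "q \<noteq> 0" "t = Arg (q/p0)" by (auto simp: T_def)
    then show "t \<le> pi / 2" using base[of q] by (simp add: abs_le_iff)
  qed
  have upper: "Arg (p/p0) \<le> Sup T" if "p \<in> P" "p \<noteq> 0" for p
    using that by (intro cSup_upper bdd) (auto simp: T_def)
  have lower: "Sup T \<le> Arg (p/p0) + pi / 2" if "p \<in> P" "p \<noteq> 0" for p
  proof (rule cSup_least)
    show "T \<noteq> {}" using p0 by (auto simp: T_def)
    fix t assume "t \<in> T"
    then obtain q where "q \<in> P" "q \<noteq> 0" "t = Arg (q/p0)" by (auto simp: T_def)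
    then show "t \<le> Arg (p/p0) + pi / 2" using diff'[of p q] that by linarith
  qed
  define c where "c = cis (- Sup T) / p0"
  have "c * p \<in> quadrant" if "p \<in> P" for p
  proof (cases "p = 0")
    case False
    let ?a = "Arg (p/p0) - Sup T"
    have "c * p = cis (- Sup T) * (p / p0)" by (simp add: c_def)
    also have "\<dots> = cis (- Sup T) * (of_real (cmod (p / p0)) * cis (Arg (p/p0)))"
      by (simp only: pol[symmetric])
    also have "\<dots> = of_real (cmod (p / p0)) * cis ?a"
      by (simp add: complex_eq_iff cos_diff sin_diff algebra_simps)
    finally have "c * p = of_real (cmod (p / p0)) * cis ?a" .
    moreover have "- (pi / 2) \<le> ?a" "?a \<le> 0" using upper[of p] lower[of p] that False by auto
    then have "0 \<le> cos ?a" "0 \<le> sin (- ?a)"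
      using pi_gt_zero by (intro cos_ge_zero sin_ge_zero; linarith)+
    then have "cos ?a \<ge> 0" "sin ?a \<le> 0" unfolding sin_minus by auto
    then have "cis ?a \<in> quadrant" by (simp add: quadrant_def)
    ultimately show ?thesis by (metis norm_ge_zero quadrant_scale)
  qed (simp add: quadrant_def)
  moreover have "c \<noteq> 0" using p0 by (simp add: c_def)
  ultimately show thesis by (intro that)
qed

section \<open>The cone as the set where two linear forms enclose at most a right angle\<close>

definition angle_form :: "('a \<Rightarrow> complex) \<Rightarrow> ('a \<Rightarrow> complex) \<Rightarrow> 'a \<Rightarrow> real" where
  "angle_form m l v = Re (m v * cnj (l v))"

lemma Re_mult_cnj_self: "Re ((b * cnj b) * z) = (cmod b)\<^sup>2 * Re z"
  unfolding complex_norm_square[symmetric] by simp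

lemma Re_divide_cnj: "Re (p / q) = Re (p * cnj q) / (cmod q)\<^sup>2"
  by (simp add: Re_divide cmod_power2)

lemma lin_indep2_iff:
  "lin_indep2 x y \<longleftrightarrow> (\<forall>a b. a *\<^sub>C x + b *\<^sub>C y = 0 \<longrightarrow> a = 0 \<and> b = 0)"
proof (cases "x = y")
  case True
  have "1 *\<^sub>C y + (-1) *\<^sub>C y = 0" by simp
  then show ?thesis using True unfolding lin_indep2_def by (metis zero_neq_one)
next
  case False
  then have dep: "complex_vector.dependent {x, y} \<longleftrightarrow> (\<exists>u. (\<exists>v\<in>{x, y}. u v \<noteq> 0) \<and> u x *\<^sub>C x + u y *\<^sub>C y = 0)"
    by (subst complex_vector.dependent_finite) auto
  have "(\<exists>u. (\<exists>v\<in>{x, y}. u v \<noteq> 0) \<and> u x *\<^sub>C x + u y *\<^sub>C y = 0) \<longleftrightarrow>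
      (\<exists>a b. a *\<^sub>C x + b *\<^sub>C y = 0 \<and> \<not> (a = 0 \<and> b = 0))" (is "?L \<longleftrightarrow> ?R")
  proof
    assume ?L then show ?R by auto
  next
    assume ?R
    then obtain a b where ab: "a *\<^sub>C x + b *\<^sub>C y = 0" "\<not> (a = 0 \<and> b = 0)" by blast
    show ?L using ab False by (intro exI[of _ "\<lambda>z. if z = x then a else b"]) auto
  qed
  then show ?thesis using dep False unfolding lin_indep2_def by blast
qed

lemma lin_indep2D:
  assumes "lin_indep2 x y"
  shows "x \<noteq> 0" "y \<noteq> 0" "z *\<^sub>C x - y \<noteq> 0"
  using assms[unfolded lin_indep2_iff, rule_format, of 1 0]
    assms[unfolded lin_indep2_iff, rule_format, of 0 1]
    assms[unfolded lin_indep2_iff, rule_format, of z "-1"] by auto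

lemma not_lin_indep2E:
  assumes "\<not> lin_indep2 x y" "x \<noteq> 0" "y \<noteq> 0"
  obtains c where "c \<noteq> 0" "y = c *\<^sub>C x"
proof -
  obtain a b where ab: "a *\<^sub>C x + b *\<^sub>C y = 0" "a \<noteq> 0 \<or> b \<noteq> 0"
    using assms(1) unfolding lin_indep2_iff by blast
  have "b \<noteq> 0" using ab assms(2) by auto
  moreover have "a \<noteq> 0" using ab assms(3) by auto
  moreover have "y = (- a / b) *\<^sub>C x"
  proof -
    have "b *\<^sub>C y = - (a *\<^sub>C x)" using ab(1) by (simp add: eq_neg_iff_add_eq_0 add.commute)
    then have "(1 / b) *\<^sub>C b *\<^sub>C y = (1 / b) *\<^sub>C (- (a *\<^sub>C x))" by simp
    then show ?thesis using \<open>b \<noteq> 0\<close> by (simp add: scaleC_scaleC scaleC_one)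
  qed
  ultimately show thesis by (intro that[of "- a / b"]) auto
qed

lemma span_pair_not_in_proper_cone:
  assumes C: "proper_cone C" and xy: "lin_indep2 x y"
  obtains a b where "a *\<^sub>C x + b *\<^sub>C y \<notin> C"
proof -
  have "complex_vector.dim (complex_vector.span {x, y}) = 2"
    using xy complex_vector.dim_span_eq_card_independent[of "{x, y}"]
    by (simp add: lin_indep2_def)
  then have "\<not> complex_vector.span {x, y} \<subseteq> closure C"
    using C complex_vector.subspace_span unfolding proper_cone_def by blast
  then obtain v where v: "v \<in> complex_vector.span {x, y}" "v \<notin> C"
    using closure_subset by blast
  then obtain a where "v - a *\<^sub>C x \<in> complex_vector.span {y}"
    by (auto simp: complex_vector.span_insert)
  then obtain b where "v - a *\<^sub>C x = b *\<^sub>C y" by (auto simp: complex_vector.span_singleton)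
  then have "v = a *\<^sub>C x + b *\<^sub>C y" by (simp add: algebra_simps)
  with v that show thesis by blast
qed

text \<open>The forms of \<open>quadrant_forms R\<close> determine \<open>R\<close>. They also determine \<open>C\<close>: a vector lies in \<open>C\<close> iff
  its values under any two of these forms enclose at most a right angle (\<open>C_iff\<close> below).\<close>

locale quadrant_cone =
  fixes R C :: "'a::cbanach set"
  assumes R: "closed_convex_cone R" and C1: "condition_C1 R C" and C2: "condition_C2 C"
begin

abbreviation "M \<equiv> quadrant_forms R"

lemmas lin = clinear_form_simps[OF quadrant_forms_linear]

lemma C_eq: "C = {c *\<^sub>C x | c x. c \<noteq> 0 \<and> x \<in> R}"
  using C1 by (simp add: condition_C1_def)

lemma C_E:
  assumes "v \<in> C" obtains c where "c \<noteq> 0" "c *\<^sub>C v \<in> R"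
proof -
  obtain c x where "c \<noteq> 0" "x \<in> R" "v = c *\<^sub>C x" using assms by (auto simp: C_eq)
  then show thesis by (intro that[of "1 / c"]) (auto simp: scaleC_scaleC scaleC_one)
qed

lemma C_I: "c \<noteq> 0 \<Longrightarrow> c *\<^sub>C v \<in> R \<Longrightarrow> v \<in> C"
  unfolding C_eq by (rule CollectI, rule exI[of _ "1 / c"], rule exI[of _ "c *\<^sub>C v"])
    (simp add: scaleC_scaleC scaleC_one)

lemma R_add: "x \<in> R \<Longrightarrow> y \<in> R \<Longrightarrow> x + y \<in> R"
  and R_scale: "0 < r \<Longrightarrow> x \<in> R \<Longrightarrow> r *\<^sub>R x \<in> R"
  using R by (auto simp: closed_convex_cone_def)

lemma R_sub_C: "x \<in> R \<Longrightarrow> x \<in> C"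
  by (rule C_I[of 1]) (auto simp: scaleC_one)

lemma C_scale: "c \<noteq> 0 \<Longrightarrow> v \<in> C \<Longrightarrow> c *\<^sub>C v \<in> C"
proof -
  assume c: "c \<noteq> 0" "v \<in> C"
  obtain d where "d \<noteq> 0" "d *\<^sub>C v \<in> R" using C_E[OF c(2)] by blast
  then show ?thesis using c(1) by (intro C_I[of "d / c"]) (auto simp: scaleC_scaleC)
qed

lemma C_scale_iff: "c \<noteq> 0 \<Longrightarrow> c *\<^sub>C v \<in> C \<longleftrightarrow> v \<in> C"
  using C_scale[of c v] C_scale[of "1 / c" "c *\<^sub>C v"] by (auto simp: scaleC_scaleC scaleC_one)

lemma zero_in_R: "0 \<in> R" by (rule closed_convex_cone_0[OF R])

text \<open>Condition (C1) writes \<open>R\<close> as the intersection of the closures of \<open>R + \<i>R\<close> and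
  \<open>R - \<i>R\<close>, so a point outside \<open>R\<close> can be separated from one of them. A form that is
  nonnegative on the second has to be rotated by \<open>- \<i>\<close> to take its values on \<open>R\<close> in the quadrant.\<close>

lemma R_separation:
  assumes "v \<notin> R" obtains m where "m \<in> M" "m v \<notin> quadrant"
proof -
  let ?S = "\<lambda>s. {x + s *\<^sub>C y | x y. x \<in> R \<and> y \<in> R}"
  have cone: "closed_convex_cone (closure (?S s))" for s
  proof (rule closed_convex_cone_closure)
    show "?S s \<noteq> {}" using zero_in_R by blast
  next
    fix u w assume "u \<in> ?S s" "w \<in> ?S s"
    then obtain x y x' y' where "x \<in> R" "y \<in> R" "x' \<in> R" "y' \<in> R" "u = x + s *\<^sub>C y" "w = x' + s *\<^sub>C y'"
      by blast
    then have "x + x' \<in> R \<and> y + y' \<in> R \<and> u + w = (x + x') + s *\<^sub>C (y + y')"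
      by (simp add: R_add complex_vector.scale_right_distrib)
    then show "u + w \<in> ?S s" by blast
  next
    fix r :: real and u assume "r > 0" "u \<in> ?S s"
    then obtain x y where "x \<in> R" "y \<in> R" "u = x + s *\<^sub>C y" by blast
    then have "r *\<^sub>R x \<in> R \<and> r *\<^sub>R y \<in> R \<and> r *\<^sub>R u = r *\<^sub>R x + s *\<^sub>C (r *\<^sub>R y)"
      using \<open>r > 0\<close> R_scale[OF \<open>r > 0\<close>]
      by (simp add: scaleR_scaleC scaleC_scaleC mult.commute complex_vector.scale_right_distrib)
    then show "r *\<^sub>R u \<in> ?S s" by blast
  qed
  have in1: "x \<in> closure (?S s)" if "x \<in> R" for s x
  proof -
    have "x \<in> ?S s"
      by (rule CollectI, rule exI[of _ x], rule exI[of _ 0]) (simp add: zero_in_R that)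
    then show ?thesis by (rule subsetD[OF closure_subset])
  qed
  have in2: "s *\<^sub>C x \<in> closure (?S s)" if "x \<in> R" for s x
  proof -
    have "s *\<^sub>C x \<in> ?S s"
      by (rule CollectI, rule exI[of _ 0], rule exI[of _ x]) (simp add: zero_in_R that)
    then show ?thesis by (rule subsetD[OF closure_subset])
  qed
  have min: "{x - \<i> *\<^sub>C y | x y. x \<in> R \<and> y \<in> R} = ?S (- \<i>)" by simp
  have "v \<notin> closure (?S \<i>) \<or> v \<notin> closure (?S (- \<i>))"
    using C1 assms unfolding condition_C1_def min by blast
  then show thesis
  proof
    assume v: "v \<notin> closure (?S \<i>)"
    obtain n :: "'a \<Rightarrow> real" where n: "linear n" "\<forall>x\<in>closure (?S \<i>). 0 \<le> n x" "n v < 0"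
      using closed_convex_cone_separation[OF cone v] by blast
    let ?m = "\<lambda>x. Complex (n x) (- n (\<i> *\<^sub>C x))"
    have "0 \<le> n x \<and> 0 \<le> n (\<i> *\<^sub>C x)" if "x \<in> R" for x
      using bspec[OF n(2) in1[OF that]] bspec[OF n(2) in2[OF that]] by simp
    then have "?m \<in> M" unfolding quadrant_forms_def quadrant_def
      using clinear_form_of_real_linear[OF n(1)] by auto
    moreover have "?m v \<notin> quadrant" using n(3) by (simp add: quadrant_def)
    ultimately show thesis by (rule that)
  next
    assume v: "v \<notin> closure (?S (- \<i>))"
    obtain n :: "'a \<Rightarrow> real" where n: "linear n" "\<forall>x\<in>closure (?S (- \<i>)). 0 \<le> n x" "n v < 0"
      using closed_convex_cone_separation[OF cone v] by blast
    let ?m = "\<lambda>x. - \<i> * Complex (n x) (- n (\<i> *\<^sub>C x))"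
    have "clinear_form ?m"
      using clinear_form_of_real_linear[OF n(1)] unfolding clinear_form_def
      by (simp only: distrib_left mult.left_commute) simp
    moreover have "0 \<le> n x \<and> 0 \<le> - n (\<i> *\<^sub>C x)" if "x \<in> R" for x
      using bspec[OF n(2) in1[OF that]] bspec[OF n(2) in2[OF that]] linear_neg[OF n(1), of "\<i> *\<^sub>C x"] by simp
    ultimately have "?m \<in> M" unfolding quadrant_forms_def quadrant_def by auto
    moreover have "?m v \<notin> quadrant" using n(3) by (simp add: quadrant_def)
    ultimately show thesis by (rule that)
  qed
qed

lemma R_iff: "v \<in> R \<longleftrightarrow> (\<forall>m\<in>M. m v \<in> quadrant)"
proof
  assume "\<forall>m\<in>M. m v \<in> quadrant"
  then show "v \<in> R" by (meson R_separation)
qed (simp add: quadrant_forms_mem)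

lemma angle_form_nonneg:
  assumes "m \<in> M" "l \<in> M" "v \<in> C" shows "0 \<le> angle_form m l v"
proof -
  obtain c where c: "c \<noteq> 0" "c *\<^sub>C v \<in> R" using C_E[OF assms(3)] by blast
  have "0 \<le> Re (m (c *\<^sub>C v) * cnj (l (c *\<^sub>C v)))"
    by (intro quadrant_angle quadrant_forms_mem[OF _ c(2)] assms)
  also have "m (c *\<^sub>C v) * cnj (l (c *\<^sub>C v)) = (c * cnj c) * (m v * cnj (l v))"
    using assms by (simp add: lin)
  also have "Re \<dots> = (cmod c)\<^sup>2 * angle_form m l v"
    unfolding angle_form_def by (rule Re_mult_cnj_self)
  finally show ?thesis using c(1) by (simp add: zero_le_mult_iff)
qed

lemma Re_quotient_nonneg: "m \<in> M \<Longrightarrow> l \<in> M \<Longrightarrow> v \<in> C \<Longrightarrow> 0 \<le> Re (m v / l v)"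
  using angle_form_nonneg[of m l v] unfolding angle_form_def Re_divide_cnj by simp

theorem C_iff: "v \<in> C \<longleftrightarrow> (\<forall>m\<in>M. \<forall>l\<in>M. 0 \<le> angle_form m l v)"
proof
  assume "\<forall>m\<in>M. \<forall>l\<in>M. 0 \<le> angle_form m l v"
  then obtain c where c: "c \<noteq> 0" "\<And>p. p \<in> (\<lambda>m. m v) ` M \<Longrightarrow> c * p \<in> quadrant"
    using rotate_into_quadrant[of "(\<lambda>m. m v) ` M"] unfolding angle_form_def by blast
  then have "c *\<^sub>C v \<in> R" unfolding R_iff by (auto simp: lin)
  then show "v \<in> C" using c(1) C_I by blast
qed (use angle_form_nonneg in blast)

lemma not_in_C:
  assumes "v \<notin> C" obtains m l where "m \<in> M" "l \<in> M" "angle_form m l v < 0"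
  using assms by (auto simp: C_iff not_le)

lemma proper: "proper_cone C" using C2 by (simp add: condition_C2_def)

text \<open>If all forms vanish on \<open>u\<close>, then adding multiples of \<open>u\<close> to a vector of \<open>C\<close> does not leave
  \<open>C\<close>. With a second independent vector this gives a complex plane in \<open>C\<close>, which properness
  excludes.\<close>

lemma form_nonzero:
  assumes u: "u \<in> C" "u \<noteq> 0" obtains m where "m \<in> M" "m u \<noteq> 0"
proof (rule ccontr)
  assume "\<not> thesis"
  then have z: "m u = 0" if m: "m \<in> M" for m using m \<open>\<And>m. m \<in> M \<Longrightarrow> m u \<noteq> 0 \<Longrightarrow> thesis\<close> by metis
  obtain x y where xy: "x \<in> C" "y \<in> C" "lin_indep2 x y" using C2 by (auto simp: condition_C2_def)
  have "lin_indep2 u x \<or> lin_indep2 u y"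
  proof (rule ccontr)
    assume "\<not> ?thesis"
    then obtain a b where "a \<noteq> 0" "x = a *\<^sub>C u" "b \<noteq> 0" "y = b *\<^sub>C u"
      using not_lin_indep2E u(2) lin_indep2D[OF xy(3)] by metis
    then have "b *\<^sub>C x + (- a) *\<^sub>C y = 0" by (simp add: scaleC_scaleC mult.commute)
    then show False using xy(3) \<open>b \<noteq> 0\<close> unfolding lin_indep2_iff by blast
  qed
  then obtain w where w: "w \<in> C" "lin_indep2 u w" using xy by blast
  obtain c where c: "c \<noteq> 0" "c *\<^sub>C w \<in> R" using C_E[OF w(1)] by blast
  obtain a b where ab: "a *\<^sub>C u + b *\<^sub>C w \<notin> C"
    using span_pair_not_in_proper_cone[OF proper w(2)] by blast
  have "a *\<^sub>C u + b *\<^sub>C w \<in> C"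
    unfolding C_iff
  proof (intro ballI)
    fix m l assume "m \<in> M" "l \<in> M"
    then have "m (a *\<^sub>C u + b *\<^sub>C w) * cnj (l (a *\<^sub>C u + b *\<^sub>C w)) = (b * cnj b) * (m w * cnj (l w))"
      by (simp add: lin z)
    then have "angle_form m l (a *\<^sub>C u + b *\<^sub>C w) = (cmod b)\<^sup>2 * angle_form m l w"
      unfolding angle_form_def by (simp only: Re_mult_cnj_self)
    then show "0 \<le> angle_form m l (a *\<^sub>C u + b *\<^sub>C w)"
      using angle_form_nonneg[OF \<open>m \<in> M\<close> \<open>l \<in> M\<close> w(1)] by simp
  qed
  with ab show False by blast
qed

text \<open>After rotating \<open>u\<close> into \<open>R\<close> both values lie in the quadrant, where nonzero numbers cannot cancel.\<close>

lemma sum_nonzero: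
  assumes "m \<in> M" "l \<in> M" "u \<in> C" "l u \<noteq> 0" "0 \<le> r" "0 < s"
  shows "of_real r * m u + of_real s * l u \<noteq> 0"
proof
  assume 0: "of_real r * m u + of_real s * l u = 0"
  obtain c where c: "c \<noteq> 0" "c *\<^sub>C u \<in> R" using C_E[OF assms(3)] by blast
  have "of_real s * l (c *\<^sub>C u) = 0"
  proof (rule quadrant_add_eq_0)
    show "of_real s * l (c *\<^sub>C u) \<in> quadrant" "of_real r * m (c *\<^sub>C u) \<in> quadrant"
      using assms c by (auto intro!: quadrant_scale intro: quadrant_forms_mem)
    have "of_real s * l (c *\<^sub>C u) + of_real r * m (c *\<^sub>C u) = c * (of_real r * m u + of_real s * l u)"
      using assms by (simp add: lin algebra_simps)
    then show "of_real s * l (c *\<^sub>C u) + of_real r * m (c *\<^sub>C u) = 0" using 0 by simp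
  qed
  then show False using assms c by (simp add: lin)
qed

lemma form_nonzero_finite:
  assumes "finite X" "X \<subseteq> C - {0}" obtains p where "p \<in> M" "\<And>u. u \<in> X \<Longrightarrow> p u \<noteq> 0"
proof -
  have "\<exists>p\<in>M. \<forall>u\<in>X. p u \<noteq> 0"
    using assms
  proof (induction X)
    case empty
    have "(\<lambda>x. 0) \<in> M" by (auto simp: quadrant_forms_def clinear_form_def quadrant_def)
    then show ?case by blast
  next
    case (insert u X)
    then obtain p where p: "p \<in> M" "\<And>u. u \<in> X \<Longrightarrow> p u \<noteq> 0" by auto
    obtain m where m: "m \<in> M" "m u \<noteq> 0" using form_nonzero[of u] insert.prems by auto
    let ?p = "\<lambda>x. of_real 1 * m x + of_real 1 * p x"
    have "?p \<in> M" using m p by (intro quadrant_forms_combine) auto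
    moreover have "?p v \<noteq> 0" if v: "v \<in> insert u X" for v
    proof (cases "p v = 0")
      case True
      then show ?thesis using m v p(2) by auto
    next
      case False
      have "v \<in> C" using v insert.prems by blast
      from sum_nonzero[OF m(1) p(1) this False, of 1 1] show ?thesis by simp
    qed
    ultimately show ?case by (intro bexI[of _ ?p] ballI)
  qed
  then show thesis using that by meson
qed

text \<open>The inequality that witnesses \<open>v \<notin> C\<close> is strict, so it survives when a small multiple of a
  form without zeros in \<open>X\<close> is added to both forms; the sums have no zeros in \<open>X\<close> either. This
  allows quotients of forms to be evaluated along a whole chain of vectors.\<close>

lemma not_in_C_nonzero:
  assumes v: "v \<notin> C" and X: "finite X" "X \<subseteq> C - {0}"
  obtains m l where "m \<in> M" "l \<in> M" "angle_form m l v < 0"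
    "\<And>u. u \<in> X \<Longrightarrow> m u \<noteq> 0 \<and> l u \<noteq> 0"
proof -
  obtain p where p: "p \<in> M" "\<And>u. u \<in> X \<Longrightarrow> p u \<noteq> 0" using form_nonzero_finite[OF X] by blast
  obtain m l where ml: "m \<in> M" "l \<in> M" "angle_form m l v < 0" using not_in_C[OF v] by blast
  define f where "f e n = (\<lambda>x. of_real 1 * n x + of_real e * p x)" for e :: real and n
  have "((\<lambda>e. angle_form (f e m) (f e l) v) \<longlongrightarrow> angle_form (f 0 m) (f 0 l) v) (at_right 0)"
    unfolding angle_form_def f_def by (intro tendsto_intros)
  then have "\<forall>\<^sub>F e in at_right 0. angle_form (f e m) (f e l) v < 0"
    using ml(3) by (intro order_tendstoD) (auto simp: f_def angle_form_def)
  moreover have "\<forall>\<^sub>F e in at_right 0. (0::real) < e" by (rule eventually_at_right_less)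
  ultimately have "\<forall>\<^sub>F e in at_right 0. angle_form (f e m) (f e l) v < 0 \<and> 0 < e"
    by (rule eventually_conj)
  then have "\<exists>e. angle_form (f e m) (f e l) v < 0 \<and> 0 < e"
    by (rule eventually_happens'[OF trivial_limit_at_right_real])
  then obtain e where e: "angle_form (f e m) (f e l) v < 0" "0 < e" by (elim exE conjE)
  show thesis
  proof (rule that[of "f e m" "f e l"])
    show "f e m \<in> M" "f e l \<in> M" unfolding f_def using e
      by (intro quadrant_forms_combine ml(1) ml(2) p(1); simp)+
    fix u assume u: "u \<in> X"
    then have uC: "u \<in> C" using X by blast
    have "f e n u \<noteq> 0" if "n \<in> M" for n
      unfolding f_def by (rule sum_nonzero[OF that p(1) uC p(2)[OF u]]) (use e in auto)
    then show "f e m u \<noteq> 0 \<and> f e l u \<noteq> 0" using ml by blast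
  qed (rule e)
qed

end

section \<open>The topology of the sphere\<close>

text \<open>Compact sets of the plane are the closed bounded ones, so the neighbourhoods of infinity in the
  one-point compactification are those that contain the complement of a ball.\<close>

lemma open_sphere_iff:
  fixes V :: "riemann_sphere set"
  shows "open V \<longleftrightarrow> open (Some -` V) \<and> (None \<in> V \<longrightarrow> (\<exists>r. \<forall>z. r < cmod z \<longrightarrow> Some z \<in> V))"
proof
  assume "open V"
  then consider U where "open U" "V = Some ` U"
    | K where "compact K" "closed K" "V = insert None (Some ` (- K))"
    unfolding open_option_def openin_Alexandroff_compactification
    by (auto simp: Compl_eq_Diff_UNIV)
  then show "open (Some -` V) \<and> (None \<in> V \<longrightarrow> (\<exists>r. \<forall>z. r < cmod z \<longrightarrow> Some z \<in> V))"
  proof cases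
    case 1
    then have "Some -` V = U" by auto
    then show ?thesis using 1 by auto
  next
    case 2
    then have "Some -` V = - K" by auto
    moreover obtain r where "\<forall>z\<in>K. cmod z \<le> r" using compact_imp_bounded[OF 2(1)] by (auto simp: bounded_iff)
    ultimately show ?thesis using 2 by (auto simp: not_le[symmetric] intro!: exI[of _ r])
  qed
next
  assume *: "open (Some -` V) \<and> (None \<in> V \<longrightarrow> (\<exists>r. \<forall>z. r < cmod z \<longrightarrow> Some z \<in> V))"
  show "open V"
  proof (cases "None \<in> V")
    case False
    have "V = Some ` (Some -` V)" using False by (auto simp: image_iff) (metis option.exhaust)
    then show ?thesis using * unfolding open_option_def openin_Alexandroff_compactification by auto
  next
    case True
    let ?K = "- (Some -` V)"
    obtain r where "\<forall>z. r < cmod z \<longrightarrow> Some z \<in> V" using * True by blast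
    then have "bounded ?K" by (auto simp: bounded_iff intro!: exI[of _ r] leI)
    moreover have "closed ?K" using * by auto
    moreover have "V = insert None (Some ` (UNIV - ?K))"
    proof -
      have "v \<in> V \<longleftrightarrow> v = None \<or> v \<in> Some ` (UNIV - ?K)" for v using True by (cases v) auto
      then show ?thesis by blast
    qed
    ultimately show ?thesis unfolding open_option_def openin_Alexandroff_compactification
      by (intro disjI2 exI[of _ ?K]) (simp add: compact_eq_bounded_closed)
  qed
qed

lemma Some_in_interior_iff: "Some z \<in> interior S \<longleftrightarrow> z \<in> interior (Some -` S)" for z :: complex
proof
  assume "Some z \<in> interior S"
  moreover have "open (Some -` interior S)" using open_sphere_iff[of "interior S"] by simp
  moreover have "Some -` interior S \<subseteq> Some -` S" using interior_subset[of S] by blast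
  ultimately show "z \<in> interior (Some -` S)" by (intro interiorI[of "Some -` interior S"]) auto
next
  let ?V = "Some ` interior (Some -` S)"
  assume "z \<in> interior (Some -` S)"
  moreover have "Some -` ?V = interior (Some -` S)" by auto
  then have "open ?V" unfolding open_sphere_iff by auto
  moreover have "?V \<subseteq> S" using interior_subset[of "Some -` S"] by blast
  ultimately show "Some z \<in> interior S" by (intro interiorI[of ?V]) auto
qed

lemma None_in_interior_iff:
  "None \<in> interior S \<longleftrightarrow> None \<in> S \<and> (\<exists>r. \<forall>z. r < cmod z \<longrightarrow> Some z \<in> S)"
proof
  assume N: "None \<in> interior S"
  then obtain r where "\<forall>z. r < cmod z \<longrightarrow> Some z \<in> interior S"
    using open_sphere_iff[of "interior S"] by auto
  then show "None \<in> S \<and> (\<exists>r. \<forall>z. r < cmod z \<longrightarrow> Some z \<in> S)"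
    using N interior_subset[of S] by (intro conjI exI[of _ r]) auto
next
  assume *: "None \<in> S \<and> (\<exists>r. \<forall>z. r < cmod z \<longrightarrow> Some z \<in> S)"
  then obtain r where r: "\<forall>z. r < cmod z \<longrightarrow> Some z \<in> S" by blast
  let ?V = "insert None (Some ` {z. r < cmod z})"
  have "Some -` ?V = {z. r < cmod z}" by auto
  moreover have "open {z::complex. r < cmod z}" by (intro open_Collect_less continuous_intros)
  ultimately have "open ?V" unfolding open_sphere_iff by auto
  moreover have "?V \<subseteq> S" using * r by auto
  ultimately show "None \<in> interior S" by (intro interiorI[of ?V]) auto
qed

section \<open>Functions on the disk with values in a half-plane\<close>

lemma norm_reflection_less:
  assumes "0 < Re a" "0 < Re b" shows "cmod (a - b) < cmod (a + cnj b)"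
proof -
  have "(cmod (a + cnj b))\<^sup>2 - (cmod (a - b))\<^sup>2 = 4 * Re a * Re b"
    unfolding cmod_power2 by (simp add: power2_eq_square algebra_simps)
  moreover have "0 < 4 * Re a * Re b" using assms by simp
  ultimately have "(cmod (a - b))\<^sup>2 < (cmod (a + cnj b))\<^sup>2" by linarith
  then show ?thesis by (rule power2_less_imp_less) simp
qed

text \<open>This is the Schwarz lemma for the largest disk around \<open>z\<close> in the unit disk, after a Cayley
  transformation of the half-plane that sends \<open>h z\<close> to \<open>0\<close>.\<close>

lemma half_plane_deriv_bound:
  assumes h: "h holomorphic_on ball 0 1" and pos: "\<And>z. z \<in> ball 0 1 \<Longrightarrow> 0 < Re (h z)"
    and z: "z \<in> ball 0 1"
  shows "cmod (deriv h z) * (1 - cmod z) \<le> 2 * Re (h z)"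
proof -
  define r where "r = 1 - cmod z"
  have r: "r > 0" using z by (simp add: r_def)
  define T where "T \<zeta> = z + of_real r * \<zeta>" for \<zeta>
  have T: "T \<zeta> \<in> ball 0 1" if "cmod \<zeta> < 1" for \<zeta>
  proof -
    have "cmod (T \<zeta>) \<le> cmod z + r * cmod \<zeta>"
      unfolding T_def using r norm_triangle_ineq[of z "of_real r * \<zeta>"] by (simp add: norm_mult)
    also have "\<dots> < cmod z + r" using r that by simp
    finally show ?thesis by (simp add: r_def)
  qed
  define F where "F \<zeta> = (h (T \<zeta>) - h z) / (h (T \<zeta>) + cnj (h z))" for \<zeta>
  have lt: "cmod (h (T \<zeta>) - h z) < cmod (h (T \<zeta>) + cnj (h z))" if "cmod \<zeta> < 1" for \<zeta>
    by (intro norm_reflection_less pos T that z)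
  have "T holomorphic_on ball 0 1" unfolding T_def by (intro holomorphic_intros)
  moreover have "T ` ball 0 1 \<subseteq> ball 0 1" using T by auto
  ultimately have hT: "(\<lambda>\<zeta>. h (T \<zeta>)) holomorphic_on ball 0 1"
    using holomorphic_on_compose_gen[OF _ h, of T "ball 0 1"] by (simp add: o_def)
  have nz: "h (T \<zeta>) + cnj (h z) \<noteq> 0" if "cmod \<zeta> < 1" for \<zeta> using lt[OF that] by auto
  have F: "F holomorphic_on ball 0 1" unfolding F_def
    using nz by (intro holomorphic_intros hT) auto
  have "cmod (deriv F 0) \<le> 1"
  proof (rule Schwarz_Lemma(2)[OF F])
    show "F 0 = 0" by (simp add: F_def T_def)
    show "cmod (F \<zeta>) < 1" if "cmod \<zeta> < 1" for \<zeta>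
      using lt[OF that] nz[OF that] by (simp add: F_def norm_divide divide_less_eq)
    show "cmod 0 < (1::real)" by simp
  qed
  moreover have "(F has_field_derivative (deriv h z * of_real r) / (of_real (2 * Re (h z)))) (at 0)"
  proof -
    have "(h has_field_derivative deriv h z) (at (T 0))"
      using holomorphic_derivI[OF h open_ball z] by (simp add: T_def)
    moreover have "(T has_field_derivative of_real r) (at 0)" unfolding T_def
      by (auto intro!: derivative_eq_intros)
    ultimately have "((\<lambda>\<zeta>. h (T \<zeta>)) has_field_derivative deriv h z * of_real r) (at 0)"
      by (rule DERIV_chain2)
    then have "(F has_field_derivative
        ((deriv h z * of_real r) * (h (T 0) + cnj (h z)) - (h (T 0) - h z) * (deriv h z * of_real r))
          / ((h (T 0) + cnj (h z)) * (h (T 0) + cnj (h z)))) (at 0)"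
      unfolding F_def using nz[of 0] by (auto intro!: derivative_eq_intros)
    moreover have "h (T 0) + cnj (h z) = of_real (2 * Re (h z))"
      by (simp add: T_def complex_add_cnj)
    moreover have "h (T 0) - h z = 0" by (simp add: T_def)
    ultimately show ?thesis using pos[OF z] by (simp add: mult.commute)
  qed
  then have "deriv F 0 = (deriv h z * of_real r) / (of_real (2 * Re (h z)))" by (rule DERIV_imp_deriv)
  then have "cmod (deriv F 0) = cmod (deriv h z) * r / (2 * Re (h z))"
    using pos[OF z] r by (simp add: norm_divide norm_mult)
  ultimately show ?thesis using pos[OF z] by (simp add: divide_le_eq r_def)
qed

text \<open>The derivative of a piecewise differentiable path may be unbounded near a break point, so the
  Henstock-Kurzweil integral on the left need not converge absolutely. If the right-hand side is
  finite, it does.\<close>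

lemma norm_has_integral_le_nn_integral:
  fixes f :: "real \<Rightarrow> complex"
  assumes f: "(f has_integral I) {0..1}"
  shows "ennreal (cmod I) \<le> (\<integral>\<^sup>+ t\<in>{0..1}. ennreal (cmod (f t)) \<partial>lborel)"
proof (cases "(\<integral>\<^sup>+ t\<in>{0..1}. ennreal (cmod (f t)) \<partial>lborel) = \<infinity>")
  case False
  let ?f = "\<lambda>t. indicat_real {0..1} t *\<^sub>R f t"
  have eq: "(\<integral>\<^sup>+ t. ennreal (cmod (?f t)) \<partial>lebesgue) = (\<integral>\<^sup>+ t\<in>{0..1}. ennreal (cmod (f t)) \<partial>lborel)"
    unfolding nn_integral_completion by (intro nn_integral_cong) (auto simp: indicator_def)
  have "integrable lebesgue ?f"
  proof (rule integrableI_bounded)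
    show "?f \<in> borel_measurable lebesgue" by (rule has_integral_implies_lebesgue_measurable[OF f])
    show "(\<integral>\<^sup>+ t. ennreal (cmod (?f t)) \<partial>lebesgue) < \<infinity>" unfolding eq using False by (simp add: top.not_eq_extremum)
  qed
  moreover from this have "(f has_integral integral\<^sup>L lebesgue ?f) {0..1}"
    using has_integral_set_lebesgue[of "{0..1}" f]
    unfolding set_integrable_def set_lebesgue_integral_def by simp
  then have "I = integral\<^sup>L lebesgue ?f" using f by (rule has_integral_unique[rotated])
  ultimately show ?thesis using integral_norm_bound_ennreal[of lebesgue ?f] unfolding eq by simp
qed simp

text \<open>The half-plane has the hyperbolic metric \<open>\<bar>dw\<bar> / Re w\<close>, which dominates the length \<open>\<bar>dw\<bar> / \<bar>w\<bar>\<close>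
  of \<open>d log w\<close>, and holomorphic maps do not increase hyperbolic lengths. The factor \<open>2\<close> appears because
  \<open>half_plane_deriv_bound\<close> has \<open>1 - \<bar>z\<bar>\<close>, which is at least
  \<open>(1 - \<bar>z\<bar>\<^sup>2) / 2\<close>, in place of \<open>1 - \<bar>z\<bar>\<^sup>2\<close>.\<close>

lemma half_plane_log_norm_le_disk_length:
  assumes h: "h holomorphic_on ball 0 1" and pos: "\<And>z. z \<in> ball 0 1 \<Longrightarrow> 0 < Re (h z)"
    and g: "valid_path g" "path_image g \<subseteq> ball 0 1"
  shows "ennreal (\<bar>ln (cmod (h (pathstart g))) - ln (cmod (h (pathfinish g)))\<bar> / 2) \<le> disk_length g"
proof -
  have np: "h z \<notin> \<real>\<^sub>\<le>\<^sub>0" "h z \<noteq> 0" if "z \<in> ball 0 1" for z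
    using pos[OF that] by (auto simp: complex_nonpos_Reals_iff)
  have der: "((\<lambda>z. Ln (h z)) has_field_derivative deriv h z / h z) (at z within ball 0 1)"
    if "z \<in> ball 0 1" for z
    using DERIV_chain2[OF has_field_derivative_Ln[OF np(1)[OF that]] holomorphic_derivI[OF h open_ball that]]
    by (simp add: field_simps has_field_derivative_at_within)
  define I where "I = Ln (h (pathfinish g)) - Ln (h (pathstart g))"
  have "((\<lambda>z. deriv h z / h z) has_contour_integral I) g"
    unfolding I_def by (rule contour_integral_primitive[OF der g])
  then have int: "((\<lambda>t. deriv h (g t) / h (g t) * vector_derivative g (at t)) has_integral I) {0..1}"
    unfolding has_contour_integral .
  have bound: "cmod (deriv h z / h z) * (1 - (cmod z)\<^sup>2) \<le> 4" if z: "z \<in> ball 0 1" for z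
  proof -
    have z1: "cmod z < 1" using z by simp
    have "cmod (deriv h z) * (1 - cmod z) \<le> 2 * cmod (h z)"
      using half_plane_deriv_bound[OF h pos z] complex_Re_le_cmod[of "h z"] by linarith
    then have "cmod (deriv h z / h z) * (1 - cmod z) \<le> 2"
      using np[OF z] by (simp add: norm_divide field_simps)
    then have "cmod (deriv h z / h z) * (1 - cmod z) * (1 + cmod z) \<le> 2 * 2"
      using z1 by (intro mult_mono) auto
    then show ?thesis by (simp add: power2_eq_square algebra_simps)
  qed
  have "ennreal (cmod (I / 2))
      \<le> (\<integral>\<^sup>+ t\<in>{0..1}. ennreal (cmod (deriv h (g t) / h (g t) * vector_derivative g (at t) / 2)) \<partial>lborel)"
    using has_integral_divide[OF int, of 2] by (rule norm_has_integral_le_nn_integral)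
  also have "\<dots> \<le> disk_length g"
    unfolding disk_length_def
  proof (intro nn_integral_mono)
    fix t :: real
    show "ennreal (cmod (deriv h (g t) / h (g t) * vector_derivative g (at t) / 2)) * indicator {0..1} t
      \<le> ennreal (2 * cmod (vector_derivative g (at t)) / (1 - (cmod (g t))\<^sup>2)) * indicator {0..1} t"
    proof (cases "t \<in> {0..1}")
      case True
      then have gt: "g t \<in> ball 0 1" using g(2) unfolding path_image_def by blast
      then have p: "0 < 1 - (cmod (g t))\<^sup>2" by (simp add: abs_square_less_1)
      have "cmod (deriv h (g t) / h (g t)) \<le> 4 / (1 - (cmod (g t))\<^sup>2)"
        using bound[OF gt] p by (simp add: pos_le_divide_eq)
      then have "cmod (deriv h (g t) / h (g t)) * cmod (vector_derivative g (at t))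
          \<le> 4 / (1 - (cmod (g t))\<^sup>2) * cmod (vector_derivative g (at t))"
        by (intro mult_right_mono) auto
      then have "cmod (deriv h (g t) / h (g t) * vector_derivative g (at t) / 2)
          \<le> 2 * cmod (vector_derivative g (at t)) / (1 - (cmod (g t))\<^sup>2)"
        by (simp add: norm_mult norm_divide)
      then show ?thesis by (intro mult_right_mono ennreal_leI) auto
    qed simp
  qed
  finally have le: "ennreal (cmod (I / 2)) \<le> disk_length g" .
  have "ln (cmod (h (pathfinish g))) - ln (cmod (h (pathstart g))) = Re I"
  proof -
    have "pathstart g \<in> ball 0 1" "pathfinish g \<in> ball 0 1" using g(2) by auto
    then show ?thesis by (simp add: I_def np)
  qed
  then have "\<bar>ln (cmod (h (pathstart g))) - ln (cmod (h (pathfinish g)))\<bar> / 2 \<le> cmod (I / 2)"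
    using abs_Re_le_cmod[of I] by (simp add: norm_divide abs_minus_commute)
  then show ?thesis using le by (meson ennreal_leI order_trans)
qed

section \<open>The gauges bound ratios of forms\<close>

lemma field_differentiable_eventually_eq:
  assumes "f field_differentiable at z" "open A" "z \<in> A" "\<And>w. w \<in> A \<Longrightarrow> f w = g w"
  shows "g field_differentiable at z"
  using assms unfolding field_differentiable_def
  by (meson has_field_derivative_transform_within_open)

text \<open>Composing with a Moebius map that has no pole on the image turns a map to the sphere into a
  holomorphic function. Where \<open>f\<close> is infinite this is seen in the chart \<open>1/u\<close>, in which the
  Moebius map becomes \<open>(a - b u) / (c - d u)\<close>; there the junk value at the point \<open>0\<close> of the
  sphere is avoided by staying in a neighbourhood of infinity.\<close>

lemma holomorphic_to_sphere_Moebius: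
  assumes f: "holomorphic_to_sphere f (ball 0 1)"
    and nz: "\<And>z. z \<in> ball 0 1 \<Longrightarrow> case f z of Some u \<Rightarrow> c * u - d \<noteq> 0 | None \<Rightarrow> c \<noteq> 0"
  shows "(\<lambda>z. case f z of Some u \<Rightarrow> (a * u - b) / (c * u - d) | None \<Rightarrow> a / c) holomorphic_on ball 0 1"
    (is "?K holomorphic_on _")
proof -
  have cont: "continuous_on (ball 0 1) f" using f by (simp add: holomorphic_to_sphere_def)
  have opn: "open (f -` V \<inter> ball 0 1)" if "open V" for V
    using continuous_on_open_vimage[of "ball 0 1" f] cont that by auto
  have "?K field_differentiable at z" if z: "z \<in> ball 0 1" for z
  proof (cases "f z = None")
    case False
    define u where "u w = (case f w of Some u \<Rightarrow> u | None \<Rightarrow> 0)" for w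
    have "u field_differentiable at z"
      using f z False unfolding holomorphic_to_sphere_def u_def[abs_def] by blast
    moreover have "c * u z - d \<noteq> 0" using nz[OF z] False by (auto simp: u_def)
    ultimately have "(\<lambda>w. (a * u w - b) / (c * u w - d)) field_differentiable at z"
      by (intro derivative_intros)
    moreover have "Some -` (- {None}) = (UNIV :: complex set)" by auto
    then have "open (f -` (- {None}) \<inter> ball 0 1)"
      by (intro opn) (simp add: open_sphere_iff)
    ultimately show ?thesis
      by (rule field_differentiable_eventually_eq) (use z False in \<open>auto simp: u_def\<close>)
  next
    case True
    define u where "u w = (case f w of Some u \<Rightarrow> inverse u | None \<Rightarrow> 0)" for w
    have "u field_differentiable at z"
      using f z True unfolding holomorphic_to_sphere_def u_def[abs_def] by blast
    moreover have "c - d * u z \<noteq> 0" using nz[OF z] True by (auto simp: u_def)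
    ultimately have "(\<lambda>w. (a - b * u w) / (c - d * u w)) field_differentiable at z"
      by (intro derivative_intros)
    moreover have "open (f -` (- {Some 0}) \<inter> ball 0 1)"
    proof (rule opn)
      have "Some -` (- {Some 0}) = - {0::complex}" by auto
      then have "open (Some -` (- {Some 0 :: riemann_sphere}))" by (simp add: open_Compl)
      moreover have "\<forall>z::complex. 0 < cmod z \<longrightarrow> Some z \<in> - {Some 0}" by auto
      ultimately show "open (- {Some 0 :: riemann_sphere})"
        unfolding open_sphere_iff by blast
    qed
    ultimately show ?thesis
    proof (rule field_differentiable_eventually_eq)
      fix w assume "w \<in> f -` (- {Some 0}) \<inter> ball 0 1"
      then have w: "f w \<noteq> Some 0" "w \<in> ball 0 1" by auto
      show "(a - b * u w) / (c - d * u w) = ?K w"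
      proof (cases "f w")
        case (Some v)
        then have "v \<noteq> 0" using w by auto
        then have "(a - b * inverse v) / (c - d * inverse v) = (v * (a - b * inverse v)) / (v * (c - d * inverse v))"
          by simp
        also have "\<dots> = (a * v - b) / (c * v - d)" using \<open>v \<noteq> 0\<close> by (simp add: algebra_simps)
        finally show ?thesis using Some by (simp add: u_def)
      qed (simp add: u_def)
    qed (use z True in auto)
  qed
  then show ?thesis
    unfolding holomorphic_on_def by (blast intro: field_differentiable_at_within)
qed

context quadrant_cone
begin

lemma L_interior_Some:
  assumes "Some z \<in> interior (L_set C x y)"
  obtains e where "e > 0" "\<And>t. cmod t < e \<Longrightarrow> (z + t) *\<^sub>C x - y \<in> C"
proof -
  have "z \<in> interior {z. z *\<^sub>C x - y \<in> C}"
    using assms unfolding Some_in_interior_iff L_set_def by (simp add: vimage_def image_iff)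
  then obtain e where "e > 0" "ball z e \<subseteq> {z. z *\<^sub>C x - y \<in> C}" by (auto simp: mem_interior)
  then show thesis by (intro that[of e]) (auto simp: subset_iff dist_norm)
qed

text \<open>Near an interior point of \<open>L(x,y)\<close> the quotient \<open>m / l\<close> has nonnegative real part. A pole is
  impossible, because near it the quotient would take all values of large modulus; the proof
  moves off the pole in the direction in which the quotient becomes negative.\<close>

lemma L_interior_nonzero:
  assumes ml: "m \<in> M" "l \<in> M" and x: "l x \<noteq> 0" and nd: "m x * l y \<noteq> m y * l x"
    and z: "Some z \<in> interior (L_set C x y)"
  shows "l (z *\<^sub>C x - y) \<noteq> 0"
proof
  let ?v = "z *\<^sub>C x - y"
  assume 0: "l ?v = 0"
  obtain e where e: "e > 0" "\<And>t. cmod t < e \<Longrightarrow> (z + t) *\<^sub>C x - y \<in> C"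
    using L_interior_Some[OF z] by metis
  have nn: "0 \<le> Re ((m ?v + t * m x) * cnj (t * l x))" if "cmod t < e" for t
  proof -
    have "m ((z + t) *\<^sub>C x - y) = m ?v + t * m x" "l ((z + t) *\<^sub>C x - y) = t * l x"
      using 0 ml by (simp_all add: lin algebra_simps)
    then show ?thesis using angle_form_nonneg[OF ml e(2)[OF that]] by (simp add: angle_form_def)
  qed
  have mv: "m ?v \<noteq> 0"
  proof
    assume "m ?v = 0"
    then have "m y = z * m x" "l y = z * l x" using 0 ml by (simp_all add: lin)
    then show False using nd by simp
  qed
  define q where "q = m ?v / l x"
  define A where "A = (cmod (m ?v))\<^sup>2"
  have A: "A > 0" using mv by (simp add: A_def)
  have qpos: "cmod q > 0" using mv x by (simp add: q_def)
  have "0 \<le> - s * A + s\<^sup>2 * A * Re (m x / l x)" if s: "s > 0" "s * cmod q < e" for s :: real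
  proof -
    let ?t = "- of_real s * q"
    have tl: "?t * l x = - of_real s * m ?v" using x by (simp add: q_def)
    have tm: "?t * m x = - of_real s * m ?v * (m x / l x)" by (simp add: q_def)
    have "(m ?v + ?t * m x) * cnj (?t * l x) = (m ?v * cnj (m ?v)) * (of_real (- s) + of_real (s\<^sup>2) * (m x / l x))"
      unfolding tl tm by (simp add: algebra_simps power2_eq_square)
    then have "Re ((m ?v + ?t * m x) * cnj (?t * l x)) = A * Re (of_real (- s) + of_real (s\<^sup>2) * (m x / l x))"
      unfolding A_def by (simp only: Re_mult_cnj_self)
    moreover have "Re (of_real (- s) + of_real (s\<^sup>2) * (m x / l x)) = - s + s\<^sup>2 * Re (m x / l x)"
      by (simp only: plus_complex.sel Re_complex_of_real times_complex.sel Im_complex_of_real)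
    ultimately have "Re ((m ?v + ?t * m x) * cnj (?t * l x)) = A * (- s + s\<^sup>2 * Re (m x / l x))" by simp
    moreover have "cmod ?t < e" using s by (simp add: norm_mult)
    ultimately show ?thesis using nn[of ?t] by (simp add: algebra_simps)
  qed
  moreover define r where "r = \<bar>Re (m x / l x)\<bar>"
  \<comment> \<open>small enough to stay in the cone and for the linear term to dominate the quadratic one\<close>
  define s where "s = min (e / (2 * cmod q)) (1 / (2 * (r + 1)))"
  have s: "s > 0" using e(1) qpos by (simp add: s_def r_def)
  have "s * cmod q \<le> e / (2 * cmod q) * cmod q" using qpos by (intro mult_right_mono) (auto simp: s_def)
  then have "s * cmod q < e" using e(1) qpos by simp
  ultimately have ge: "0 \<le> - s * A + s\<^sup>2 * A * Re (m x / l x)" using s by blast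
  have "s * Re (m x / l x) \<le> s * r" using s by (simp add: r_def)
  also have "\<dots> \<le> 1 / (2 * (r + 1)) * r" by (intro mult_right_mono) (auto simp: s_def r_def)
  also have "\<dots> < 1"
  proof -
    have "0 \<le> r" by (simp add: r_def)
    then show ?thesis by (simp add: divide_less_eq)
  qed
  finally have "s * A * (s * Re (m x / l x)) < s * A * 1" using s A by (intro mult_strict_left_mono) auto
  with ge show False by (simp add: power2_eq_square algebra_simps)
qed

text \<open>The quotient \<open>m (z x - y) / l (z x - y)\<close> maps the interior of \<open>L(x,y)\<close> into the closed right half-plane. It has
  the value \<open>m x / l x\<close> at infinity and \<open>m y / l y\<close> at \<open>0\<close>, and subtracting \<open>w\<close> makes its real part
  positive. Composed with a covering of \<open>L(x,y)\<close> by the disk it is subject to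
  \<open>half_plane_log_norm_le_disk_length\<close>.\<close>

theorem log_ratio_le_d_gauge:
  assumes ml: "m \<in> M" "l \<in> M" and xy: "x \<in> C" "y \<in> C" and lx: "l x \<noteq> 0" and ly: "l y \<noteq> 0"
    and w: "Re w < 0"
  shows "ennreal (\<bar>ln (cmod (m x / l x - w)) - ln (cmod (m y / l y - w))\<bar> / 2) \<le> d_gauge C x y"
proof (cases "m x * l y = m y * l x")
  case True
  then have "m x / l x = m y / l y" using lx ly by (simp add: field_simps)
  then show ?thesis by simp
next
  case nd: False
  have indep: "lin_indep2 x y"
  proof (rule ccontr)
    assume "\<not> ?thesis"
    moreover have "x \<noteq> 0" "y \<noteq> 0" using lx ly ml by (auto simp: lin)
    ultimately obtain c where "y = c *\<^sub>C x" using not_lin_indep2E by metis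
    then show False using nd ml by (simp add: lin)
  qed
  let ?L = "interior (L_set C x y)"
  note re = Re_quotient_nonneg[OF ml]
  have bound: "ennreal (\<bar>ln (cmod (m x / l x - w)) - ln (cmod (m y / l y - w))\<bar> / 2) \<le> disk_length g"
    if f: "holomorphic_to_sphere f (ball 0 1)" "f ` ball 0 1 \<subseteq> ?L"
      and g: "valid_path g" "path_image g \<subseteq> ball 0 1"
      and end1: "f (pathstart g) = Some 0" and end2: "f (pathfinish g) = None" for f g
  proof -
    define h where "h z = (case f z of Some u \<Rightarrow> (m x * u - m y) / (l x * u - l y) | None \<Rightarrow> m x / l x) - w" for z
    have nz: "l x * u - l y \<noteq> 0" if "z \<in> ball 0 1" "f z = Some u" for z u
    proof -
      have "f z \<in> ?L" using f(2) that(1) by blast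
      then have "l (u *\<^sub>C x - y) \<noteq> 0" using that(2) by (intro L_interior_nonzero[OF ml lx nd]) simp
      then show ?thesis using ml by (simp add: lin mult.commute)
    qed
    have hol: "h holomorphic_on ball 0 1" unfolding h_def
      by (intro holomorphic_intros holomorphic_to_sphere_Moebius f(1))
        (use nz lx in \<open>auto split: option.split\<close>)
    have pos: "0 < Re (h z)" if z: "z \<in> ball 0 1" for z
    proof (cases "f z")
      case None
      then show ?thesis using re[OF xy(1)] w by (simp add: h_def)
    next
      case (Some u)
      have "f z \<in> ?L" using f(2) z by blast
      then have "Some u \<in> L_set C x y" using interior_subset Some by (metis subsetD)
      then have "u *\<^sub>C x - y \<in> C" by (auto simp: L_set_def)
      from re[OF this] show ?thesis using Some w ml by (simp add: h_def lin mult.commute)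
    qed
    have "h (pathstart g) = m y / l y - w" "h (pathfinish g) = m x / l x - w"
      using end1 end2 by (simp_all add: h_def)
    then show ?thesis using half_plane_log_norm_le_disk_length[OF hol pos g]
      by (simp add: abs_minus_commute)
  qed
  show ?thesis
  proof (cases "Some 0 \<in> ?L \<and> None \<in> ?L")
    case True
    then have "d_gauge C x y = poincare_distance ?L (Some 0) None"
      using indep by (simp add: d_gauge_def)
    also have "ennreal (\<bar>ln (cmod (m x / l x - w)) - ln (cmod (m y / l y - w))\<bar> / 2) \<le> \<dots>"
      unfolding poincare_distance_def
    proof (rule Inf_greatest, elim CollectE exE conjE)
      fix d f z w'
      assume f: "holomorphic_to_sphere f (ball 0 1)" "covering_space (ball 0 1) f ?L" "f z = Some 0" "f w' = None"
        and d: "d = disk_distance z w'"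
      have "f ` ball 0 1 \<subseteq> ?L" using covering_space_imp_surjective[OF f(2)] by simp
      then show "ennreal (\<bar>ln (cmod (m x / l x - w)) - ln (cmod (m y / l y - w))\<bar> / 2) \<le> d"
        unfolding d disk_distance_def using f by (intro Inf_greatest) (auto intro!: bound)
    qed
    finally show ?thesis .
  next
    case False
    then have "d_gauge C x y = \<infinity>" using indep by (auto simp: d_gauge_def)
    then show ?thesis by simp
  qed
qed

corollary log_quotient_le_d_gauge:
  assumes ml: "m \<in> M" "l \<in> M" and xy: "x \<in> C" "y \<in> C" and lx: "l x \<noteq> 0" and ly: "l y \<noteq> 0"
    and mx: "m x \<noteq> 0" and my: "m y \<noteq> 0"
  shows "ennreal (\<bar>ln (cmod (m x / l x)) - ln (cmod (m y / l y))\<bar> / 2) \<le> d_gauge C x y"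
proof (rule tendsto_upperbound)
  let ?F = "\<lambda>e::real. ennreal (\<bar>ln (cmod (m x / l x - of_real (- e))) - ln (cmod (m y / l y - of_real (- e)))\<bar> / 2)"
  have "(?F \<longlongrightarrow> ennreal (\<bar>ln (cmod (m x / l x - of_real (- 0))) - ln (cmod (m y / l y - of_real (- 0)))\<bar> / 2)) (at_right 0)"
    using assms by (intro tendsto_ennrealI tendsto_intros) auto
  then show "(?F \<longlongrightarrow> ennreal (\<bar>ln (cmod (m x / l x)) - ln (cmod (m y / l y))\<bar> / 2)) (at_right 0)"
    by simp
  have "\<forall>\<^sub>F e in at_right 0. (0::real) < e" by (rule eventually_at_right_less)
  then show "\<forall>\<^sub>F e in at_right 0. ?F e \<le> d_gauge C x y"
    by (rule eventually_mono) (rule log_ratio_le_d_gauge[OF ml xy lx ly], simp)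
qed simp

end

lemma ennreal_abs_diff_chain:
  fixes \<phi> :: "nat \<Rightarrow> real"
  assumes "\<And>k. k < n \<Longrightarrow> ennreal (\<bar>\<phi> k - \<phi> (Suc k)\<bar> / 2) \<le> d k"
  shows "ennreal (\<bar>\<phi> 0 - \<phi> n\<bar> / 2) \<le> (\<Sum>k<n. d k)"
  using assms
proof (induction n)
  case (Suc n)
  have "\<bar>\<phi> 0 - \<phi> (Suc n)\<bar> / 2 \<le> \<bar>\<phi> 0 - \<phi> n\<bar> / 2 + \<bar>\<phi> n - \<phi> (Suc n)\<bar> / 2"
    using abs_triangle_ineq[of "\<phi> 0 - \<phi> n" "\<phi> n - \<phi> (Suc n)"] by (simp add: field_simps)
  then have "ennreal (\<bar>\<phi> 0 - \<phi> (Suc n)\<bar> / 2) \<le> ennreal (\<bar>\<phi> 0 - \<phi> n\<bar> / 2 + \<bar>\<phi> n - \<phi> (Suc n)\<bar> / 2)"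
    by (rule ennreal_leI)
  also have "\<dots> = ennreal (\<bar>\<phi> 0 - \<phi> n\<bar> / 2) + ennreal (\<bar>\<phi> n - \<phi> (Suc n)\<bar> / 2)"
    by (rule ennreal_plus) auto
  also have "\<dots> \<le> (\<Sum>k<n. d k) + d n"
    using Suc by (intro add_mono) auto
  finally show ?case by simp
qed simp

context quadrant_cone
begin

text \<open>A point \<open>c\<close> of \<open>E(x,y)\<close> comes with two forms and a number \<open>w\<close> of negative real part such that
  \<open>f = m - w l\<close> vanishes at \<open>c x - y\<close>, that is, \<open>c = f y / f x\<close>. By \<open>log_ratio_le_d_gauge\<close> the
  logarithm of \<open>\<bar>f / l\<bar>\<close> varies along the chain by at most twice its length, so \<open>ln \<bar>c\<bar>\<close> differs
  from \<open>ln \<bar>l y / l x\<bar>\<close> by at most \<open>2 T\<close>. Two points of \<open>E(x,y)\<close> are compared through their forms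
  \<open>l\<close> and \<open>l'\<close>, whose quotient contributes another \<open>2 T\<close>. These quantities telescope, which is why a
  chain costs no more than its length, although \<open>d\<close> itself need not satisfy the triangle inequality.\<close>

theorem E_set_ratio_le_chain:
  assumes X: "\<And>k. k \<le> n \<Longrightarrow> X k \<in> C - {0}" and sum: "(\<Sum>k<n. d_gauge C (X k) (X (Suc k))) \<le> ennreal T"
    and T: "0 \<le> T"
    and a: "a \<in> E_set C (X 0) (X n)" and b: "b \<in> E_set C (X 0) (X n)"
  shows "cmod a \<le> exp (6 * T) * cmod b"
proof -
  let ?X = "X ` {..n}" and ?x = "X 0" and ?y = "X n"
  have fin: "finite ?X" "?X \<subseteq> C - {0}" using X by auto
  have XC: "X k \<in> C" if "k \<le> n" for k using X[OF that] by simp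
  have le: "\<bar>\<phi> 0 - \<phi> n\<bar> \<le> 2 * T"
    if "\<And>k. k < n \<Longrightarrow> ennreal (\<bar>\<phi> k - \<phi> (Suc k)\<bar> / 2) \<le> d_gauge C (X k) (X (Suc k))" for \<phi> :: "nat \<Rightarrow> real"
  proof -
    have "ennreal (\<bar>\<phi> 0 - \<phi> n\<bar> / 2) \<le> ennreal T"
      using ennreal_abs_diff_chain[of n \<phi> "\<lambda>k. d_gauge C (X k) (X (Suc k))"] that sum by (meson order_trans)
    then show ?thesis using T by (simp add: ennreal_le_iff)
  qed
  have key: "\<exists>l\<in>M. (\<forall>u\<in>?X. l u \<noteq> 0) \<and> c \<noteq> 0 \<and> \<bar>ln (cmod c) - (ln (cmod (l ?y)) - ln (cmod (l ?x)))\<bar> \<le> 2 * T"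
    if c: "c \<in> E_set C ?x ?y" for c
  proof -
    let ?v = "c *\<^sub>C ?x - ?y"
    have "?v \<notin> C" using c by (simp add: E_set_def)
    then obtain m l where ml: "m \<in> M" "l \<in> M" "angle_form m l ?v < 0" "\<And>u. u \<in> ?X \<Longrightarrow> m u \<noteq> 0 \<and> l u \<noteq> 0"
      using not_in_C_nonzero[OF _ fin] by metis
    have lv: "l ?v \<noteq> 0" using ml(3) by (auto simp: angle_form_def)
    define w where "w = m ?v / l ?v"
    have w: "Re w < 0" using ml(3) lv unfolding w_def angle_form_def Re_divide_cnj
      by (simp add: divide_less_0_iff)
    have pos: "0 < Re (m (X k) / l (X k) - w)" if "k \<le> n" for k
      using Re_quotient_nonneg[OF ml(1,2) XC[OF that]] w by simp
    define \<phi> where "\<phi> k = ln (cmod (m (X k) / l (X k) - w))" for k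
    have lX: "l (X k) \<noteq> 0" if "k \<le> n" for k using ml(4) that by auto
    have "\<bar>\<phi> 0 - \<phi> n\<bar> \<le> 2 * T"
      unfolding \<phi>_def by (rule le) (intro log_ratio_le_d_gauge ml w XC lX; simp)
    moreover have "m ?v = w * l ?v" using lv by (simp add: w_def)
    then have "c * (l ?x * (m ?x / l ?x - w)) = l ?y * (m ?y / l ?y - w)"
      using lX[of 0] lX[of n] ml by (simp add: lin algebra_simps)
    moreover have "l ?x * (m ?x / l ?x - w) \<noteq> 0" "l ?y * (m ?y / l ?y - w) \<noteq> 0"
      using lX[of 0] lX[of n] pos[of 0] pos[of n] by auto
    ultimately have c: "c = (l ?y * (m ?y / l ?y - w)) / (l ?x * (m ?x / l ?x - w))" "c \<noteq> 0"
      by (auto simp: nonzero_eq_divide_eq)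
    then have "ln (cmod c) = (ln (cmod (l ?y)) + \<phi> n) - (ln (cmod (l ?x)) + \<phi> 0)"
      using \<open>l ?x * (m ?x / l ?x - w) \<noteq> 0\<close> \<open>l ?y * (m ?y / l ?y - w) \<noteq> 0\<close>
      by (simp add: norm_divide norm_mult ln_div ln_mult \<phi>_def)
    then have "\<bar>ln (cmod c) - (ln (cmod (l ?y)) - ln (cmod (l ?x)))\<bar> \<le> 2 * T"
      using \<open>\<bar>\<phi> 0 - \<phi> n\<bar> \<le> 2 * T\<close> by linarith
    then show ?thesis using ml(2,4) c(2) by blast
  qed
  obtain l where l: "l \<in> M" "\<And>u. u \<in> ?X \<Longrightarrow> l u \<noteq> 0" "a \<noteq> 0"
    "\<bar>ln (cmod a) - (ln (cmod (l ?y)) - ln (cmod (l ?x)))\<bar> \<le> 2 * T"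
    using key[OF a] by blast
  obtain l' where l': "l' \<in> M" "\<And>u. u \<in> ?X \<Longrightarrow> l' u \<noteq> 0" "b \<noteq> 0"
    "\<bar>ln (cmod b) - (ln (cmod (l' ?y)) - ln (cmod (l' ?x)))\<bar> \<le> 2 * T"
    using key[OF b] by blast
  have nz: "l (X k) \<noteq> 0" "l' (X k) \<noteq> 0" if "k \<le> n" for k using l(2) l'(2) that by auto
  define \<phi> where "\<phi> k = ln (cmod (l (X k) / l' (X k)))" for k
  have "\<bar>\<phi> 0 - \<phi> n\<bar> \<le> 2 * T"
    unfolding \<phi>_def by (rule le) (intro log_quotient_le_d_gauge l(1) l'(1) XC nz; simp)
  moreover have "\<phi> k = ln (cmod (l (X k))) - ln (cmod (l' (X k)))" if "k \<le> n" for k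
    using nz[OF that] by (simp add: \<phi>_def norm_divide ln_div)
  ultimately have "ln (cmod a) \<le> 6 * T + ln (cmod b)"
    using l(4) l'(4) by simp
  then have "exp (ln (cmod a)) \<le> exp (6 * T + ln (cmod b))" by simp
  then show ?thesis using l(3) l'(3) by (simp add: exp_add)
qed

lemma E_set_nonempty:
  assumes "y \<in> C" "lin_indep2 x y" "x \<in> C" shows "E_set C x y \<noteq> {}"
proof
  assume "E_set C x y = {}"
  then have all: "z *\<^sub>C x - y \<in> C" for z by (auto simp: E_set_def)
  obtain a b where ab: "a *\<^sub>C x + b *\<^sub>C y \<notin> C"
    using span_pair_not_in_proper_cone[OF proper assms(2)] by blast
  show False
  proof (cases "b = 0")
    case True
    then have "a *\<^sub>C x \<notin> C" using ab by simp
    moreover have "0 \<in> C" using zero_in_R R_sub_C by blast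
    ultimately show False using C_scale[of a x] assms(3) by (cases "a = 0") auto
  next
    case False
    have "(- b) *\<^sub>C ((- a / b) *\<^sub>C x - y) \<in> C" using False by (intro C_scale all) simp
    moreover have "(- b) *\<^sub>C ((- a / b) *\<^sub>C x - y) = a *\<^sub>C x + b *\<^sub>C y"
      using False by (simp add: complex_vector.scale_right_diff_distrib scaleC_scaleC)
    ultimately show False using ab by metis
  qed
qed

lemma zero_not_in_E_set: "y \<in> C \<Longrightarrow> 0 \<notin> E_set C x y"
  using C_scale[of "-1" y] by (simp add: E_set_def)

lemma delta_gauge_le:
  assumes xy: "x \<in> C" "y \<in> C" and S: "1 \<le> S"
    and E: "\<And>a b. a \<in> E_set C x y \<Longrightarrow> b \<in> E_set C x y \<Longrightarrow> cmod a \<le> S * cmod b"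
  shows "delta_gauge C x y \<le> ennreal (ln S)"
proof (cases "lin_indep2 x y")
  case True
  let ?E = "E_set C x y"
  define B where "B = (SUP z\<in>?E. ennreal (cmod z))"
  define A where "A = (INF z\<in>?E. ennreal (cmod z))"
  obtain e where e: "e \<in> ?E" using E_set_nonempty[OF xy(2) True xy(1)] by blast
  then have e0: "e \<noteq> 0" using zero_not_in_E_set[OF xy(2)] by auto
  have Bz: "B \<le> ennreal (S * cmod z)" if "z \<in> ?E" for z
    unfolding B_def using E that by (intro SUP_least ennreal_leI) auto
  have "B \<noteq> \<infinity>" using Bz[OF e] by (auto simp: top_unique)
  then obtain b where b: "B = ennreal b" "0 \<le> b" by (cases B) auto
  have Az: "A \<le> ennreal (cmod z)" if "z \<in> ?E" for z
    unfolding A_def using that by (rule INF_lower)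
  then have "A \<noteq> \<infinity>" using e by (metis ennreal_neq_top neq_top_trans infinity_ennreal_def)
  then obtain a where a: "A = ennreal a" "0 \<le> a" by (cases A) auto
  have "ennreal (b / S) \<le> A" unfolding A_def
  proof (intro INF_greatest ennreal_leI)
    fix z assume "z \<in> ?E"
    then have "b \<le> S * cmod z" using Bz[of z] b S by (simp add: ennreal_le_iff)
    then show "b / S \<le> cmod z" using S by (simp add: divide_le_eq mult.commute)
  qed
  then have ba: "b \<le> S * a" using a S by (simp add: ennreal_le_iff divide_le_eq mult.commute)
  have "ennreal (cmod e) \<le> B" unfolding B_def using e by (intro SUP_upper)
  then have "cmod e \<le> b" using b by (simp add: ennreal_le_iff)
  moreover have "0 < cmod e" using e0 by simp
  ultimately have bpos: "0 < b" by linarith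
  then have "0 < S * a" using ba by linarith
  then have apos: "0 < a" using S a(2) by (simp add: zero_less_mult_iff)
  have "delta_gauge C x y = ennreal (ln (b / a))"
    unfolding delta_gauge_def using True apos a b
    by (simp add: A_def[symmetric] B_def[symmetric] Let_def)
  also have "\<dots> \<le> ennreal (ln S)"
    using apos bpos ba S by (intro ennreal_leI) (simp add: divide_le_eq)
  finally show ?thesis .
qed (simp add: delta_gauge_def)

theorem delta_gauge_le_d_tilde:
  assumes xy: "x \<in> C - {0}" "y \<in> C - {0}" and T: "d_tilde C x y < ennreal T"
  shows "delta_gauge C x y \<le> ennreal (6 * T)"
proof -
  have T0: "0 \<le> T" using T by (metis ennreal_neg not_less_zero linear)
  obtain n X where nX: "(\<Sum>k<n. d_gauge C (X k) (X (Suc k))) < ennreal T" "X 0 = x" "X n = y"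
    "\<forall>k\<le>n. X k \<in> C - {0}"
    using T unfolding d_tilde_def Inf_less_iff by blast
  have "delta_gauge C x y \<le> ennreal (ln (exp (6 * T)))"
  proof (rule delta_gauge_le)
    fix a b assume "a \<in> E_set C x y" "b \<in> E_set C x y"
    then show "cmod a \<le> exp (6 * T) * cmod b"
      using E_set_ratio_le_chain[of n X T a b] nX T0 by auto
  qed (use xy T0 in auto)
  then show ?thesis by simp
qed

lemma d_tilde_le_d_gauge:
  assumes "x \<in> C - {0}" "y \<in> C - {0}" shows "d_tilde C x y \<le> d_gauge C x y"
proof -
  let ?X = "\<lambda>k::nat. if k = 0 then x else y"
  have "d_gauge C x y \<in> {\<Sum>k<n. d_gauge C (X k) (X (Suc k)) | n (X :: nat \<Rightarrow> 'a).
            n \<ge> 1 \<and> X 0 = x \<and> X n = y \<and> (\<forall>k\<le>n. X k \<in> C - {0})}"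
    using assms by (intro CollectI exI[of _ "1::nat"] exI[of _ ?X]) auto
  then show ?thesis unfolding d_tilde_def by (rule Inf_lower)
qed

end

section \<open>The domain \<open>L(x,y)\<close> is simply connected\<close>

text \<open>A Hermitian quadratic function that is nonnegative on a disk but negative somewhere has
  coefficients bounded by its value at the centre. The worst direction gives
  \<open>A - s \<bar>S\<bar> + s\<^sup>2 B\<close>; if \<open>B > 0\<close>, this has two roots that are at least \<open>e\<close> with product \<open>A / B\<close>.\<close>

lemma disk_quadratic_bound:
  fixes A B e :: real and S :: complex
  assumes e: "e > 0" and nn: "\<And>t. cmod t \<le> e \<Longrightarrow> 0 \<le> A + Re (t * S) + (cmod t)\<^sup>2 * B"
    and neg: "A + Re (u * S) + (cmod u)\<^sup>2 * B < 0"
  shows "0 \<le> A" "e\<^sup>2 * \<bar>B\<bar> \<le> A" "e * cmod S \<le> 2 * A"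
proof -
  show A: "0 \<le> A" using nn[of 0] e by simp
  have eS: "e * cmod S \<le> A + e\<^sup>2 * B"
  proof (cases "S = 0")
    case True
    then show ?thesis using nn[of "of_real e"] e by simp
  next
    case False
    \<comment> \<open>the point of modulus \<open>e\<close> at which the linear term is smallest\<close>
    let ?t = "- of_real (e / cmod S) * cnj S"
    have "cmod ?t = e" using e False by (simp add: norm_mult norm_divide)
    moreover have "?t * S = - of_real (e / cmod S * (cmod S)\<^sup>2)"
      unfolding of_real_mult complex_norm_square by (simp add: mult.assoc mult.commute)
    then have "Re (?t * S) = - (e / cmod S * (cmod S)\<^sup>2)" by (simp only: uminus_complex.sel Re_complex_of_real)
    then have "Re (?t * S) = - (e * cmod S)" using False by (simp add: power2_eq_square)
    ultimately show ?thesis using nn[of ?t] by simp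
  qed
  have "e\<^sup>2 * \<bar>B\<bar> \<le> A \<and> e\<^sup>2 * B \<le> A"
  proof (cases "B \<le> 0")
    case True
    have "0 \<le> e * cmod S" using e by simp
    then show ?thesis using True A eS mult_nonneg_nonpos[of "e\<^sup>2" B] by simp
  next
    case False
    let ?s = "cmod u"
    have s: "e < ?s" using nn[of u] neg by (meson not_le)
    have "- (?s * cmod S) \<le> Re (u * S)"
      using abs_Re_le_cmod[of "u * S"] by (simp add: norm_mult abs_le_iff)
    then have "A + ?s\<^sup>2 * B < ?s * cmod S" using neg by linarith
    then have "e * (A + ?s\<^sup>2 * B) < e * (?s * cmod S)" using e by simp
    also have "\<dots> = ?s * (e * cmod S)" by simp
    also have "\<dots> \<le> ?s * (A + e\<^sup>2 * B)" using eS by (intro mult_left_mono) auto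
    finally have "(?s - e) * (e * ?s * B) < (?s - e) * A" by (simp add: algebra_simps power2_eq_square)
    then have "e * ?s * B < A" using s by simp
    moreover have "e * e * B \<le> e * ?s * B" using s e False by (intro mult_right_mono) auto
    ultimately show ?thesis using False by (simp add: power2_eq_square)
  qed
  then show "e\<^sup>2 * \<bar>B\<bar> \<le> A" "e * cmod S \<le> 2 * A" using eS by auto
qed

context quadrant_cone
begin

lemma angle_form_scale:
  assumes "m \<in> M" "l \<in> M"
  shows "angle_form m l (c *\<^sub>C v) = (cmod c)\<^sup>2 * angle_form m l v"
proof -
  have "m (c *\<^sub>C v) * cnj (l (c *\<^sub>C v)) = (c * cnj c) * (m v * cnj (l v))"
    using assms by (simp add: lin)
  then show ?thesis unfolding angle_form_def by (simp only: Re_mult_cnj_self)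
qed

lemma angle_form_add_scale:
  assumes "m \<in> M" "l \<in> M"
  shows "angle_form m l (v + t *\<^sub>C w)
    = angle_form m l v + Re (t * (m w * cnj (l v) + cnj (m v) * l w)) + (cmod t)\<^sup>2 * angle_form m l w"
proof -
  have "m (v + t *\<^sub>C w) * cnj (l (v + t *\<^sub>C w))
      = m v * cnj (l v) + (t * (m w * cnj (l v)) + cnj (t * (cnj (m v) * l w))) + (t * cnj t) * (m w * cnj (l w))"
    using assms by (simp add: lin algebra_simps)
  then have "Re (m (v + t *\<^sub>C w) * cnj (l (v + t *\<^sub>C w)))
      = Re (m v * cnj (l v)) + (Re (t * (m w * cnj (l v))) + Re (cnj (t * (cnj (m v) * l w))))
        + Re ((t * cnj t) * (m w * cnj (l w)))" by (simp only: plus_complex.sel)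
  moreover have "Re (t * (m w * cnj (l v))) + Re (cnj (t * (cnj (m v) * l w)))
      = Re (t * (m w * cnj (l v) + cnj (m v) * l w))" by (simp add: algebra_simps)
  ultimately show ?thesis unfolding angle_form_def Re_mult_cnj_self by simp
qed

lemma angle_form_add_ge:
  assumes ml: "m \<in> M" "l \<in> M" and "p \<in> R" "q \<in> R"
  shows "angle_form m l p + angle_form m l q \<le> angle_form m l (p + q)"
proof -
  have "0 \<le> Re (m p * cnj (l q))" "0 \<le> Re (m q * cnj (l p))"
    by (intro quadrant_angle quadrant_forms_mem[OF ml(1)] quadrant_forms_mem[OF ml(2)] assms(3,4))+
  moreover have "m (p + q) * cnj (l (p + q)) = m p * cnj (l p) + m q * cnj (l q) + m p * cnj (l q) + m q * cnj (l p)"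
    using ml by (simp add: lin algebra_simps)
  ultimately show ?thesis unfolding angle_form_def by (simp only: plus_complex.sel)
qed

text \<open>If \<open>p\<close> and \<open>q\<close> are in \<open>R\<close> and can be moved in the direction of \<open>w\<close> without leaving \<open>C\<close>, so can
  \<open>p + q\<close>. The angle form of two forms is superadditive on \<open>R\<close>, and \<open>disk_quadratic_bound\<close> controls
  the change under a small multiple of \<open>w\<close> by the values at \<open>p\<close> and \<open>q\<close>, uniformly in the forms.
  If the angle form is negative nowhere on the plane, there is nothing to show.\<close>

lemma interior_add:
  assumes pq: "p \<in> R" "q \<in> R"
    and p: "p = c1 *\<^sub>C x + s1 *\<^sub>C w" "c1 \<noteq> 0" and q: "q = c2 *\<^sub>C x + s2 *\<^sub>C w" "c2 \<noteq> 0" and c: "c1 + c2 \<noteq> 0"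
    and e: "e > 0" and pe: "\<And>t. cmod t \<le> e \<Longrightarrow> p + t *\<^sub>C w \<in> C" and qe: "\<And>t. cmod t \<le> e \<Longrightarrow> q + t *\<^sub>C w \<in> C"
    and t: "cmod t \<le> e / 4"
  shows "p + q + t *\<^sub>C w \<in> C"
proof (rule ccontr)
  let ?v = "p + q + t *\<^sub>C w"
  assume "?v \<notin> C"
  then obtain m l where ml: "m \<in> M" "l \<in> M" "angle_form m l ?v < 0" by (rule not_in_C)
  define S where "S v = m w * cnj (l v) + cnj (m v) * l w" for v
  have add: "angle_form m l (v + s *\<^sub>C w) = angle_form m l v + Re (s * S v) + (cmod s)\<^sup>2 * angle_form m l w" for v s
    unfolding S_def by (rule angle_form_add_scale[OF ml(1,2)])
  have neg: "\<exists>u. angle_form m l (d *\<^sub>C x + s *\<^sub>C w + u *\<^sub>C w) < 0" if d: "d \<noteq> 0" for d s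
  proof -
    define r where "r = d / (c1 + c2)"
    have v: "?v = (c1 + c2) *\<^sub>C x + (s1 + s2 + t) *\<^sub>C w" by (simp add: p q scaleC_add_left)
    have "r * (c1 + c2) = d" using c by (simp add: r_def)
    then have "r *\<^sub>C ?v = d *\<^sub>C x + (r * (s1 + s2 + t)) *\<^sub>C w"
      unfolding v scaleC_add_right scaleC_scaleC by (simp only:)
    then have "d *\<^sub>C x + s *\<^sub>C w + (r * (s1 + s2 + t) - s) *\<^sub>C w = r *\<^sub>C ?v"
      by (simp add: complex_vector.scale_left_diff_distrib)
    then have "angle_form m l (d *\<^sub>C x + s *\<^sub>C w + (r * (s1 + s2 + t) - s) *\<^sub>C w) = (cmod r)\<^sup>2 * angle_form m l ?v"
      by (simp add: angle_form_scale ml)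
    moreover have "\<dots> < 0" using ml(3) d c by (intro mult_pos_neg) (auto simp: r_def)
    ultimately show ?thesis by metis
  qed
  let ?A = "angle_form m l p" and ?A' = "angle_form m l q" and ?B = "angle_form m l w"
  obtain u where u: "angle_form m l (p + u *\<^sub>C w) < 0" using neg[OF p(2), of s1] unfolding p by blast
  have P: "0 \<le> ?A" "e\<^sup>2 * \<bar>?B\<bar> \<le> ?A" "e * cmod (S p) \<le> 2 * ?A"
    using disk_quadratic_bound[OF e, of ?A "S p" ?B u] angle_form_nonneg[OF ml(1,2) pe] u unfolding add by auto
  obtain u' where u': "angle_form m l (q + u' *\<^sub>C w) < 0" using neg[OF q(2), of s2] unfolding q by blast
  have Q: "0 \<le> ?A'" "e * cmod (S q) \<le> 2 * ?A'"
    using disk_quadratic_bound[OF e, of ?A' "S q" ?B u'] angle_form_nonneg[OF ml(1,2) qe] u' unfolding add by auto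
  have "S (p + q) = S p + S q" using ml by (simp add: S_def lin algebra_simps)
  then have "cmod (t * S (p + q)) \<le> cmod t * (cmod (S p) + cmod (S q))"
    by (simp add: norm_mult mult_left_mono norm_triangle_ineq)
  also have "\<dots> \<le> e / 4 * (cmod (S p) + cmod (S q))" using t by (intro mult_right_mono) auto
  also have "\<dots> \<le> (?A + ?A') / 2" using P(3) Q(2) by (simp add: algebra_simps)
  finally have 1: "- ((?A + ?A') / 2) \<le> Re (t * S (p + q))"
    using abs_Re_le_cmod[of "t * S (p + q)"] by linarith
  have "(cmod t)\<^sup>2 * \<bar>?B\<bar> \<le> (e / 4)\<^sup>2 * \<bar>?B\<bar>" using t by (intro mult_right_mono power_mono) auto
  also have "\<dots> \<le> ?A / 16" using P(2) by (simp add: power_divide)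
  finally have "(cmod t)\<^sup>2 * \<bar>?B\<bar> \<le> ?A / 16" .
  moreover have "- ((cmod t)\<^sup>2 * \<bar>?B\<bar>) \<le> (cmod t)\<^sup>2 * ?B"
    by (metis abs_ge_minus_self abs_mult abs_power2 minus_le_iff)
  ultimately have 2: "- (?A / 16) \<le> (cmod t)\<^sup>2 * ?B" by linarith
  have "angle_form m l (p + q) \<ge> ?A + ?A'" using angle_form_add_ge[OF ml(1,2) pq] .
  then have "0 \<le> angle_form m l ?v" unfolding add using 1 2 P(1) Q(1) by argo
  then show False using ml(3) by linarith
qed

end

text \<open>A pair with \<open>\<delta>(x,y) \<le> ln K\<close>. The point \<open>e\<close> of \<open>E(x,y)\<close> is sent to infinity by the coordinate
  \<open>u = 1/(z - e)\<close> of the sphere, in which the interior of \<open>L(x,y)\<close> becomes the plane domain \<open>U\<close>: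
  as \<open>x + u w\<close> is a multiple of \<open>(e + 1/u) x - y\<close>, the point \<open>z = \<infinity>\<close> is \<open>u = 0\<close>.\<close>

locale annular_pair = quadrant_cone +
  fixes x y :: "'a::cbanach" and a K :: real and e :: complex
  assumes x: "x \<in> C" and y: "y \<in> C" and indep: "lin_indep2 x y" and a: "0 < a" and K: "1 \<le> K"
    and annulus: "\<And>z. z \<in> E_set C x y \<Longrightarrow> a \<le> cmod z \<and> cmod z \<le> K * a"
    and e: "e \<in> E_set C x y"
begin

abbreviation "E \<equiv> E_set C x y"
definition "X = closure E"
definition "w = e *\<^sub>C x - y"
definition "U = {u. u = 0 \<or> e + 1 / u \<notin> X}"

lemma X_annulus: "z \<in> X \<Longrightarrow> a \<le> cmod z \<and> cmod z \<le> K * a"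
proof -
  have "closed {z. a \<le> cmod z \<and> cmod z \<le> K * a}"
    by (intro closed_Collect_conj closed_Collect_le continuous_intros)
  then have "X \<subseteq> {z. a \<le> cmod z \<and> cmod z \<le> K * a}"
    unfolding X_def using annulus by (intro closure_minimal) auto
  then show "z \<in> X \<Longrightarrow> a \<le> cmod z \<and> cmod z \<le> K * a" by blast
qed

lemma E_sub_X: "E \<subseteq> X" unfolding X_def by (rule closure_subset)

lemma e_nonzero: "e \<noteq> 0" using annulus[OF e] a by auto

lemma w_notin_C: "w \<notin> C" using e by (simp add: w_def E_set_def)

lemma open_E: "open E"
proof -
  have "E = (\<Union>m\<in>M. \<Union>l\<in>M. {z. angle_form m l (z *\<^sub>C x - y) < 0})"
    unfolding E_set_def C_iff by (auto simp: not_le)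
  also have "open \<dots>"
  proof (intro open_UN ballI)
    fix m l assume ml: "m \<in> M" "l \<in> M"
    have "open {z. Re ((z * m x - m y) * cnj (z * l x - l y)) < 0}"
      by (intro open_Collect_less continuous_intros)
    then show "open {z. angle_form m l (z *\<^sub>C x - y) < 0}" using ml by (simp add: angle_form_def lin)
  qed
  finally show ?thesis .
qed

lemma chart: "u \<noteq> 0 \<Longrightarrow> x + u *\<^sub>C w = u *\<^sub>C ((e + 1 / u) *\<^sub>C x - y)"
  by (simp add: w_def complex_vector.scale_right_diff_distrib scaleC_scaleC distrib_left scaleC_add_left scaleC_add_right scaleC_one)

lemma U_in_C: assumes "u \<in> U" shows "x + u *\<^sub>C w \<in> C"
proof (cases "u = 0")
  case False
  then have "e + 1 / u \<notin> E" using assms E_sub_X by (auto simp: U_def)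
  then have "(e + 1 / u) *\<^sub>C x - y \<in> C" by (simp add: E_set_def)
  then show ?thesis unfolding chart[OF False] by (rule C_scale[OF False])
qed (simp add: x)

lemma open_U: "open U"
proof -
  define r where "r = 1 / (K * a + cmod e + 1)"
  have pos: "0 < K * a + cmod e + 1" using a K by (simp add: add_nonneg_pos)
  then have r: "r > 0" by (simp add: r_def)
  have "continuous_on (- {0}) (\<lambda>u. e + 1 / u)" by (intro continuous_intros) auto
  moreover have "open (- X)" by (simp add: X_def open_Compl)
  ultimately have "open (- {0} \<inter> (\<lambda>u. e + 1 / u) -` (- X))"
    by (intro continuous_open_preimage) (auto simp: open_Compl)
  moreover have "ball 0 r \<subseteq> U"
  proof
    fix u :: complex assume "u \<in> ball 0 r"
    then have u: "cmod u < r" by simp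
    show "u \<in> U"
    proof (cases "u = 0")
      case False
      then have "1 / r < 1 / cmod u" using u r by (simp add: divide_strict_left_mono)
      then have "K * a + cmod e + 1 < cmod (1 / u)" by (simp add: r_def norm_divide)
      moreover have "cmod (1 / u) \<le> cmod (e + 1 / u) + cmod e"
        using norm_triangle_ineq4[of "e + 1 / u" e] by simp
      ultimately have "K * a < cmod (e + 1 / u)" by linarith
      then show ?thesis using X_annulus[of "e + 1 / u"] by (auto simp: U_def)
    qed (simp add: U_def)
  qed
  moreover have "U = (- {0} \<inter> (\<lambda>u. e + 1 / u) -` (- X)) \<union> ball 0 r"
    using calculation(2) r by (auto simp: U_def)
  ultimately show ?thesis by (metis open_Un open_ball)
qed

lemma mem_UI:
  assumes r: "r > 0" and C: "\<And>t. cmod t < r \<Longrightarrow> x + (u + t) *\<^sub>C w \<in> C"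
  shows "u \<in> U"
proof (rule ccontr)
  assume "u \<notin> U"
  then have u: "u \<noteq> 0" "e + 1 / u \<in> closure E" by (auto simp: U_def X_def)
  let ?T = "\<lambda>z. 1 / (z - e)"
  have "continuous_on (- {e}) ?T" by (intro continuous_intros) auto
  then have "open (- {e} \<inter> ?T -` ball u r)"
    by (intro continuous_open_preimage) (auto simp: open_Compl)
  moreover have "e + 1 / u \<in> - {e} \<inter> ?T -` ball u r" using u r by simp
  ultimately have "(- {e} \<inter> ?T -` ball u r) \<inter> E \<noteq> {}"
    using u(2) open_Int_closure_eq_empty by blast
  then obtain z where "z \<in> (- {e} \<inter> ?T -` ball u r) \<inter> E" by blast
  then have z: "z \<in> E" "z \<noteq> e" "dist u (?T z) < r" by auto
  have "x + (u + (?T z - u)) *\<^sub>C w \<in> C" using z(3) by (intro C) (simp add: dist_norm norm_minus_commute)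
  then have "x + ?T z *\<^sub>C w \<in> C" by simp
  then have "?T z *\<^sub>C (z *\<^sub>C x - y) \<in> C" using chart[of "?T z"] z(2) by simp
  then have "z *\<^sub>C x - y \<in> C" using C_scale_iff[of "?T z"] z(2) by simp
  then show False using z(1) by (simp add: E_set_def)
qed

end

context annular_pair
begin

text \<open>A point \<open>u0\<close> of \<open>U\<close> is joined to \<open>0\<close> by rotating \<open>x + u0 w\<close> and \<open>x\<close> into the convex cone \<open>R\<close> and
  projecting the segment between them. By \<open>interior_add\<close> it runs through inner points.\<close>

lemma connected_U: "connected U"
proof -
  have "\<exists>S. connected S \<and> S \<subseteq> U \<and> 0 \<in> S \<and> u0 \<in> S" if u0: "u0 \<in> U" for u0
  proof (cases "u0 = 0")
    case True
    then show ?thesis using u0 by (intro exI[of _ "{0}"]) auto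
  next
    case u0n: False
    have "0 \<in> U" by (simp add: U_def)
    then obtain r1 r2 where r1: "r1 > 0" "cball 0 r1 \<subseteq> U" and r2: "r2 > 0" "cball u0 r2 \<subseteq> U"
      using open_U u0 unfolding open_contains_cball by blast
    define r where "r = min r1 r2"
    have r: "r > 0" using r1 r2 by (simp add: r_def)
    have C1: "x + t *\<^sub>C w \<in> C" if "cmod t \<le> r" for t
      using that r1(2) by (intro U_in_C) (auto simp: r_def)
    have C2: "x + (u0 + t) *\<^sub>C w \<in> C" if "cmod t \<le> r" for t
      using that r2(2) by (intro U_in_C) (auto simp: r_def dist_norm subset_iff)
    obtain c where c: "c \<noteq> 0" "c *\<^sub>C (x + u0 *\<^sub>C w) \<in> R" using C_E[OF C2[of 0]] r by auto
    obtain c' where c': "c' \<noteq> 0" "c' *\<^sub>C x \<in> R" using C_E[OF x] by auto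
    define k where "k t = of_real (1 - t) * c + of_real t * c'" for t :: real
    define u where "u t = of_real (1 - t) * c * u0 / k t" for t :: real
    \<comment> \<open>the segment does not meet the line of \<open>w\<close>, which is not in the cone\<close>
    have k: "k t \<noteq> 0" if t: "0 \<le> t" "t \<le> 1" for t
    proof (cases "t = 1")
      case True
      then show ?thesis using c' by (simp add: k_def)
    next
      case False
      then have s: "0 < 1 - t" using t by simp
      show ?thesis
      proof
        assume k0: "k t = 0"
        have "(1 - t) *\<^sub>R (c *\<^sub>C (x + u0 *\<^sub>C w)) \<in> R" using s c(2) by (rule R_scale)
        moreover have "t *\<^sub>R (c' *\<^sub>C x) \<in> R"
          using c'(2) t zero_in_R by (cases "t = 0") (auto intro: R_scale)
        ultimately have "(1 - t) *\<^sub>R (c *\<^sub>C (x + u0 *\<^sub>C w)) + t *\<^sub>R (c' *\<^sub>C x) \<in> R" by (rule R_add)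
        also have "(1 - t) *\<^sub>R (c *\<^sub>C (x + u0 *\<^sub>C w)) + t *\<^sub>R (c' *\<^sub>C x) = k t *\<^sub>C x + (of_real (1 - t) * c * u0) *\<^sub>C w"
          by (simp add: scaleR_scaleC k_def scaleC_add_left scaleC_add_right scaleC_scaleC mult.assoc)
        also have "\<dots> = (of_real (1 - t) * c * u0) *\<^sub>C w" by (simp add: k0)
        finally have "(of_real (1 - t) * c * u0) *\<^sub>C w \<in> C" by (rule R_sub_C)
        moreover have "of_real (1 - t) * c * u0 \<noteq> 0" using s c u0n by simp
        ultimately show False using w_notin_C C_scale_iff by blast
      qed
    qed
    have uU: "u t \<in> U" if t: "0 \<le> t" "t \<le> 1" for t
    proof -
      consider "t = 0" | "t = 1" | "0 < t" "t < 1" using t by linarith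
      then show ?thesis
      proof cases
        case 1
        then show ?thesis using u0 c by (simp add: u_def k_def)
      next
        case 2
        then show ?thesis using \<open>0 \<in> U\<close> by (simp add: u_def)
      next
        case 3
        let ?c = "of_real (1 - t) * c" and ?d = "of_real t * c'"
        let ?p = "?c *\<^sub>C x + (?c * u0) *\<^sub>C w" and ?q = "?d *\<^sub>C x + 0 *\<^sub>C w"
        have "(1 - t) *\<^sub>R (c *\<^sub>C (x + u0 *\<^sub>C w)) \<in> R" using 3 c(2) by (intro R_scale) auto
        then have p: "?p \<in> R" by (simp add: scaleR_scaleC scaleC_add_right scaleC_scaleC mult.assoc)
        have "t *\<^sub>R (c' *\<^sub>C x) \<in> R" using 3 c'(2) by (intro R_scale) auto
        then have q: "?q \<in> R" by (simp add: scaleR_scaleC scaleC_scaleC)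
        have cn: "?c \<noteq> 0" "?d \<noteq> 0" using 3 c c' by auto
        define s where "s = r * min (cmod ?c) (cmod ?d)"
        have s: "s > 0" using r cn by (simp add: s_def)
        have sc: "s \<le> r * cmod ?c" "s \<le> r * cmod ?d" unfolding s_def using r by (auto intro: mult_left_mono)
        have "?p + v *\<^sub>C w \<in> C" if v: "cmod v \<le> s" for v
        proof -
          have "cmod v \<le> r * cmod ?c" using v sc by linarith
          then have "cmod (v / ?c) \<le> r" using cn(1) by (simp add: norm_divide divide_le_eq del: norm_mult)
          then have "?c *\<^sub>C (x + (u0 + v / ?c) *\<^sub>C w) \<in> C" by (intro C_scale C2 cn)
          also have "?c *\<^sub>C (x + (u0 + v / ?c) *\<^sub>C w) = ?c *\<^sub>C x + (?c * (u0 + v / ?c)) *\<^sub>C w"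
            by (simp only: scaleC_add_right scaleC_scaleC)
          also have "?c * (u0 + v / ?c) = ?c * u0 + v" using cn(1) by (simp add: distrib_left)
          finally show ?thesis by (simp only: scaleC_add_left add.assoc)
        qed
        moreover have "?q + v *\<^sub>C w \<in> C" if v: "cmod v \<le> s" for v
        proof -
          have "cmod v \<le> r * cmod ?d" using v sc by linarith
          then have "cmod (v / ?d) \<le> r" using cn(2) by (simp add: norm_divide divide_le_eq del: norm_mult)
          then have "?d *\<^sub>C (x + (v / ?d) *\<^sub>C w) \<in> C" by (intro C_scale C1 cn)
          also have "?d *\<^sub>C (x + (v / ?d) *\<^sub>C w) = ?d *\<^sub>C x + (?d * (v / ?d)) *\<^sub>C w"
            by (simp only: scaleC_add_right scaleC_scaleC)
          also have "?d * (v / ?d) = v" using cn(2) by simp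
          finally show ?thesis by simp
        qed
        moreover have kt: "?c + ?d \<noteq> 0" using k[OF t] by (simp add: k_def)
        ultimately have main: "?p + ?q + v *\<^sub>C w \<in> C" if "cmod v \<le> s / 4" for v
          using interior_add[OF p q refl cn(1) refl cn(2) _ s _ _ that] by blast
        have kc: "0 < cmod (k t)" using k[OF t] by simp
        show ?thesis
        proof (rule mem_UI)
          show "0 < s / (4 * cmod (k t))" using s kc by simp
          fix v assume v: "cmod v < s / (4 * cmod (k t))"
          then have "cmod (k t * v) \<le> s / 4" using kc by (simp add: norm_mult field_simps)
          from main[OF this] have "?p + ?q + (k t * v) *\<^sub>C w \<in> C" .
          also have "?p + ?q + (k t * v) *\<^sub>C w = k t *\<^sub>C x + (?c * u0 + k t * v) *\<^sub>C w"
            by (simp add: k_def scaleC_add_left)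
          also have "?c * u0 + k t * v = k t * (u t + v)" using k[OF t] by (simp add: u_def distrib_left)
          finally have "k t *\<^sub>C (x + (u t + v) *\<^sub>C w) \<in> C" by (simp add: scaleC_add_right scaleC_scaleC)
          then show "x + (u t + v) *\<^sub>C w \<in> C" using C_scale_iff[OF k[OF t]] by simp
        qed
      qed
    qed
    have "continuous_on {0..1} u" unfolding u_def
      using k by (intro continuous_intros) (auto simp: k_def intro!: continuous_intros)
    then have "connected (u ` {0..1})" by (intro connected_continuous_image) auto
    moreover have "u ` {0..1} \<subseteq> U" using uU by auto
    moreover have "u 1 = 0" "u 0 = u0" using c by (auto simp: u_def k_def)
    then have "0 \<in> u ` {0..1}" "u0 \<in> u ` {0..1}" by (auto simp: image_iff intro: bexI[of _ 0] bexI[of _ 1])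
    ultimately show ?thesis by blast
  qed
  then have "\<forall>u0\<in>U. \<exists>S. connected S \<and> S \<subseteq> U \<and> 0 \<in> S \<and> u0 \<in> S" by blast
  then have "U = \<Union>{S. connected S \<and> S \<subseteq> U \<and> 0 \<in> S}" by blast
  moreover have "connected (\<Union>{S. connected S \<and> S \<subseteq> U \<and> (0::complex) \<in> S})"
    by (rule connected_Union) auto
  ultimately show ?thesis by metis
qed

text \<open>The set \<open>E(x,y)\<close> is the union of the disks where the angle form of two forms \<open>m\<close> and \<open>l\<close> is negative.
  The zeros \<open>ratio m\<close> and \<open>ratio l\<close> of \<open>m (z x - y)\<close> and \<open>l (z x - y)\<close> lie on the boundary of such a
  disk, and the set of all these zeros is connected since the forms form a convex cone.\<close>

definition "ratio m = m y / m x"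
definition "ratios = ratio ` {m \<in> M. m x \<noteq> 0}"

lemma ratio_zero: "m \<in> M \<Longrightarrow> m x \<noteq> 0 \<Longrightarrow> m (ratio m *\<^sub>C x - y) = 0"
  by (simp add: lin ratio_def)

lemma connected_ratios: "connected ratios"
proof -
  have "\<exists>S. connected S \<and> S \<subseteq> ratios \<and> ratio m \<in> S \<and> ratio l \<in> S"
    if m: "m \<in> M" "m x \<noteq> 0" and l: "l \<in> M" "l x \<noteq> 0" for m l
  proof -
    define f where "f t = (\<lambda>v. of_real (1 - t) * m v + of_real t * l v)" for t :: real
    have fM: "f t \<in> M" if "t \<in> {0..1}" for t
      unfolding f_def using that by (intro quadrant_forms_combine m l) auto
    have fx: "f t x \<noteq> 0" if t: "t \<in> {0..1}" for t
    proof (cases "t = 0")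
      case False
      then show ?thesis unfolding f_def using t by (intro sum_nonzero m l x) auto
    qed (simp add: f_def m)
    have "continuous_on {0..1} (\<lambda>t. ratio (f t))"
      unfolding ratio_def using fx by (intro continuous_intros) (auto simp: f_def intro!: continuous_intros)
    then have "connected ((\<lambda>t. ratio (f t)) ` {0..1})" by (intro connected_continuous_image) auto
    moreover have "(\<lambda>t. ratio (f t)) ` {0..1} \<subseteq> ratios" unfolding ratios_def using fM fx by blast
    moreover have "ratio (f 0) = ratio m" "ratio (f 1) = ratio l" by (simp_all add: f_def)
    then have "ratio m \<in> (\<lambda>t. ratio (f t)) ` {0..1}" "ratio l \<in> (\<lambda>t. ratio (f t)) ` {0..1}"
      by (metis atLeastAtMost_iff image_eqI order_refl zero_le_one)+
    ultimately show ?thesis by blast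
  qed
  then have "\<forall>p\<in>ratios. \<forall>q\<in>ratios. \<exists>S. connected S \<and> S \<subseteq> ratios \<and> p \<in> S \<and> q \<in> S"
    unfolding ratios_def by auto
  then have "\<forall>p\<in>ratios. \<forall>q\<in>ratios. connected_component ratios p q"
    unfolding connected_component_def by blast
  then show ?thesis by (rule connected_iff_connected_component[THEN iffD2])
qed

text \<open>If \<open>m\<close> vanishes at a vector \<open>v = z x - y\<close> of \<open>C\<close>, some form \<open>l\<close> does not, and to first order the angle form of
  \<open>m\<close> and \<open>l\<close> near \<open>z\<close> is a nonzero real-linear function. Hence it is negative arbitrarily close to \<open>z\<close>.\<close>

lemma ratios_sub_X: "ratios \<subseteq> X"
proof
  fix z assume "z \<in> ratios"
  then obtain m where m: "m \<in> M" "m x \<noteq> 0" "z = ratio m" by (auto simp: ratios_def)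
  let ?v = "z *\<^sub>C x - y"
  have mv: "m ?v = 0" using ratio_zero m by simp
  show "z \<in> X"
  proof (cases "?v \<in> C")
    case False
    then show ?thesis using E_sub_X by (auto simp: E_set_def)
  next
    case True
    then obtain l where l: "l \<in> M" "l ?v \<noteq> 0" using form_nonzero lin_indep2D(3)[OF indep] by metis
    \<comment> \<open>moving \<open>z\<close> by \<open>- s q\<close> makes the linear term equal to \<open>- s \<bar>l v\<bar>\<^sup>2\<close>\<close>
    define q where "q = l ?v / m x"
    have "((\<lambda>s. Re (l ?v * cnj (l ?v - of_real s * q * l x))) \<longlongrightarrow> Re (l ?v * cnj (l ?v - of_real 0 * q * l x))) (at_right 0)"
      by (intro tendsto_intros)
    moreover have "0 < Re (l ?v * cnj (l ?v - of_real 0 * q * l x))"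
      using l(2) by (simp add: complex_neq_0 power2_eq_square[symmetric])
    ultimately have ev1: "\<forall>\<^sub>F s in at_right 0. 0 < Re (l ?v * cnj (l ?v - of_real s * q * l x))"
      by (rule order_tendstoD)
    show ?thesis unfolding X_def closure_approachable
    proof (intro allI impI)
      fix d :: real assume d: "0 < d"
      have "((\<lambda>s. s * cmod q) \<longlongrightarrow> 0 * cmod q) (at_right 0)" by (intro tendsto_intros)
      then have "\<forall>\<^sub>F s in at_right 0. s * cmod q < d" using d by (intro order_tendstoD) auto
      moreover have "\<forall>\<^sub>F s in at_right 0. (0::real) < s" by (rule eventually_at_right_less)
      ultimately have "\<forall>\<^sub>F s in at_right 0. 0 < Re (l ?v * cnj (l ?v - of_real s * q * l x)) \<and> s * cmod q < d \<and> 0 < s"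
        using ev1 by eventually_elim simp
      then have "\<exists>s. 0 < Re (l ?v * cnj (l ?v - of_real s * q * l x)) \<and> s * cmod q < d \<and> 0 < s"
        by (rule eventually_happens'[OF trivial_limit_at_right_real])
      then obtain s where s: "0 < Re (l ?v * cnj (l ?v - of_real s * q * l x))" "s * cmod q < d" "0 < s" by blast
      let ?z = "z - of_real s * q"
      have "m (?z *\<^sub>C x - y) = m ?v - of_real s * q * m x" "l (?z *\<^sub>C x - y) = l ?v - of_real s * q * l x"
        using m l by (simp_all add: lin algebra_simps)
      then have "m (?z *\<^sub>C x - y) * cnj (l (?z *\<^sub>C x - y)) = - of_real s * (l ?v * cnj (l ?v - of_real s * q * l x))"
        using m mv by (simp add: q_def)
      then have "angle_form m l (?z *\<^sub>C x - y) = - s * Re (l ?v * cnj (l ?v - of_real s * q * l x))"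
        unfolding angle_form_def by (simp only:) simp
      then have "angle_form m l (?z *\<^sub>C x - y) < 0" using s by (simp add: mult_neg_pos)
      then have "?z \<in> E" using angle_form_nonneg[OF m(1) l(1)] by (fastforce simp: E_set_def)
      moreover have "dist ?z z < d" using s by (simp add: dist_norm norm_mult)
      ultimately show "\<exists>z'\<in>E. dist z' z < d" by blast
    qed
  qed
qed

text \<open>A point where the angle form of \<open>m\<close> and \<open>l\<close> is negative is joined to the zero of \<open>m\<close> by a
  segment. Along it the angle form is a combination of its value at the end point and of
  \<open>Re (m u * cnj (l v))\<close>, which differs from this value by a nonpositive term.\<close>

lemma E_segment:
  assumes z: "z \<in> E" obtains z0 where "z0 \<in> ratios" "closed_segment z0 z \<subseteq> ratios \<union> E"
proof -
  have "z *\<^sub>C x - y \<notin> C" using z by (simp add: E_set_def)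
  moreover have "finite {x}" "{x} \<subseteq> C - {0}" using x lin_indep2D(1)[OF indep] by auto
  ultimately obtain m l where ml: "m \<in> M" "l \<in> M" "angle_form m l (z *\<^sub>C x - y) < 0" "m x \<noteq> 0" "l x \<noteq> 0"
    using not_in_C_nonzero[of "z *\<^sub>C x - y" "{x}"] by (metis insertI1)
  define z0 where "z0 = ratio m"
  let ?v = "z0 *\<^sub>C x - y" and ?u = "z *\<^sub>C x - y"
  have mv: "m ?v = 0" using ratio_zero ml by (simp add: z0_def)
  have mu: "m ?u = (z - z0) * m x" and lu: "l ?u = l ?v + (z - z0) * l x"
    using mv ml by (simp_all add: lin algebra_simps)
  have "m ?u * (l x / m x) = (z - z0) * l x" unfolding mu using ml(4) by simp
  then have lv: "l ?v = l ?u - m ?u * (l x / m x)" using lu by simp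
  have "m ?u * cnj (l ?v) = m ?u * cnj (l ?u) - (m ?u * cnj (m ?u)) * cnj (l x / m x)"
    by (simp only: lv complex_cnj_diff complex_cnj_mult right_diff_distrib mult.assoc)
  then have "Re (m ?u * cnj (l ?v)) = angle_form m l ?u - (cmod (m ?u))\<^sup>2 * Re (cnj (l x / m x))"
    unfolding angle_form_def by (simp only: minus_complex.sel Re_mult_cnj_self)
  moreover have "0 \<le> Re (cnj (l x / m x))" using Re_quotient_nonneg[OF ml(2,1) x] by (simp only: cnj.sel)
  ultimately have neg: "Re (m ?u * cnj (l ?v)) < 0" using ml(3) by (smt (verit) mult_nonneg_nonneg zero_le_power2)
  have "closed_segment z0 z \<subseteq> ratios \<union> E"
  proof
    fix p assume "p \<in> closed_segment z0 z"
    then obtain t where t: "0 \<le> t" "t \<le> 1" "p = z0 + of_real t * (z - z0)"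
      by (auto simp: closed_segment_def scaleR_conv_of_real algebra_simps)
    show "p \<in> ratios \<union> E"
    proof (cases "t = 0")
      case True
      then show ?thesis using t ml by (auto simp: ratios_def z0_def)
    next
      case False
      have pz: "p - z0 = of_real t * (z - z0)" using t(3) by simp
      have "m (p *\<^sub>C x - y) = m ?v + (p - z0) * m x" using ml by (simp add: lin algebra_simps)
      then have mp: "m (p *\<^sub>C x - y) = of_real t * m ?u" unfolding pz mv mu by simp
      have "l (p *\<^sub>C x - y) = l ?v + (p - z0) * l x" using ml by (simp add: lin algebra_simps)
      then have lp: "l (p *\<^sub>C x - y) = of_real (1 - t) * l ?v + of_real t * l ?u"
        unfolding pz lu by (simp add: algebra_simps)
      have "m (p *\<^sub>C x - y) * cnj (l (p *\<^sub>C x - y))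
        = of_real (t * (1 - t)) * (m ?u * cnj (l ?v)) + of_real (t * t) * (m ?u * cnj (l ?u))"
        unfolding mp lp by (simp add: algebra_simps)
      then have "angle_form m l (p *\<^sub>C x - y) = t * (1 - t) * Re (m ?u * cnj (l ?v)) + t * t * angle_form m l ?u"
        unfolding angle_form_def by (simp only: plus_complex.sel times_complex.sel Re_complex_of_real Im_complex_of_real)
      moreover have "t * (1 - t) * Re (m ?u * cnj (l ?v)) \<le> 0" using t neg by (intro mult_nonneg_nonpos) auto
      moreover have "t * t * angle_form m l ?u < 0" using t False ml(3) by (intro mult_pos_neg) auto
      ultimately have "angle_form m l (p *\<^sub>C x - y) < 0" by linarith
      then show ?thesis using angle_form_nonneg[OF ml(1,2)] by (fastforce simp: E_set_def)
    qed
  qed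
  moreover have "z0 \<in> ratios" using ml by (auto simp: ratios_def z0_def)
  ultimately show thesis using that by blast
qed

lemma connected_X: "connected X"
proof -
  obtain z0 where z0: "z0 \<in> ratios" by (rule E_segment[OF e])
  have "\<forall>z\<in>ratios \<union> E. \<exists>S. connected S \<and> S \<subseteq> ratios \<union> E \<and> z0 \<in> S \<and> z \<in> S"
  proof
    fix z assume "z \<in> ratios \<union> E"
    then show "\<exists>S. connected S \<and> S \<subseteq> ratios \<union> E \<and> z0 \<in> S \<and> z \<in> S"
    proof
      assume "z \<in> ratios"
      then show ?thesis using z0 connected_ratios by (intro exI[of _ ratios]) auto
    next
      assume "z \<in> E"
      then obtain z1 where z1: "z1 \<in> ratios" "closed_segment z1 z \<subseteq> ratios \<union> E" by (rule E_segment)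
      have "connected (ratios \<union> closed_segment z1 z)"
        using z1 connected_ratios by (intro connected_Un connected_segment) auto
      then show ?thesis using z0 z1 by (intro exI[of _ "ratios \<union> closed_segment z1 z"]) auto
    qed
  qed
  then have "ratios \<union> E = \<Union>{S. connected S \<and> S \<subseteq> ratios \<union> E \<and> z0 \<in> S}" by blast
  moreover have "connected (\<Union>{S. connected S \<and> S \<subseteq> ratios \<union> E \<and> z0 \<in> S})"
    by (rule connected_Union) auto
  ultimately have "connected (ratios \<union> E)" by metis
  then show ?thesis
  proof (rule connected_intermediate_closure)
    show "ratios \<union> E \<subseteq> X" using ratios_sub_X E_sub_X by blast
    show "X \<subseteq> closure (ratios \<union> E)" unfolding X_def by (rule closure_mono) auto
  qed
qed

text \<open>The complement of \<open>U\<close> is the image of \<open>X\<close> under a map that sends \<open>e\<close> to infinity,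
  so the winding number of a loop in \<open>U\<close> is constant along \<open>X\<close> and zero near \<open>e\<close>.\<close>

lemma simply_connected_U: "simply_connected U"
  unfolding simply_connected_eq_winding_number_zero[OF open_U]
proof (intro conjI allI impI connected_U)
  fix g z assume "path g \<and> path_image g \<subseteq> U \<and> pathfinish g = pathstart g \<and> z \<notin> U"
  then have g: "path g" "path_image g \<subseteq> U" "pathfinish g = pathstart g" and z: "z \<notin> U" by auto
  define N where "N v = (if v = e then 0 else winding_number g (1 / (v - e)))" for v
  have notin: "1 / (v - e) \<notin> path_image g" if "v \<in> X" "v \<noteq> e" for v
    using that g(2) by (auto simp: U_def)
  obtain B where B: "\<And>v. B \<le> cmod v \<Longrightarrow> winding_number g v = 0"
    using winding_number_zero_at_infinity[OF g(1,3)] by blast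
  have "isCont N v" if v: "v \<in> X" for v
  proof (cases "v = e")
    case True
    \<comment> \<open>within distance \<open>d\<close> of \<open>e\<close> the point \<open>1 / (v - e)\<close> is far away from the loop\<close>
    define d where "d = 1 / (\<bar>B\<bar> + 1)"
    have "N u = 0" if "u \<in> ball e d" for u
    proof (cases "u = e")
      case False
      then have "0 < cmod (u - e)" "cmod (u - e) < d" using that by (auto simp: dist_norm norm_minus_commute)
      then have "\<bar>B\<bar> + 1 < 1 / cmod (u - e)" by (simp add: d_def field_simps)
      then show ?thesis using False by (simp add: N_def B norm_divide)
    qed (simp add: N_def)
    moreover have "e \<in> ball e d" by (simp add: d_def)
    ultimately have "\<forall>\<^sub>F u in nhds e. N u = (\<lambda>u. 0) u"
      by (intro eventually_nhds_in_open[THEN eventually_mono, of "ball e d"]) auto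
    then show ?thesis unfolding True by (subst isCont_cong) auto
  next
    case False
    have "isCont (winding_number g) (1 / (v - e))"
      using continuous_at_winding_number[OF g(1) notin[OF v False]] .
    moreover have "isCont (\<lambda>u. 1 / (u - e)) v" using False by (intro continuous_intros) auto
    ultimately have "isCont (\<lambda>u. winding_number g (1 / (u - e))) v"
      by (rule isCont_o2[rotated])
    moreover have "\<forall>\<^sub>F u in nhds v. N u = winding_number g (1 / (u - e))"
      using False by (intro eventually_nhds_in_open[THEN eventually_mono, of "- {e}"]) (auto simp: N_def)
    ultimately show ?thesis by (subst isCont_cong) auto
  qed
  then have cont: "continuous_on X N" by (intro continuous_at_imp_continuous_on) auto
  have int: "N v \<in> \<int>" if "v \<in> X" for v
    using integer_winding_number[OF g(1,3) notin[OF that]] by (auto simp: N_def)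
  have "N constant_on X"
  proof (rule continuous_discrete_range_constant[OF connected_X cont])
    fix v assume v: "v \<in> X"
    have "1 \<le> cmod (N u - N v)" if u: "u \<in> X" "N u \<noteq> N v" for u
    proof -
      have "N u - N v \<in> \<int>" using int u v by auto
      then obtain n where "N u - N v = of_int n" by (auto elim: Ints_cases)
      moreover from this have "n \<noteq> 0" using u(2) by auto
      ultimately show ?thesis by simp
    qed
    then show "\<exists>d>0. \<forall>u. u \<in> X \<and> N u \<noteq> N v \<longrightarrow> d \<le> cmod (N u - N v)" by (intro exI[of _ 1]) auto
  qed
  moreover have "e \<in> X" using e E_sub_X by blast
  moreover have z': "z \<noteq> 0" "e + 1 / z \<in> X" using z by (auto simp: U_def)
  ultimately have "N (e + 1 / z) = N e" unfolding constant_on_def by metis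
  then show "winding_number g z = 0" using z' by (simp add: N_def)
qed

end

section \<open>Holomorphic maps of the disk\<close>

lemma one_minus_Moebius:
  "(cmod (1 + cnj b * k))\<^sup>2 - (cmod (k + b))\<^sup>2 = (1 - (cmod b)\<^sup>2) * (1 - (cmod k)\<^sup>2)"
  unfolding cmod_power2 by (simp add: power2_eq_square algebra_simps)

text \<open>A coarse form of the Schwarz-Pick lemma, convenient because it can be iterated: the defect
  \<open>1 - \<bar>h\<bar>\<^sup>2\<close> loses at most a constant factor from \<open>0\<close> to \<open>z\<close>. The factor \<open>1/4\<close> is from \<open>\<bar>1 + cnj b k\<bar> \<le> 2\<close>
  in the formula for \<open>h z\<close> in terms of \<open>k z\<close>, the value after moving \<open>b = h 0\<close> to \<open>0\<close>.\<close>

lemma Schwarz_Pick_coarse: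
  assumes h: "h holomorphic_on ball 0 1" and lt: "\<And>z. z \<in> ball 0 1 \<Longrightarrow> h z \<in> ball 0 1"
    and z: "z \<in> ball 0 1"
  shows "(1 - (cmod (h 0))\<^sup>2) * (1 - (cmod z)\<^sup>2) / 4 \<le> 1 - (cmod (h z))\<^sup>2"
proof -
  define b where "b = h 0"
  have b: "cmod b < 1" using lt[of 0] by (simp add: b_def)
  define k where "k z = Moebius_function 0 b (h z)" for z
  have k_lt: "cmod (k z) < 1" if "z \<in> ball 0 1" for z
    unfolding k_def using lt[OF that] b by (intro Moebius_function_norm_lt_1) auto
  have "Moebius_function 0 b \<circ> h holomorphic_on ball 0 1"
    by (rule holomorphic_on_compose_gen[OF h Moebius_function_holomorphic[OF b]]) (use lt in auto)
  then have "k holomorphic_on ball 0 1" by (simp add: k_def[abs_def] o_def)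
  then have "cmod (k z) \<le> cmod z"
    by (rule Schwarz_Lemma(1)) (use z k_lt in \<open>auto simp: k_def b_def Moebius_function_eq_zero\<close>)
  then have kz: "(cmod (k z))\<^sup>2 \<le> (cmod z)\<^sup>2" by simp
  have "h z = Moebius_function 0 (- b) (k z)"
    using Moebius_function_compose[of "- b" b "h z"] b lt[OF z] by (simp add: k_def)
  then have hz: "h z = (k z + b) / (1 + cnj b * k z)" by (simp add: Moebius_function_simple)
  have "cmod (cnj b * k z) < 1"
    using norm_mult_less[of "cnj b" 1 "k z" 1] b k_lt[OF z] by simp
  then have le: "cmod (1 + cnj b * k z) \<le> 2" and nz: "1 + cnj b * k z \<noteq> 0"
    using norm_triangle_ineq[of 1 "cnj b * k z"] by (auto simp: add_eq_0_iff)
  let ?N = "(cmod (1 + cnj b * k z))\<^sup>2"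
  have N: "0 < ?N" "?N \<le> 4" using nz power_mono[OF le norm_ge_zero, of 2] by auto
  have "1 - (cmod (h z))\<^sup>2 = (?N - (cmod (k z + b))\<^sup>2) / ?N"
    unfolding hz norm_divide power_divide using N(1) by (simp add: diff_divide_distrib)
  also have "\<dots> = (1 - (cmod b)\<^sup>2) * (1 - (cmod (k z))\<^sup>2) / ?N" unfolding one_minus_Moebius ..
  finally have eq: "1 - (cmod (h z))\<^sup>2 = (1 - (cmod b)\<^sup>2) * (1 - (cmod (k z))\<^sup>2) / ?N" .
  have "0 \<le> 1 - (cmod b)\<^sup>2" "0 \<le> 1 - (cmod (k z))\<^sup>2" using b k_lt[OF z] by (auto simp: abs_square_le_1)
  then have "(1 - (cmod b)\<^sup>2) * (1 - (cmod z)\<^sup>2) / 4 \<le> (1 - (cmod b)\<^sup>2) * (1 - (cmod (k z))\<^sup>2) / ?N"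
    using kz N by (intro frac_le mult_left_mono mult_nonneg_nonneg) auto
  then show ?thesis unfolding eq b_def .
qed

lemma disk_distance_0_le:
  assumes p: "cmod p < 1"
  shows "disk_distance 0 p \<le> ennreal (2 / (1 - (cmod p)\<^sup>2))"
proof -
  let ?g = "linepath 0 p"
  have D: "0 < 1 - (cmod p)\<^sup>2" using p by (simp add: abs_square_less_1)
  have "closed_segment 0 p \<subseteq> ball 0 1" using p by (intro closed_segment_subset) auto
  then have "disk_distance 0 p \<le> disk_length ?g" unfolding disk_distance_def
    by (intro Inf_lower CollectI exI[of _ ?g]) auto
  also have "\<dots> \<le> (\<integral>\<^sup>+ t\<in>{0..1::real}. ennreal (2 / (1 - (cmod p)\<^sup>2)) \<partial>lborel)"
    unfolding disk_length_def
  proof (intro nn_integral_mono)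
    fix t :: real
    show "ennreal (2 * cmod (vector_derivative ?g (at t)) / (1 - (cmod (?g t))\<^sup>2)) * indicator {0..1} t
      \<le> ennreal (2 / (1 - (cmod p)\<^sup>2)) * indicator {0..1} t"
    proof (cases "t \<in> {0..1}")
      case True
      have "cmod (?g t) = t * cmod p" using True by (simp add: linepath_def)
      also have "\<dots> \<le> cmod p" using True by (intro mult_left_le_one_le) auto
      finally have "(cmod (?g t))\<^sup>2 \<le> (cmod p)\<^sup>2" by (intro power_mono) auto
      then have "2 * cmod p / (1 - (cmod (?g t))\<^sup>2) \<le> 2 / (1 - (cmod p)\<^sup>2)"
        using D p by (intro frac_le) auto
      then show ?thesis by (intro mult_right_mono ennreal_leI) auto
    qed simp
  qed
  also have "\<dots> = ennreal (2 / (1 - (cmod p)\<^sup>2))" by (simp add: nn_integral_cmult_indicator)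
  finally show ?thesis .
qed

section \<open>A Riemann map of \<open>L(x,y)\<close>\<close>

context annular_pair
begin

lemma e_in_X: "e \<in> X" using e E_sub_X by blast

lemma interior_L: "interior (L_set C x y) = insert None (Some ` (- X))"
proof -
  have pre: "Some -` L_set C x y = - E" by (auto simp: L_set_def E_set_def)
  have "Some z \<in> interior (L_set C x y) \<longleftrightarrow> z \<notin> X" for z
    unfolding Some_in_interior_iff pre X_def by (simp add: interior_complement)
  moreover have "None \<in> interior (L_set C x y)" unfolding None_in_interior_iff
  proof (intro conjI exI[of _ "K * a"] allI impI)
    fix z assume "K * a < cmod z"
    then have "z \<notin> E" using annulus[of z] by auto
    then show "Some z \<in> L_set C x y" by (auto simp: L_set_def E_set_def)
  qed (simp add: L_set_def)
  ultimately have "s \<in> interior (L_set C x y) \<longleftrightarrow> s \<in> insert None (Some ` (- X))" for s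
    by (cases s) auto
  then show ?thesis by blast
qed

lemma far_from_origin:
  assumes "u \<noteq> 0" "cmod u < 1 / (\<bar>r\<bar> + cmod e + 1)" shows "r < cmod (e + 1 / u)"
proof -
  have pos: "0 < \<bar>r\<bar> + cmod e + 1" by (simp add: add_nonneg_pos)
  have "\<bar>r\<bar> + cmod e + 1 < 1 / cmod u" using assms pos by (simp add: field_simps)
  also have "1 / cmod u = cmod (1 / u)" by (simp add: norm_divide)
  also have "\<dots> \<le> cmod (e + 1 / u) + cmod e" using norm_triangle_ineq4[of "e + 1 / u" e] by simp
  finally show ?thesis by linarith
qed

definition "to_sphere u = (if u = 0 then None else Some (e + 1 / u))"
definition "to_plane s = (case s of None \<Rightarrow> 0 | Some z \<Rightarrow> 1 / (z - e))"

lemma to_plane_to_sphere: "to_plane (to_sphere u) = u"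
  by (simp add: to_plane_def to_sphere_def)

lemma to_sphere_to_plane: "s \<in> interior (L_set C x y) \<Longrightarrow> to_sphere (to_plane s) = s"
  using e_in_X by (auto simp: interior_L to_plane_def to_sphere_def)

lemma to_sphere_in: "u \<in> U \<Longrightarrow> to_sphere u \<in> interior (L_set C x y)"
  by (auto simp: U_def to_sphere_def interior_L)

lemma to_plane_in: "s \<in> interior (L_set C x y) \<Longrightarrow> to_plane s \<in> U"
  using e_in_X by (auto simp: U_def to_plane_def interior_L)

lemma continuous_to_sphere: "continuous_on UNIV to_sphere"
  unfolding continuous_on_open_vimage[OF open_UNIV]
proof (intro allI impI)
  fix B :: "riemann_sphere set" assume B: "open B"
  have "continuous_on (- {0}) (\<lambda>u. e + 1 / u)" by (intro continuous_intros) auto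
  moreover have "open (Some -` B)" using B by (simp add: open_sphere_iff)
  ultimately have op: "open (- {0} \<inter> (\<lambda>u. e + 1 / u) -` (Some -` B))"
    by (intro continuous_open_preimage) (auto simp: open_Compl)
  show "open (to_sphere -` B \<inter> UNIV)"
  proof (cases "None \<in> B")
    case False
    then have "to_sphere -` B \<inter> UNIV = - {0} \<inter> (\<lambda>u. e + 1 / u) -` (Some -` B)"
      by (auto simp: to_sphere_def split: if_splits)
    then show ?thesis using op by simp
  next
    case True
    then obtain r where r: "\<forall>z. r < cmod z \<longrightarrow> Some z \<in> B" using B by (auto simp: open_sphere_iff)
    let ?V = "ball 0 (1 / (\<bar>r\<bar> + cmod e + 1))"
    have "to_sphere u \<in> B" if "u \<in> ?V" for u
      using that r far_from_origin[of u r] True by (auto simp: to_sphere_def)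
    moreover have "0 \<in> ?V" by (simp add: add_nonneg_pos)
    ultimately have "to_sphere -` B \<inter> UNIV = (- {0} \<inter> (\<lambda>u. e + 1 / u) -` (Some -` B)) \<union> ?V"
      by (auto simp: to_sphere_def split: if_splits)
    then show ?thesis using op by (metis open_Un open_ball)
  qed
qed

lemma continuous_to_plane: "continuous_on (interior (L_set C x y)) to_plane"
  unfolding continuous_on_open_vimage[OF open_interior]
proof (intro allI impI)
  fix B :: "complex set" assume B: "open B"
  have X: "closed X" by (simp add: X_def)
  have "continuous_on (- X) (\<lambda>z. 1 / (z - e))" using e_in_X by (intro continuous_intros) auto
  then have "open (- X \<inter> (\<lambda>z. 1 / (z - e)) -` B)"
    using X B by (intro continuous_open_preimage) (auto simp: open_Compl)
  moreover have "Some -` (to_plane -` B \<inter> interior (L_set C x y)) = - X \<inter> (\<lambda>z. 1 / (z - e)) -` B"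
    by (auto simp: interior_L to_plane_def)
  moreover have "\<exists>r. \<forall>z. r < cmod z \<longrightarrow> Some z \<in> to_plane -` B \<inter> interior (L_set C x y)"
    if "None \<in> to_plane -` B \<inter> interior (L_set C x y)"
  proof -
    have "0 \<in> B" using that by (simp add: to_plane_def)
    then obtain d where d: "d > 0" "ball 0 d \<subseteq> B" using B by (auto simp: open_contains_ball)
    have "Some z \<in> to_plane -` B \<inter> interior (L_set C x y)" if z: "max (K * a) (cmod e + 1 / d) < cmod z" for z
    proof -
      have "z \<notin> X" using z X_annulus[of z] by auto
      moreover have "1 / d < cmod (z - e)" using z norm_triangle_ineq2[of z e] by linarith
      then have "cmod (1 / (z - e)) < d" using d(1) by (simp add: norm_divide field_simps)
        (metis mult.commute zero_less_mult_pos2 less_trans zero_less_one divide_pos_pos pos_divide_less_eq)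
      then have "1 / (z - e) \<in> B" using d by auto
      ultimately show ?thesis by (auto simp: interior_L to_plane_def)
    qed
    then show ?thesis by blast
  qed
  ultimately show "open (to_plane -` B \<inter> interior (L_set C x y))" unfolding open_sphere_iff by simp
qed

lemma minus_inverse_e_in_U: "- 1 / e \<in> U"
  using X_annulus[of 0] a e_nonzero by (auto simp: U_def)

lemma U_not_UNIV: "U \<noteq> UNIV"
proof -
  obtain r where r: "r > 0" "ball e r \<subseteq> E" using open_E e by (auto simp: open_contains_ball)
  let ?z = "e + of_real (r / 2)"
  have "?z \<in> ball e r" using r by (simp add: dist_norm norm_divide)
  then have "?z \<in> X" using r E_sub_X by blast
  then have "1 / of_real (r / 2) \<notin> U" using r by (simp add: U_def)
  then show ?thesis by blast
qed

lemma Riemann_map: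
  obtains F G where "F holomorphic_on U" "G holomorphic_on ball 0 1"
    "\<And>u. u \<in> U \<Longrightarrow> F u \<in> ball 0 1 \<and> G (F u) = u" "\<And>z. z \<in> ball 0 1 \<Longrightarrow> G z \<in> U \<and> F (G z) = z"
    "F (- 1 / e) = 0"
proof -
  have "U \<noteq> {}" using minus_inverse_e_in_U by blast
  then obtain f g where f: "f holomorphic_on U" and g: "g holomorphic_on ball 0 1"
    and fg: "\<forall>u\<in>U. f u \<in> ball 0 1 \<and> g (f u) = u" and gf: "\<forall>z\<in>ball 0 1. g z \<in> U \<and> f (g z) = z"
    using Riemann_mapping_theorem[of U] open_U simply_connected_U U_not_UNIV by blast
  define p where "p = f (- 1 / e)"
  have p: "cmod p < 1" using fg minus_inverse_e_in_U by (auto simp: p_def)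
  let ?m = "Moebius_function 0 p" and ?n = "Moebius_function 0 (- p)"
  have m: "?m z \<in> ball 0 1" "?n z \<in> ball 0 1" "?n (?m z) = z" "?m (?n z) = z" if "z \<in> ball 0 1" for z
    using that p Moebius_function_norm_lt_1[of p z 0] Moebius_function_norm_lt_1[of "- p" z 0]
      Moebius_function_compose[of "- p" p z] Moebius_function_compose[of p "- p" z] by auto
  show thesis
  proof (rule that[of "?m \<circ> f" "g \<circ> ?n"])
    show "?m \<circ> f holomorphic_on U"
      by (rule holomorphic_on_compose_gen[OF f Moebius_function_holomorphic[OF p]]) (use fg in auto)
    have "?n holomorphic_on ball 0 1" using p by (intro Moebius_function_holomorphic) simp
    then show "g \<circ> ?n holomorphic_on ball 0 1"
      by (rule holomorphic_on_compose_gen[OF _ g]) (use m(2) in blast)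
    show "(?m \<circ> f) u \<in> ball 0 1 \<and> (g \<circ> ?n) ((?m \<circ> f) u) = u" if "u \<in> U" for u
      using fg m that by simp
    show "(g \<circ> ?n) z \<in> U \<and> (?m \<circ> f) ((g \<circ> ?n) z) = z" if "z \<in> ball 0 1" for z
      using gf m that by simp
    show "(?m \<circ> f) (- 1 / e) = 0" unfolding o_def p_def by (rule Moebius_function_eq_zero)
  qed
qed

lemma holomorphic_to_sphere_compose:
  assumes G: "G holomorphic_on ball 0 1"
  shows "holomorphic_to_sphere (to_sphere \<circ> G) (ball 0 1)"
  unfolding holomorphic_to_sphere_def
proof (intro conjI ballI impI)
  have cont: "continuous_on (ball 0 1) G" using G by (rule holomorphic_on_imp_continuous_on)
  show "continuous_on (ball 0 1) (to_sphere \<circ> G)"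
    using cont continuous_on_subset[OF continuous_to_sphere] by (intro continuous_on_compose) auto
  fix z :: complex assume z: "z \<in> ball 0 1"
  have Gz: "G field_differentiable at z" using G z by (auto intro: holomorphic_on_imp_differentiable_at)
  show "(\<lambda>v. case (to_sphere \<circ> G) v of Some u \<Rightarrow> u | None \<Rightarrow> 0) field_differentiable at z"
    if "(to_sphere \<circ> G) z \<noteq> None"
  proof (rule field_differentiable_eventually_eq)
    have nz: "G z \<noteq> 0" using that by (auto simp: to_sphere_def)
    then show "(\<lambda>v. e + 1 / G v) field_differentiable at z" using Gz by (intro derivative_intros) auto
    show "open (ball 0 1 \<inter> G -` (- {0}))"
      by (intro continuous_open_preimage cont) (auto simp: open_Compl)
    show "z \<in> ball 0 1 \<inter> G -` (- {0})" using z nz by simp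
  qed (auto simp: to_sphere_def)
  show "(\<lambda>v. case (to_sphere \<circ> G) v of Some u \<Rightarrow> inverse u | None \<Rightarrow> 0) field_differentiable at z"
    if "(to_sphere \<circ> G) z = None"
  proof (rule field_differentiable_eventually_eq)
    have Gz0: "G z = 0" using that by (auto simp: to_sphere_def split: if_splits)
    then show "(\<lambda>v. G v / (1 + e * G v)) field_differentiable at z" using Gz by (intro derivative_intros) auto
    have "continuous_on (ball 0 1) (\<lambda>v. 1 + e * G v)" by (intro continuous_intros cont)
    then show "open (ball 0 1 \<inter> (\<lambda>v. 1 + e * G v) -` (- {0}))"
      by (intro continuous_open_preimage) (auto simp: open_Compl)
    show "z \<in> ball 0 1 \<inter> (\<lambda>v. 1 + e * G v) -` (- {0})" using z Gz0 by simp
    fix v assume "v \<in> ball 0 1 \<inter> (\<lambda>v. 1 + e * G v) -` (- {0})"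
    then have "1 + e * G v \<noteq> 0" by auto
    then have "G v / (1 + e * G v) = inverse (e + 1 / G v)" if "G v \<noteq> 0"
      using that by (simp add: field_simps)
    then show "G v / (1 + e * G v) = (case (to_sphere \<circ> G) v of Some u \<Rightarrow> inverse u | None \<Rightarrow> 0)"
      by (auto simp: to_sphere_def)
  qed
qed simp

text \<open>A Riemann map of \<open>U\<close>, read on the sphere, is one of the coverings over which the Poincare distance
  of \<open>L(x,y)\<close> is an infimum. It is normalized at the point \<open>z = 0\<close>, which is \<open>u = - 1/e\<close>.\<close>

theorem d_gauge_le_disk_distance:
  obtains F where "F holomorphic_on U" "\<forall>u\<in>U. F u \<in> ball 0 1" "F (- 1 / e) = 0"
    "d_gauge C x y \<le> disk_distance 0 (F 0)"
proof -
  obtain F G where F: "F holomorphic_on U" and G: "G holomorphic_on ball 0 1"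
    and FG: "\<And>u. u \<in> U \<Longrightarrow> F u \<in> ball 0 1 \<and> G (F u) = u"
    and GF: "\<And>z. z \<in> ball 0 1 \<Longrightarrow> G z \<in> U \<and> F (G z) = z" and F0: "F (- 1 / e) = 0"
    using Riemann_map by metis
  let ?L = "interior (L_set C x y)"
  let ?f = "to_sphere \<circ> G"
  have hol: "holomorphic_to_sphere ?f (ball 0 1)" by (rule holomorphic_to_sphere_compose[OF G])
  have "homeomorphism (ball 0 1) ?L ?f (F \<circ> to_plane)"
  proof (rule homeomorphismI)
    show "continuous_on (ball 0 1) ?f" using hol by (simp add: holomorphic_to_sphere_def)
    have "to_plane ` ?L \<subseteq> U" using to_plane_in by blast
    then show "continuous_on ?L (F \<circ> to_plane)"
      using continuous_to_plane continuous_on_subset[OF holomorphic_on_imp_continuous_on[OF F]]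
      by (intro continuous_on_compose) auto
  qed (use FG GF to_sphere_in to_plane_in in \<open>auto simp: to_sphere_to_plane to_plane_to_sphere\<close>)
  then have cov: "covering_space (ball 0 1) ?f ?L" by (rule homeomorphism_imp_covering_space)
  have "0 \<in> U" by (simp add: U_def)
  have "G 0 = - 1 / e" using FG[OF minus_inverse_e_in_U] F0 by simp
  then have "?f 0 = Some 0" using e_nonzero by (simp add: to_sphere_def)
  moreover have "?f (F 0) = None" using FG[OF \<open>0 \<in> U\<close>] by (simp add: to_sphere_def)
  moreover have "F 0 \<in> ball 0 1" using FG[OF \<open>0 \<in> U\<close>] by simp
  ultimately have "poincare_distance ?L (Some 0) None \<le> disk_distance 0 (F 0)"
    unfolding poincare_distance_def using hol cov
    by (intro Inf_lower CollectI exI[of _ ?f] exI[of _ 0] exI[of _ "F 0"]) auto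
  moreover have "Some 0 \<in> ?L" "None \<in> ?L" using X_annulus[of 0] a by (auto simp: interior_L)
  ultimately have "d_gauge C x y \<le> disk_distance 0 (F 0)" using indep by (simp add: d_gauge_def)
  then show thesis using F FG F0 by (intro that[of F]) auto
qed

end

section \<open>A finite annulus bounds the hyperbolic distance\<close>

context annular_pair
begin

text \<open>Let \<open>c1 x\<close> and \<open>c2 y\<close> be in \<open>R\<close>. All \<open>c2 y + t c1 x\<close> with \<open>t > 0\<close> are in \<open>R\<close>, which
  gives a ray from \<open>0\<close> to infinity outside \<open>E(x,y)\<close>. A whole sector around it, of an opening that depends only on \<open>K\<close>,
  is outside too: the angle form at \<open>c2 y + t c1 x\<close> is \<open>A + Re (t S) + \<bar>t\<bar>\<^sup>2 B\<close> with \<open>0 \<le> Re S\<close>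
  because both vectors are in \<open>R\<close>, and \<open>b \<bar>S\<bar> \<le> A + b\<^sup>2 B\<close> because the circle \<open>\<bar>z\<bar> = a/2\<close> is
  outside \<open>E(x,y)\<close>; so only \<open>\<bar>Im t\<bar>\<close> has to be small.\<close>

lemma sector_avoids_X:
  obtains v where "cmod v = 1" "\<forall>z. 0 < Re (z / v) \<and> \<bar>Im (z / v)\<bar> < cmod z / (2 * K) \<longrightarrow> z \<notin> X"
proof -
  obtain c1 where c1: "c1 \<noteq> 0" "c1 *\<^sub>C x \<in> R" using C_E[OF x] by auto
  obtain c2 where c2: "c2 \<noteq> 0" "c2 *\<^sub>C y \<in> R" using C_E[OF y] by auto
  define r where "r = cmod (c2 / c1)"
  have r: "r > 0" using c1 c2 by (simp add: r_def)
  \<comment> \<open>the direction of the ray, chosen so that \<open>z x - y\<close> is a multiple of \<open>c2 y + (r z / v) c1 x\<close>\<close>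
  define v where "v = - of_real r * c1 / c2"
  have v: "cmod v = 1" using c1 c2 by (simp add: v_def r_def norm_mult norm_divide)
  then have v0: "v \<noteq> 0" by auto
  let ?x = "c1 *\<^sub>C x" and ?y = "c2 *\<^sub>C y"
  have conv: "?y + t *\<^sub>C ?x = (- c2) *\<^sub>C ((v * t / of_real r) *\<^sub>C x - y)" for t
    using c1 c2 r by (simp add: v_def complex_vector.scale_right_diff_distrib scaleC_scaleC)
  have nrm: "cmod (v * t / of_real r) = cmod t / r" for t
    using r v by (simp add: norm_mult norm_divide)
  have main: "z *\<^sub>C x - y \<in> C" if z: "0 < Re (z / v)" "\<bar>Im (z / v)\<bar> < cmod z / (2 * K)" for z
  proof (cases "a \<le> cmod z \<and> cmod z \<le> K * a")
    case False
    then show ?thesis using annulus[of z] by (auto simp: E_set_def)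
  next
    case True
    define t where "t = of_real r * (z / v)"
    have zt: "v * t / of_real r = z" using r v0 by (simp add: t_def)
    have t: "cmod t = r * cmod z" using r v by (simp add: t_def norm_mult norm_divide)
    have "Re t = r * Re (z / v)" "Im t = r * Im (z / v)"
      unfolding t_def by (simp_all only: times_complex.sel Re_complex_of_real Im_complex_of_real)
    then have Ret: "0 \<le> Re t" and "\<bar>Im t\<bar> = r * \<bar>Im (z / v)\<bar>" using r z by (simp_all add: abs_mult)
    moreover have "r * \<bar>Im (z / v)\<bar> \<le> r * (cmod z / (2 * K))"
      using r z(2) by (intro mult_left_mono) linarith+
    ultimately have "\<bar>Im t\<bar> \<le> r * (cmod z / (2 * K))" by linarith
    then have Imt: "\<bar>Im t\<bar> \<le> cmod t / (2 * K)" by (simp add: t)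
    define b where "b = r * a / 2"
    have b: "b > 0" using r a by (simp add: b_def)
    have tb: "2 * b \<le> cmod t" "cmod t \<le> 2 * K * b"
      using True r by (simp_all add: t b_def)
    have "?y + t *\<^sub>C ?x \<in> C" unfolding C_iff
    proof (intro ballI)
      fix m l assume ml: "m \<in> M" "l \<in> M"
      define S where "S = m ?x * cnj (l ?y) + cnj (m ?y) * l ?x"
      let ?A = "angle_form m l ?y" and ?B = "angle_form m l ?x"
      have add: "angle_form m l (?y + s *\<^sub>C ?x) = ?A + Re (s * S) + (cmod s)\<^sup>2 * ?B" for s
        unfolding S_def by (rule angle_form_add_scale[OF ml])
      have A: "0 \<le> ?A" "0 \<le> ?B" by (intro angle_form_nonneg ml R_sub_C c1 c2)+
      have "0 \<le> Re (m ?x * cnj (l ?y))" "0 \<le> Re (l ?x * cnj (m ?y))"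
        by (intro quadrant_angle quadrant_forms_mem[OF ml(1)] quadrant_forms_mem[OF ml(2)] c1 c2)+
      then have ReS: "0 \<le> Re S" unfolding S_def by (simp add: mult.commute)
      have bS: "b * cmod S \<le> ?A + b\<^sup>2 * ?B"
      proof (cases "S = 0")
        case False
        \<comment> \<open>the point of modulus \<open>b\<close> at which the linear term is smallest\<close>
        let ?s = "- of_real (b / cmod S) * cnj S"
        have s: "cmod ?s = b" using b False by (simp add: norm_mult norm_divide)
        have "cmod (v * ?s / of_real r) = a / 2" unfolding nrm s using r by (simp add: b_def)
        then have "v * ?s / of_real r \<notin> E" using annulus[of "v * ?s / of_real r"] a by auto
        then have "?y + ?s *\<^sub>C ?x \<in> C"
          unfolding conv by (intro C_scale) (use c2 in \<open>auto simp: E_set_def\<close>)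
        then have "0 \<le> ?A + Re (?s * S) + b\<^sup>2 * ?B" using angle_form_nonneg[OF ml] add[of ?s] s by metis
        moreover have "?s * S = - of_real (b / cmod S * (cmod S)\<^sup>2)"
          unfolding of_real_mult complex_norm_square by (simp add: mult.assoc mult.commute)
        then have "Re (?s * S) = - (b / cmod S * (cmod S)\<^sup>2)" by (simp only: uminus_complex.sel Re_complex_of_real)
        then have "Re (?s * S) = - (b * cmod S)" using False by (simp add: power2_eq_square)
        ultimately show ?thesis by linarith
      qed (use A b in simp)
      have "- (\<bar>Im t\<bar> * cmod S) \<le> Re (t * S)"
      proof -
        have "Im t * Im S \<le> \<bar>Im t\<bar> * cmod S"
        proof -
          have "\<bar>Im t\<bar> * \<bar>Im S\<bar> \<le> \<bar>Im t\<bar> * cmod S" by (intro mult_left_mono abs_Im_le_cmod) simp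
          then show ?thesis using abs_ge_self[of "Im t * Im S"] by (simp add: abs_mult)
        qed
        moreover have "0 \<le> Re t * Re S" using Ret ReS by simp
        ultimately show ?thesis by simp
      qed
      moreover have "\<bar>Im t\<bar> * cmod S \<le> ?A + (cmod t)\<^sup>2 * ?B"
      proof -
        have "\<bar>Im t\<bar> * cmod S \<le> cmod t / (2 * K) * cmod S" using Imt by (intro mult_right_mono) auto
        also have "\<dots> = cmod t / (2 * K * b) * (b * cmod S)" using b by simp
        also have "\<dots> \<le> cmod t / (2 * K * b) * (?A + b\<^sup>2 * ?B)"
          using bS b K by (intro mult_left_mono) auto
        also have "\<dots> = cmod t / (2 * K * b) * ?A + cmod t * (b / (2 * K)) * ?B"
          using b K by (simp add: field_simps power2_eq_square)
        also have "\<dots> \<le> 1 * ?A + cmod t * cmod t * ?B"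
        proof (intro add_mono mult_right_mono mult_left_mono A)
          show "cmod t / (2 * K * b) \<le> 1" using tb b K by simp
          have "b / (2 * K) \<le> b / 1" using b K by (intro divide_left_mono) auto
          then show "b / (2 * K) \<le> cmod t" using tb b by linarith
        qed auto
        finally show ?thesis by (simp add: power2_eq_square)
      qed
      ultimately show "0 \<le> angle_form m l (?y + t *\<^sub>C ?x)" unfolding add by linarith
    qed
    then show ?thesis unfolding conv zt using C_scale_iff[of "- c2"] c2(1) by simp
  qed
  let ?S = "{z. 0 < Re (z / v) \<and> \<bar>Im (z / v)\<bar> < cmod z / (2 * K)}"
  have "open ?S" using v0 K by (intro open_Collect_conj open_Collect_less continuous_intros) auto
  moreover have "?S \<inter> E = {}" using main by (auto simp: E_set_def)
  ultimately have "?S \<inter> X = {}" unfolding X_def using open_Int_closure_eq_empty by blast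
  then show thesis using v by (intro that[of v]) auto
qed

lemma to_plane_holomorphic:
  assumes f: "f holomorphic_on S" and X: "\<And>z. z \<in> S \<Longrightarrow> f z \<notin> X"
  shows "(\<lambda>z. 1 / (f z - e)) holomorphic_on S" "\<And>z. z \<in> S \<Longrightarrow> 1 / (f z - e) \<in> U"
proof -
  have "f z - e \<noteq> 0" if "z \<in> S" for z using X[OF that] e_in_X by auto
  then show "(\<lambda>z. 1 / (f z - e)) holomorphic_on S" by (intro holomorphic_intros f) auto
  show "1 / (f z - e) \<in> U" if "z \<in> S" for z using X[OF that] by (auto simp: U_def)
qed

text \<open>Three holomorphic maps of the disk into \<open>L(x,y)\<close> lead from \<open>0\<close> to infinity along the axis of the
  sector: a multiple of the identity from \<open>0\<close> to \<open>v a/2\<close>, the exponential of a strip, which lies in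
  the sector, from \<open>v a/2\<close> to \<open>3 K a v\<close>, and a disk in the chart \<open>1/z\<close> from there to infinity.
  Composed with the Riemann map \<open>F\<close> they become maps of the disk into itself, and
  \<open>Schwarz_Pick_coarse\<close> keeps \<open>F\<close> at infinity away from the unit circle. The quotient of the
  two intermediate points is \<open>6 K\<close>, and \<open>T\<close> and \<open>s\<close> are chosen so that the second map sends \<open>s\<close> to
  the second of them.\<close>

theorem d_gauge_bound:
  defines "T \<equiv> (6 * K) powr (pi * K)"
  defines "s \<equiv> (T - 1) / (T + 1)"
  shows "d_gauge C x y \<le> ennreal (2 / (3/16 * ((1 - s\<^sup>2) / 4) * (3/16)))"
proof -
  obtain F where F: "F holomorphic_on U" "\<forall>u\<in>U. F u \<in> ball 0 1" "F (- 1 / e) = 0"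
    and d: "d_gauge C x y \<le> disk_distance 0 (F 0)"
    using d_gauge_le_disk_distance by blast
  obtain v where v: "cmod v = 1" "\<forall>z. 0 < Re (z / v) \<and> \<bar>Im (z / v)\<bar> < cmod z / (2 * K) \<longrightarrow> z \<notin> X"
    using sector_avoids_X by blast
  then have v0: "v \<noteq> 0" by auto
  define D where "D u = 1 - (cmod (F u))\<^sup>2" for u
  have step: "D (h 0) * (1 - (cmod z)\<^sup>2) / 4 \<le> D (h z)"
    if "h holomorphic_on ball 0 1" "\<And>z. z \<in> ball 0 1 \<Longrightarrow> h z \<in> U" "z \<in> ball 0 1" for h z
  proof -
    have "F \<circ> h holomorphic_on ball 0 1"
      by (rule holomorphic_on_compose_gen[OF that(1) F(1)]) (use that in auto)
    then show ?thesis using Schwarz_Pick_coarse[of "F \<circ> h" z] that F(2) by (simp add: D_def)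
  qed
  define P where "P z = 1 / (z - e)" for z
  have T: "1 < T" unfolding T_def using K pi_gt_zero by (intro gr_one_powr) auto
  have s: "0 < s" "s < 1" "(1 + s) / (1 - s) = T" using T by (auto simp: s_def field_simps)
  have s2: "0 < 1 - s\<^sup>2" using s by (simp add: abs_square_less_1)
  have half: "1 - (1/2)\<^sup>2 = (3/4 :: real)" by (simp add: power2_eq_square)
  have D1: "3/16 \<le> D (P (v * of_real (a / 2)))"
  proof -
    let ?f = "\<lambda>z. v * of_real a * z"
    have nX: "?f z \<notin> X" if "z \<in> ball 0 1" for z
    proof -
      have "cmod (?f z) < a" using that v a by (simp add: norm_mult)
      then show ?thesis using X_annulus[of "?f z"] by auto
    qed
    have "?f holomorphic_on ball 0 1" by (intro holomorphic_intros)
    from step[OF to_plane_holomorphic[OF this nX], of "1/2"]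
    have "D (P (?f 0)) * (1 - (1/2)\<^sup>2) / 4 \<le> D (P (?f (1/2)))" by (simp add: P_def norm_divide)
    moreover have "P (?f 0) = - 1 / e" by (simp add: P_def)
    moreover have "D (- 1 / e) = 1" unfolding D_def F(3) by simp
    ultimately show ?thesis unfolding half by simp
  qed
  have D2: "D (P (v * of_real (a / 2))) * (1 - s\<^sup>2) / 4 \<le> D (P (v * of_real (3 * K * a)))"
  proof -
    \<comment> \<open>scales the strip \<open>\<bar>Im\<bar> < \<pi>/2\<close> to \<open>\<bar>Im\<bar> < 1/(2 K)\<close>, which the exponential maps into the sector\<close>
    define k where "k = 1 / (pi * K)"
    have k: "k > 0" using K by (simp add: k_def)
    define w' where "w' z = (1 + z) / (1 - z)" for z :: complex
    let ?f = "\<lambda>z. v * of_real (a / 2) * exp (of_real k * Ln (w' z))"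
    have Re_w: "0 < Re (w' z)" if "z \<in> ball 0 1" for z
    proof -
      have "Re ((1 + z) * cnj (1 - z)) = 1 - (cmod z)\<^sup>2" unfolding cmod_power2 by (simp add: power2_eq_square algebra_simps)
      moreover have "0 < 1 - (cmod z)\<^sup>2" using that by (simp add: abs_square_less_1)
      moreover have "1 - z \<noteq> 0" using that by auto
      ultimately show ?thesis unfolding w'_def Re_divide_cnj by simp
    qed
    have hol: "?f holomorphic_on ball 0 1"
    proof -
      have "w' holomorphic_on ball 0 1" unfolding w'_def by (intro holomorphic_intros) auto
      moreover have "w' z \<notin> \<real>\<^sub>\<le>\<^sub>0" if "z \<in> ball 0 1" for z
        using Re_w[OF that] by (auto simp: complex_nonpos_Reals_iff)
      ultimately show ?thesis by (intro holomorphic_intros) auto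
    qed
    have nX: "?f z \<notin> X" if z: "z \<in> ball 0 1" for z
    proof (rule v(2)[rule_format], intro conjI)
      let ?i = "k * Im (Ln (w' z))"
      let ?r = "a / 2 * exp (k * Re (Ln (w' z)))"
      have r: "?r > 0" using a by simp
      have "w' z \<noteq> 0" using Re_w[OF z] by auto
      then have "\<bar>Im (Ln (w' z))\<bar> < pi / 2" using Re_Ln_pos_lt[of "w' z"] Re_w[OF z] by simp
      then have "k * \<bar>Im (Ln (w' z))\<bar> < k * (pi / 2)" using k by (intro mult_strict_left_mono)
      then have i: "\<bar>?i\<bar> < 1 / (2 * K)" using k K by (simp add: abs_mult k_def)
      have "1 / (2 * K) \<le> 1 / 2" using K by simp
      then have "\<bar>?i\<bar> < 1 / 2" using i by linarith
      then have "\<bar>?i\<bar> < pi / 2" using pi_gt3 by linarith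
      then have cos: "0 < cos ?i" by (intro cos_gt_zero_pi) linarith+
      have sin: "\<bar>sin ?i\<bar> < 1 / (2 * K)" using abs_sin_x_le_abs_x[of ?i] i by linarith
      have fv: "?f z / v = of_real (a / 2) * exp (of_real k * Ln (w' z))" using v0 by simp
      have Re: "Re (?f z / v) = ?r * cos ?i" and Im: "Im (?f z / v) = ?r * sin ?i"
        unfolding fv by (simp_all add: Re_exp Im_exp)
      have nf: "cmod (?f z) = ?r" using v(1) a by (simp add: norm_mult)
      show "0 < Re (?f z / v)" unfolding Re using r cos by simp
      have "?r * \<bar>sin ?i\<bar> < ?r * (1 / (2 * K))" using r sin by (intro mult_strict_left_mono)
      then show "\<bar>Im (?f z / v)\<bar> < cmod (?f z) / (2 * K)" unfolding Im nf using r a by (simp add: abs_mult)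
    qed
    have "of_real s \<in> ball (0::complex) 1" using s by simp
    from step[OF to_plane_holomorphic[OF hol nX] this]
    have "D (P (?f 0)) * (1 - s\<^sup>2) / 4 \<le> D (P (?f (of_real s)))" using s by (simp add: P_def)
    moreover have "?f 0 = v * of_real (a / 2)" by (simp add: w'_def)
    moreover have "?f (of_real s) = v * of_real (3 * K * a)"
    proof -
      have "w' (of_real s) = of_real ((1 + s) / (1 - s))" unfolding w'_def by simp
      then have "w' (of_real s) = of_real T" using s(3) by simp
      then have "Ln (w' (of_real s)) = of_real (ln T)" using T by (simp add: Ln_of_real)
      then have "exp (of_real k * Ln (w' (of_real s))) = of_real (exp (k * ln T))"
        by (simp flip: exp_of_real)
      also have "k * ln T = ln (6 * K)" unfolding T_def k_def using K by (simp add: ln_powr)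
      also have "exp (ln (6 * K)) = 6 * K" using K by simp
      finally show ?thesis by simp
    qed
    ultimately show ?thesis by metis
  qed
  have D3: "D (P (v * of_real (3 * K * a))) * (3/16) \<le> D 0"
  proof -
    define b where "b = K * a"
    have b: "b > 0" using K a by (simp add: b_def)
    let ?q = "\<lambda>z. (1 + 2 * z) / (of_real (3 * b) * v)"
    let ?h = "\<lambda>z. ?q z / (1 - e * ?q z)"
    have q: "cmod (?q z) < 1 / b" if "z \<in> ball 0 1" for z
    proof -
      have "cmod (1 + 2 * z) \<le> 1 + 2 * cmod z" using norm_triangle_ineq[of 1 "2 * z"] by (simp add: norm_mult)
      also have "\<dots> < 3" using that by simp
      finally show ?thesis using b v(1) by (simp add: norm_divide norm_mult divide_less_eq)
    qed
    have eq: "1 - e * ?q z \<noteq> 0" if "z \<in> ball 0 1" for z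
    proof -
      have "cmod (e * ?q z) \<le> b * cmod (?q z)" unfolding norm_mult using annulus[OF e]
        by (intro mult_right_mono) (auto simp: b_def)
      also have "\<dots> < b * (1 / b)" using q[OF that] b by (intro mult_strict_left_mono)
      finally have "cmod (e * ?q z) < 1" using b by simp
      then show ?thesis by (metis eq_iff_diff_eq_0 less_irrefl norm_one)
    qed
    have quot: "(1 - e * q) / q = 1 / q - e" if "q \<noteq> 0" for q
      using that by (simp add: field_simps)
    have hol: "?h holomorphic_on ball 0 1"
      using eq b v0 by (intro holomorphic_intros) auto
    have U: "?h z \<in> U" if z: "z \<in> ball 0 1" for z
    proof (cases "?q z = 0")
      case False
      have "e + 1 / ?h z = e + (1 - e * ?q z) / ?q z" by simp
      also have "\<dots> = 1 / ?q z" unfolding quot[OF False] by simp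
      finally have "e + 1 / ?h z = 1 / ?q z" .
      moreover have "b < cmod (1 / ?q z)"
      proof -
        have inv: "b < 1 / r" if "0 < r" "r < 1 / b" for r using that b by (simp add: field_simps)
        have "0 < cmod (?q z)" using False by simp
        from inv[OF this q[OF z]] show ?thesis by (simp only: norm_divide norm_one)
      qed
      ultimately have "e + 1 / ?h z \<notin> X" using X_annulus[of "1 / ?q z"] by (auto simp: b_def)
      then show ?thesis unfolding U_def by blast
    next
      case True
      then have "?h z = 0" by (simp only: div_0)
      then show ?thesis unfolding U_def by blast
    qed
    have "- 1 / 2 \<in> ball (0::complex) 1" by (simp add: norm_divide)
    from step[OF hol U this]
    have "D (?h 0) * (1 - (1/2)\<^sup>2) / 4 \<le> D (?h (- 1 / 2))" by (simp add: norm_divide)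
    moreover have "?h (- 1 / 2) = 0" by simp
    moreover have "?h 0 = P (v * of_real (3 * K * a))"
    proof -
      have q0: "?q 0 \<noteq> 0" using b v0 by simp
      have "?h 0 = 1 / ((1 - e * ?q 0) / ?q 0)" by simp
      also have "(1 - e * ?q 0) / ?q 0 = 1 / ?q 0 - e" by (rule quot[OF q0])
      also have "1 / ?q 0 = v * of_real (3 * K * a)" by (simp add: b_def)
      finally show ?thesis by (simp add: P_def)
    qed
    ultimately show ?thesis unfolding half by simp
  qed
  have "3/16 * ((1 - s\<^sup>2) / 4) * (3/16) \<le> D (P (v * of_real (a / 2))) * ((1 - s\<^sup>2) / 4) * (3/16)"
    using D1 s2 by (intro mult_right_mono) auto
  also have "\<dots> \<le> D (P (v * of_real (3 * K * a))) * (3/16)"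
    using D2 by (intro mult_right_mono) auto
  also have "\<dots> \<le> D 0" by (rule D3)
  finally have le: "3/16 * ((1 - s\<^sup>2) / 4) * (3/16) \<le> D 0" .
  have "F 0 \<in> ball 0 1" using F(2) by (simp add: U_def)
  then have "disk_distance 0 (F 0) \<le> ennreal (2 / D 0)" unfolding D_def by (intro disk_distance_0_le) simp
  also have "\<dots> \<le> ennreal (2 / (3/16 * ((1 - s\<^sup>2) / 4) * (3/16)))"
    using le s2 by (intro ennreal_leI divide_left_mono) auto
  finally show ?thesis using d by simp
qed

end

context quadrant_cone
begin

lemma delta_gauge_annulus:
  assumes xy: "x \<in> C" "y \<in> C" and indep: "lin_indep2 x y" and D: "0 \<le> D" and le: "delta_gauge C x y \<le> ennreal D"
  obtains a where "0 < a" "\<And>z. z \<in> E_set C x y \<Longrightarrow> a \<le> cmod z \<and> cmod z \<le> exp D * a"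
proof -
  let ?E = "E_set C x y"
  define B where "B = (SUP z\<in>?E. ennreal (cmod z))"
  define A where "A = (INF z\<in>?E. ennreal (cmod z))"
  have delta: "delta_gauge C x y = (if B = \<infinity> \<or> A = 0 then \<infinity> else ennreal (ln (enn2real B / enn2real A)))"
    using indep by (simp add: delta_gauge_def A_def B_def Let_def)
  have fin: "B \<noteq> \<infinity>" "A \<noteq> 0" using le unfolding delta by (auto simp: top_unique split: if_splits)
  obtain e where e: "e \<in> ?E" using E_set_nonempty[OF xy(2) indep xy(1)] by blast
  have AB: "A \<le> ennreal (cmod z)" "ennreal (cmod z) \<le> B" if "z \<in> ?E" for z
    unfolding A_def B_def using that by (auto intro: INF_lower SUP_upper)
  obtain b where b: "B = ennreal b" "0 \<le> b" using fin(1) by (cases B) auto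
  obtain a where a: "A = ennreal a" "0 \<le> a" using AB(1)[OF e] by (cases A) (auto simp: top_unique)
  have ab: "a \<le> cmod z" "cmod z \<le> b" if "z \<in> ?E" for z
    using AB[OF that] a b by (auto simp: ennreal_le_iff)
  have a0: "0 < a" using fin(2) a by (cases "a = 0") auto
  then have b0: "0 < b" using ab[OF e] by linarith
  have "ennreal (ln (b / a)) \<le> ennreal D" using le fin a b unfolding delta by simp
  then have "ln (b / a) \<le> D" using D by (simp add: ennreal_le_iff)
  then have "b / a \<le> exp D" using a0 b0 by (metis divide_pos_pos exp_le_cancel_iff exp_ln)
  then have "b \<le> exp D * a" using a0 by (simp add: divide_le_eq)
  then show thesis using a0 ab by (intro that[of a]) fastforce+
qed

end

section \<open>Finiteness of the three diameters\<close>

lemma cone_diameter_le: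
  assumes "\<And>x y. x \<in> A - {0} \<Longrightarrow> y \<in> A - {0} \<Longrightarrow> \<rho> x y \<le> ennreal c"
  shows "cone_diameter \<rho> A < \<infinity>"
proof -
  have "cone_diameter \<rho> A \<le> ennreal c" unfolding cone_diameter_def by (intro SUP_least assms)
  then show ?thesis by (simp add: le_less_trans)
qed

lemma cone_diameter_upper:
  "x \<in> A - {0} \<Longrightarrow> y \<in> A - {0} \<Longrightarrow> \<rho> x y \<le> cone_diameter \<rho> A"
  unfolding cone_diameter_def by (meson SUP_upper2 order_refl)

lemma cone_diameter_finiteE:
  assumes "cone_diameter \<rho> A < \<infinity>"
  obtains c where "0 \<le> c" "\<forall>x\<in>A - {0}. \<forall>y\<in>A - {0}. \<rho> x y \<le> ennreal c"
proof -
  obtain c where c: "cone_diameter \<rho> A = ennreal c" "0 \<le> c"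
    using assms by (cases "cone_diameter \<rho> A") auto
  then show thesis using cone_diameter_upper[of _ A _ \<rho>] by (intro that[of c]) auto
qed

theorem theorem5p6:
  fixes R C C\<^sub>1 :: "'a::cbanach set"
  assumes "closed_convex_cone R"
    and "cplx_cone C"
    and "condition_C1 R C"
    and "condition_C2 C"
    and "cplx_cone C\<^sub>1" and "C\<^sub>1 \<subseteq> C"
  shows "(cone_diameter (delta_gauge C) C\<^sub>1 < \<infinity> \<longrightarrow>
            cone_diameter (d_gauge C) C\<^sub>1 < \<infinity> \<and> cone_diameter (d_tilde C) C\<^sub>1 < \<infinity>) \<and>
         (cone_diameter (d_gauge C) C\<^sub>1 < \<infinity> \<longrightarrow>
            cone_diameter (delta_gauge C) C\<^sub>1 < \<infinity> \<and> cone_diameter (d_tilde C) C\<^sub>1 < \<infinity>) \<and>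
         (cone_diameter (d_tilde C) C\<^sub>1 < \<infinity> \<longrightarrow>
            cone_diameter (delta_gauge C) C\<^sub>1 < \<infinity> \<and> cone_diameter (d_gauge C) C\<^sub>1 < \<infinity>)"
proof -
  interpret quadrant_cone R C using assms by unfold_locales
  have sub: "x \<in> C - {0}" if "x \<in> C\<^sub>1 - {0}" for x using that assms(6) by blast
  have delta_d: "cone_diameter (d_gauge C) C\<^sub>1 < \<infinity>" if fin: "cone_diameter (delta_gauge C) C\<^sub>1 < \<infinity>"
  proof -
    obtain D where D: "0 \<le> D" "\<forall>x\<in>C\<^sub>1 - {0}. \<forall>y\<in>C\<^sub>1 - {0}. delta_gauge C x y \<le> ennreal D"
      using cone_diameter_finiteE[OF fin] by blast
    define T where "T = (6 * exp D) powr (pi * exp D)"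
    define s where "s = (T - 1) / (T + 1)"
    show ?thesis
    proof (rule cone_diameter_le)
      fix x y assume xy: "x \<in> C\<^sub>1 - {0}" "y \<in> C\<^sub>1 - {0}"
      show "d_gauge C x y \<le> ennreal (2 / (3/16 * ((1 - s\<^sup>2) / 4) * (3/16)))"
      proof (cases "lin_indep2 x y")
        case True
        have C: "x \<in> C" "y \<in> C" using sub xy by blast+
        obtain a where a: "0 < a" "\<And>z. z \<in> E_set C x y \<Longrightarrow> a \<le> cmod z \<and> cmod z \<le> exp D * a"
          using delta_gauge_annulus[OF C True D(1) D(2)[rule_format, OF xy]] by blast
        obtain e where "e \<in> E_set C x y" using E_set_nonempty[OF C(2) True C(1)] by blast
        then interpret annular_pair R C x y a "exp D" e
          using C True a D(1) by unfold_locales auto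
        show ?thesis using d_gauge_bound unfolding T_def s_def .
      qed (simp add: d_gauge_def)
    qed
  qed
  have d_dt: "cone_diameter (d_tilde C) C\<^sub>1 < \<infinity>" if fin: "cone_diameter (d_gauge C) C\<^sub>1 < \<infinity>"
  proof -
    have "cone_diameter (d_tilde C) C\<^sub>1 \<le> cone_diameter (d_gauge C) C\<^sub>1"
      unfolding cone_diameter_def[of "d_tilde C"]
      by (intro SUP_least order_trans[OF d_tilde_le_d_gauge] cone_diameter_upper sub)
    then show ?thesis using fin by (rule le_less_trans)
  qed
  have dt_delta: "cone_diameter (delta_gauge C) C\<^sub>1 < \<infinity>" if fin: "cone_diameter (d_tilde C) C\<^sub>1 < \<infinity>"
  proof -
    obtain c where c: "0 \<le> c" "\<forall>x\<in>C\<^sub>1 - {0}. \<forall>y\<in>C\<^sub>1 - {0}. d_tilde C x y \<le> ennreal c"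
      using cone_diameter_finiteE[OF fin] by blast
    show ?thesis
    proof (rule cone_diameter_le)
      fix x y assume xy: "x \<in> C\<^sub>1 - {0}" "y \<in> C\<^sub>1 - {0}"
      \<comment> \<open>the infimum defining \<open>d_tilde\<close> need not be attained by a chain\<close>
      have "ennreal c < ennreal (c + 1)" using c(1) by (simp add: ennreal_less_iff)
      then have "d_tilde C x y < ennreal (c + 1)" using c(2)[rule_format, OF xy] by (rule le_less_trans[rotated])
      then show "delta_gauge C x y \<le> ennreal (6 * (c + 1))"
        by (intro delta_gauge_le_d_tilde sub xy)
    qed
  qed
  show ?thesis using delta_d d_dt dt_delta by blast
qed

end
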